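(* Let $E$ be a Banach space with cotype $2$. Then for every Banach space $F$, every natural number $n$ and every $p$ with $0<p\leq 2$, $$\mathcal{P}_{[as,p]}(^{n}E;F)=\mathcal{P}_{[as,2]}(^{n}E;F)\quad\text{and}\quad \mathcal{P}_{d,p}(^{n}E;F)=\mathcal{P}_{d,2}(^{n}E;F).$$
   Context: Banach spaces are over $\mathbb{K}=\mathbb{R}$ or $\mathbb{C}$; $E'$ is the dual of $E$ and $B_{E'}$ its closed unit ball with the weak* topology. $\mathcal{P}(^{n}E;F)$ is the space of continuous $n$-homogeneous polynomials $E\to F$, and $\overset{\vee}{P}$ is the unique symmetric continuous $n$-linear mapping associated to $P$. $\mathcal{L}(E_1,\dots,E_n;F)$ is the space of continuous $n$-linear mappings, and $\mathcal{L}(^{k}E;F)$ is this space when all $k$ domain factors equal $E$. For $0<p<\infty$, a continuous linear operator $u:E\to F$ is absolutely $p$-summing ($u\in\mathcal{L}_{as,p}(E;F)$) if there is $C\ge 0$ with $\left(\sum_{j=1}^k\|u(x_j)\|^p\right)^{1/p}\le C\sup_{\varphi\in B_{E'}}\left(\sum_{j=1}^k|\varphi(x_j)|^p\right)^{1/p}$ for all $k$ and $x_1,\dots,x_k\in E$. $P\in\mathcal{P}_{[as,p]}(^{n}E;F)$ means: $P\in\mathcal{P}(^nE;F)$ and for every $i=1,\dots,n$ the linear operator $E\to\mathcal{L}(^{n-1}E;F)$ sending $x_i$ to $\big((x_j)_{j\ne i}\mapsto \overset{\vee}{P}(x_1,\dots,x_n)\big)$ is absolutely $p$-summing (for $n=1$: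 $P$ itself is absolutely $p$-summing). $P\in\mathcal{P}_{d,p}(^{n}E;F)$ ($P$ is $p$-dominated) means: $P\in\mathcal{P}(^nE;F)$ and there exist $C\ge0$ and a regular Borel probability measure $\mu$ on $B_{E'}$ such that $\|P(x)\|\le C\left[\int_{B_{E'}}|\varphi(x)|^p\,d\mu(\varphi)\right]^{n/p}$ for all $x\in E$. *)

theory Defs
  imports "HOL-Probability.Probability" "HOL-Combinatorics.Permutations"
begin

text \<open>The scalar field is the real or the complex field, up to isometric isomorphism.\<close>

class real_or_complex_field = real_normed_field +
  assumes real_or_complex:
    "\<exists>f :: 'a \<Rightarrow> complex.
       (\<forall>x y. f (x + y) = f x + f y) \<and> (\<forall>x y. f (x * y) = f x * f y) \<and>
       (\<forall>r x. f (r *\<^sub>R x) = r *\<^sub>R f x) \<and> (\<forall>x. norm (f x) = norm x) \<and>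
       (range f = \<real> \<or> range f = UNIV)"

instance real :: real_or_complex_field
proof
  show "\<exists>f :: real \<Rightarrow> complex.
       (\<forall>x y. f (x + y) = f x + f y) \<and> (\<forall>x y. f (x * y) = f x * f y) \<and>
       (\<forall>r x. f (r *\<^sub>R x) = r *\<^sub>R f x) \<and> (\<forall>x. norm (f x) = norm x) \<and>
       (range f = \<real> \<or> range f = UNIV)"
    by (rule exI[of _ complex_of_real]) (auto simp: Reals_def scaleR_conv_of_real)
qed

instance complex :: real_or_complex_field
proof
  show "\<exists>f :: complex \<Rightarrow> complex.
       (\<forall>x y. f (x + y) = f x + f y) \<and> (\<forall>x y. f (x * y) = f x * f y) \<and>
       (\<forall>r x. f (r *\<^sub>R x) = r *\<^sub>R f x) \<and> (\<forall>x. norm (f x) = norm x) \<and>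
       (range f = \<real> \<or> range f = UNIV)"
    by (rule exI[of _ id]) auto
qed

text \<open>A Banach space over \<open>'k\<close> is a type of class \<^class>\<open>banach\<close> together with a scalar
  multiplication \<open>s\<close> by elements of \<open>'k\<close> that extends the real one and for which the norm is
  homogeneous. For \<open>'k = real\<close> this forces \<open>s = (*\<^sub>R)\<close>.\<close>

definition normed_scaling ::
  "('k::real_or_complex_field \<Rightarrow> 'e::real_normed_vector \<Rightarrow> 'e) \<Rightarrow> bool"
  where "normed_scaling s \<longleftrightarrow>
    vector_space s \<and> (\<forall>r x. s (of_real r) x = r *\<^sub>R x) \<and>
    (\<forall>c x. norm (s c x) = norm c * norm x)"

definition rademacher :: "nat \<Rightarrow> real \<Rightarrow> real"
  where "rademacher j t = sgn (sin (2 ^ j * pi * t))"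

definition has_cotype :: "'e::real_normed_vector itself \<Rightarrow> real \<Rightarrow> bool"
  where "has_cotype _ q \<longleftrightarrow>
    (\<exists>C\<ge>0. \<forall>k. \<forall>x :: nat \<Rightarrow> 'e.
       (\<Sum>j=1..k. norm (x j) powr q) powr (1 / q)
       \<le> C * sqrt (LBINT t:{0..1}. (norm (\<Sum>j=1..k. rademacher j t *\<^sub>R x j))\<^sup>2))"

definition continuous_dual ::
  "('k::real_or_complex_field \<Rightarrow> 'e::real_normed_vector \<Rightarrow> 'e) \<Rightarrow> ('e \<Rightarrow> 'k) set"
  where "continuous_dual s = {\<phi>. Vector_Spaces.linear s (*) \<phi> \<and> continuous_on UNIV \<phi>}"

definition dual_ball ::
  "('k::real_or_complex_field \<Rightarrow> 'e::real_normed_vector \<Rightarrow> 'e) \<Rightarrow> ('e \<Rightarrow> 'k) set"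
  where "dual_ball s = {\<phi> \<in> continuous_dual s. onorm \<phi> \<le> 1}"

text \<open>The topology of the type \<open>'e \<Rightarrow> 'k\<close> is the product topology, that is, the topology of
  pointwise convergence; on the dual it induces the weak* topology.\<close>

definition dual_ball_topology ::
  "('k::real_or_complex_field \<Rightarrow> 'e::real_normed_vector \<Rightarrow> 'e) \<Rightarrow> ('e \<Rightarrow> 'k) topology"
  where "dual_ball_topology s = subtopology euclidean (dual_ball s)"

definition regular_borel_prob :: "'a topology \<Rightarrow> 'a measure \<Rightarrow> bool"
  where "regular_borel_prob T \<mu> \<longleftrightarrow>
    prob_space \<mu> \<and> space \<mu> = topspace T \<and>
    sets \<mu> = sigma_sets (topspace T) {U. openin T U} \<and>
    (\<forall>A\<in>sets \<mu>.
       emeasure \<mu> A = (INF U\<in>{U. openin T U \<and> A \<subseteq> U}. emeasure \<mu> U) \<and>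
       emeasure \<mu> A = (SUP K\<in>{K. compactin T K \<and> K \<subseteq> A}. emeasure \<mu> K))"

text \<open>An \<open>n\<close>-linear mapping on \<open>E \<times> \<dots> \<times> E\<close> is encoded as a function of sequences that depends
  only on the entries with index \<open>< n\<close>. Sequences carry the product topology, so for such
  functions continuity amounts to continuity on the \<open>n\<close>-fold product.\<close>

definition multilinear_maps ::
  "nat \<Rightarrow> ('k::real_or_complex_field \<Rightarrow> 'e::real_normed_vector \<Rightarrow> 'e)
    \<Rightarrow> ('k \<Rightarrow> 'f::real_normed_vector \<Rightarrow> 'f) \<Rightarrow> ((nat \<Rightarrow> 'e) \<Rightarrow> 'f) set"
  where "multilinear_maps n sE sF =
    {A. (\<forall>x y. (\<forall>i<n. x i = y i) \<longrightarrow> A x = A y) \<and>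
        (\<forall>x. \<forall>i<n. Vector_Spaces.linear sE sF (\<lambda>v. A (x(i := v)))) \<and>
        continuous_on UNIV A}"

definition multilinear_norm ::
  "nat \<Rightarrow> ((nat \<Rightarrow> 'e::real_normed_vector) \<Rightarrow> 'f::real_normed_vector) \<Rightarrow> real"
  where "multilinear_norm n A = (SUP x\<in>{x. \<forall>i<n. norm (x i) \<le> 1}. norm (A x))"

definition symmetric_map :: "nat \<Rightarrow> ((nat \<Rightarrow> 'e) \<Rightarrow> 'f) \<Rightarrow> bool"
  where "symmetric_map n A \<longleftrightarrow> (\<forall>\<pi> x. \<pi> permutes {..<n} \<longrightarrow> A (x \<circ> \<pi>) = A x)"

definition polynomials ::
  "nat \<Rightarrow> ('k::real_or_complex_field \<Rightarrow> 'e::real_normed_vector \<Rightarrow> 'e)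
    \<Rightarrow> ('k \<Rightarrow> 'f::real_normed_vector \<Rightarrow> 'f) \<Rightarrow> ('e \<Rightarrow> 'f) set"
  where "polynomials n sE sF = {P. \<exists>A\<in>multilinear_maps n sE sF. \<forall>x. P x = A (\<lambda>_. x)}"

definition polar ::
  "nat \<Rightarrow> ('k::real_or_complex_field \<Rightarrow> 'e::real_normed_vector \<Rightarrow> 'e)
    \<Rightarrow> ('k \<Rightarrow> 'f::real_normed_vector \<Rightarrow> 'f) \<Rightarrow> ('e \<Rightarrow> 'f) \<Rightarrow> (nat \<Rightarrow> 'e) \<Rightarrow> 'f"
  where "polar n sE sF P =
    (THE A. A \<in> multilinear_maps n sE sF \<and> symmetric_map n A \<and> (\<forall>x. P x = A (\<lambda>_. x)))"

definition insert_at :: "nat \<Rightarrow> 'e \<Rightarrow> (nat \<Rightarrow> 'e) \<Rightarrow> nat \<Rightarrow> 'e"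
  where "insert_at i v y = (\<lambda>j. if j < i then y j else if j = i then v else y (j - 1))"

text \<open>The target is a normed space given by its carrier \<open>G\<close>, addition \<open>add\<close>, scalar
  multiplication \<open>sG\<close> and norm \<open>nrm\<close>, because the target spaces of multilinear mappings below
  are not types. The supremum is over a nonempty bounded set of reals.\<close>

definition absolutely_summing ::
  "real \<Rightarrow> ('k::real_or_complex_field \<Rightarrow> 'e::real_normed_vector \<Rightarrow> 'e)
    \<Rightarrow> 'g set \<Rightarrow> ('g \<Rightarrow> 'g \<Rightarrow> 'g) \<Rightarrow> ('k \<Rightarrow> 'g \<Rightarrow> 'g) \<Rightarrow> ('g \<Rightarrow> real) \<Rightarrow> ('e \<Rightarrow> 'g) \<Rightarrow> bool"
  where "absolutely_summing p sE G add sG nrm u \<longleftrightarrow>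
    (\<forall>x. u x \<in> G) \<and> (\<forall>x y. u (x + y) = add (u x) (u y)) \<and>
    (\<forall>c x. u (sE c x) = sG c (u x)) \<and> (\<exists>B. \<forall>x. nrm (u x) \<le> B * norm x) \<and>
    (\<exists>C\<ge>0. \<forall>k. \<forall>x :: nat \<Rightarrow> 'e.
       (\<Sum>j=1..k. nrm (u (x j)) powr p) powr (1 / p)
       \<le> C * (SUP \<phi>\<in>dual_ball sE. (\<Sum>j=1..k. norm (\<phi> (x j)) powr p) powr (1 / p)))"

definition as_polynomials ::
  "real \<Rightarrow> nat \<Rightarrow> ('k::real_or_complex_field \<Rightarrow> 'e::real_normed_vector \<Rightarrow> 'e)
    \<Rightarrow> ('k \<Rightarrow> 'f::real_normed_vector \<Rightarrow> 'f) \<Rightarrow> ('e \<Rightarrow> 'f) set"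
  where "as_polynomials p n sE sF =
    {P \<in> polynomials n sE sF.
       if n = 1 then absolutely_summing p sE UNIV (+) sF norm P
       else \<forall>i<n. absolutely_summing p sE
              (multilinear_maps (n - 1) sE sF) (\<lambda>A B y. A y + B y) (\<lambda>c A y. sF c (A y))
              (multilinear_norm (n - 1))
              (\<lambda>v y. polar n sE sF P (insert_at i v y))}"

definition dominated_polynomials ::
  "real \<Rightarrow> nat \<Rightarrow> ('k::real_or_complex_field \<Rightarrow> 'e::real_normed_vector \<Rightarrow> 'e)
    \<Rightarrow> ('k \<Rightarrow> 'f::real_normed_vector \<Rightarrow> 'f) \<Rightarrow> ('e \<Rightarrow> 'f) set"
  where "dominated_polynomials p n sE sF =
    {P \<in> polynomials n sE sF.
       \<exists>C\<ge>0. \<exists>\<mu>. regular_borel_prob (dual_ball_topology sE) \<mu> \<and>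
         (\<forall>x. norm (P x) \<le> C * (LINT \<phi>|\<mu>. norm (\<phi> x) powr p) powr (real n / p))}"

end

theory Submission
  imports Defs
begin

text \<open>
  Both equalities reduce to a theorem of Maurey: on a space \<open>E\<close> of cotype 2, every positively
  homogeneous function \<open>N\<close> that is 2-summing with respect to the dual ball is \<open>p\<close>-summing
  for all \<open>0 < p \<le> 2\<close>.

  If \<open>x\<^sub>1, \<dots>, x\<^sub>m\<close> is weakly 1-summable, then \<open>a \<mapsto> \<Sum>\<^sub>j a\<^sub>j x\<^sub>j\<close> is bounded from
  \<open>\<ell>\<^sub>\<infinity>\<close> to \<open>E\<close>, hence 2-summing by cotype 2 and a truncation argument; by duality
  \<open>\<Sum>\<^sub>j \<parallel>x\<^sub>j\<parallel>\<^sub>L\<^sub>2\<^sub>(\<^sub>\<mu>\<^sub>)\<close> is bounded uniformly in the finitely supported probabilities \<open>\<mu>\<close> on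
  the dual ball. So all norms \<open>L\<^sub>2(\<mu>)\<close> are uniformly 1-summing. For \<open>p < 1\<close> one extrapolates: by a finite
  minimax argument each \<open>L\<^sub>2(\<mu>)\<close> norm is dominated on finitely many points by some \<open>L\<^sub>1(\<mu>')\<close> norm, which lies
  between \<open>L\<^sub>p(\<mu>')\<close> and \<open>L\<^sub>2(\<mu>')\<close>, and the \<open>L\<^sub>2\<close> part is absorbed into the supremum over all
  \<open>\<mu>\<close>. For \<open>p > 1\<close> the inclusion theorem suffices.

  For dominated polynomials, \<open>N x = \<parallel>x\<parallel>\<^sub>L\<^sub>2\<^sub>(\<^sub>\<mu>\<^sub>)\<close> is 2-summing, hence \<open>p\<close>-summing, and the new measure
  arises from finitely supported ones by compactness, first as a finitely additive set function.
\<close>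

section \<open>Finite means and domination on finite sets\<close>

text \<open>Nothing but positive homogeneity is asked of \<open>N\<close>, because domination only
  rescales points. The same theorem therefore serves operators into a space of multilinear maps,
  which is not a type, and the norm of L_2(mu), which comes without any operator. The obstacle in
  the extrapolation is that domination returns a mean different from the one it starts with, so the
  L_2 term cannot be absorbed for a single mean. The supremum over all means absorbs it; on a fixed
  finite set of points this supremum is finite because every mean norm is at most the norm of E.
  Working on finitely many points with an error \<epsilon> keeps topology and integration on the
  dual ball out of the extrapolation. A finitely supported probability is represented by its mean on
  arbitrary real functions, generated by mixing in one point at a time, which is the move made in
  the minimax descent. In place of Holder's inequality the changes of exponent use two-term bounds
  with a free parameter.\<close>

inductive_set finite_means :: "'a set \<Rightarrow> (('a \<Rightarrow> real) \<Rightarrow> real) set" for D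
  where
    point: "a \<in> D \<Longrightarrow> (\<lambda>f. f a) \<in> finite_means D"
  | mix: "L \<in> finite_means D \<Longrightarrow> a \<in> D \<Longrightarrow> 0 \<le> t \<Longrightarrow> t \<le> 1 \<Longrightarrow>
      (\<lambda>f. (1 - t) * L f + t * f a) \<in> finite_means D"

lemma finite_means_const: "L \<in> finite_means D \<Longrightarrow> L (\<lambda>_. c) = c"
  by (induction rule: finite_means.induct) (auto simp: algebra_simps)

lemma finite_means_add: "L \<in> finite_means D \<Longrightarrow> L (\<lambda>x. f x + g x) = L f + L g"
  by (induction rule: finite_means.induct) (auto simp: algebra_simps)

lemma finite_means_scale: "L \<in> finite_means D \<Longrightarrow> L (\<lambda>x. c * f x) = c * L f"
  by (induction rule: finite_means.induct) (auto simp: algebra_simps)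

lemma finite_means_sum:
  assumes "L \<in> finite_means D"
  shows "L (\<lambda>x. \<Sum>i\<in>I. f i x) = (\<Sum>i\<in>I. L (f i))"
  by (induction I rule: infinite_finite_induct)
    (simp_all add: finite_means_const[OF assms] finite_means_add[OF assms])

lemma finite_means_mono:
  "L \<in> finite_means D \<Longrightarrow> (\<And>x. x \<in> D \<Longrightarrow> f x \<le> g x) \<Longrightarrow> L f \<le> L g"
  by (induction rule: finite_means.induct) (auto intro!: add_mono mult_left_mono)

lemma finite_means_nonneg: "L \<in> finite_means D \<Longrightarrow> (\<And>x. x \<in> D \<Longrightarrow> 0 \<le> f x) \<Longrightarrow> 0 \<le> L f"
  using finite_means_mono[of L D "\<lambda>_. 0" f] finite_means_const[of L D 0] by auto

lemma finite_means_le: "L \<in> finite_means D \<Longrightarrow> (\<And>x. x \<in> D \<Longrightarrow> f x \<le> c) \<Longrightarrow> L f \<le> c"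
  using finite_means_mono[of L D f "\<lambda>_. c"] finite_means_const[of L D c] by auto

text \<open>Points and weights are exposed only for the duality argument, which needs a
  finite-dimensional l_2; elsewhere the functional alone is used.\<close>

lemma finite_means_representation:
  "L \<in> finite_means D \<Longrightarrow>
    \<exists>r::nat. \<exists>w a. (\<forall>k<r. 0 \<le> w k \<and> a k \<in> D) \<and> (\<Sum>k<r. w k) = 1 \<and>
      (\<forall>f. L f = (\<Sum>k<r. w k * f (a k)))"
proof (induction rule: finite_means.induct)
  case (point b)
  then show ?case by (intro exI[of _ 1] exI[of _ "\<lambda>_. 1"] exI[of _ "\<lambda>_. b"]) auto
next
  case (mix L b t)
  then obtain r :: nat and w a where r: "\<forall>k<r. 0 \<le> w k \<and> a k \<in> D" "(\<Sum>k<r. w k) = 1"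
    "\<And>f. L f = (\<Sum>k<r. w k * f (a k))" by blast
  define w' where "w' k = (if k < r then (1 - t) * w k else t)" for k
  define a' where "a' k = (if k < r then a k else b)" for k
  have sm: "(\<Sum>k<r. w' k) = (1 - t) * (\<Sum>k<r. w k)"
    unfolding sum_distrib_left by (intro sum.cong) (auto simp: w'_def)
  have "(\<Sum>k<r. w' k * f (a' k)) = (1 - t) * (\<Sum>k<r. w k * f (a k))" for f
    unfolding sum_distrib_left by (intro sum.cong) (auto simp: w'_def a'_def)
  then show ?case
    using r mix(2-4) sm
    by (intro exI[of _ "Suc r"] exI[of _ w'] exI[of _ a'])
      (auto simp: w'_def a'_def less_Suc_eq)
qed

text \<open>The squared distance of the attainable vectors to the positive orthant can be decreased by
  moving towards a point on which the current defect vector, used as weights, is nearly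
  nonnegative.\<close>

lemma finite_minimax:
  fixes g :: "'a \<Rightarrow> nat \<Rightarrow> real"
  assumes bnd: "\<And>a j. a \<in> D \<Longrightarrow> j < m \<Longrightarrow> \<bar>g a j\<bar> \<le> B" and "D \<noteq> {}"
    and weights: "\<And>c \<eta>. (\<And>j. 0 \<le> c j) \<Longrightarrow> 0 < \<eta> \<Longrightarrow> \<exists>a\<in>D. - \<eta> \<le> (\<Sum>j<m. c j * g a j)"
    and "0 < \<epsilon>"
  shows "\<exists>L\<in>finite_means D. \<forall>j<m. - \<epsilon> \<le> L (\<lambda>a. g a j)"
proof -
  define \<Phi> where "\<Phi> L = (\<Sum>j<m. (max 0 (- L (\<lambda>a. g a j)))\<^sup>2)" for L :: "('a \<Rightarrow> real) \<Rightarrow> real"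
  define \<delta> where "\<delta> = Inf (\<Phi> ` finite_means D)"
  have ne: "finite_means D \<noteq> {}"
  proof -
    obtain a where "a \<in> D" using \<open>D \<noteq> {}\<close> by blast
    from finite_means.point[OF this] show ?thesis by (simp only: ex_in_conv[symmetric]) (rule exI)
  qed
  have \<Phi>0: "0 \<le> \<Phi> L" for L unfolding \<Phi>_def by (intro sum_nonneg) auto
  have \<delta>0: "0 \<le> \<delta>" unfolding \<delta>_def using ne \<Phi>0 by (intro cINF_greatest) auto
  have low: "\<delta> \<le> \<Phi> L" if "L \<in> finite_means D" for L
    unfolding \<delta>_def by (rule cINF_lower[OF bdd_belowI2[of _ 0 \<Phi>] that]) (rule \<Phi>0)
  \<comment> \<open>\<open>m * B\<^sup>2\<close> bounds the sum of squares at the new point, and 2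
    comes from the cross term, because the weights are tested with
    \<open>\<eta> = t\<close>.\<close>
  define B' where "B' = m * B\<^sup>2 + 2"
  have step: "\<delta> \<le> (1 - t)\<^sup>2 * \<Phi> L + t\<^sup>2 * B'" if L: "L \<in> finite_means D" and t: "0 < t" "t \<le> 1" for L t
  proof -
    define c where "c j = max 0 (- L (\<lambda>a. g a j))" for j
    have c0: "0 \<le> c j" for j by (simp add: c_def)
    obtain a where a: "a \<in> D" "- t \<le> (\<Sum>j<m. c j * g a j)"
      using weights[of c t, OF c0 t(1)] by (rule bexE)
    define L' where "L' f = (1 - t) * L f + t * f a" for f
    have L': "L' \<in> finite_means D"
      unfolding L'_def[abs_def] by (rule finite_means.mix[OF L a(1)]) (use t in simp_all)
    have "\<Phi> L' \<le> (\<Sum>j<m. ((1 - t) * c j - t * g a j)\<^sup>2)"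
      unfolding \<Phi>_def
    proof (intro sum_mono)
      fix j
      have "(1 - t) * (- L (\<lambda>a. g a j)) \<le> (1 - t) * c j"
        using t by (intro mult_left_mono) (auto simp: c_def)
      then have "- L' (\<lambda>a. g a j) \<le> (1 - t) * c j - t * g a j"
        unfolding L'_def by simp
      then have "max 0 (- L' (\<lambda>a. g a j)) \<le> \<bar>(1 - t) * c j - t * g a j\<bar>" by linarith
      then show "(max 0 (- L' (\<lambda>a. g a j)))\<^sup>2 \<le> ((1 - t) * c j - t * g a j)\<^sup>2"
        using power_mono[of "max 0 (- L' (\<lambda>a. g a j))" "\<bar>(1 - t) * c j - t * g a j\<bar>" 2] by simp
    qed
    also have "\<dots> = (1 - t)\<^sup>2 * \<Phi> L - 2 * t * (1 - t) * (\<Sum>j<m. c j * g a j) + t\<^sup>2 * (\<Sum>j<m. (g a j)\<^sup>2)"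
    proof -
      have "((1 - t) * c j - t * g a j)\<^sup>2 =
          (1 - t)\<^sup>2 * (c j)\<^sup>2 - 2 * t * (1 - t) * (c j * g a j) + t\<^sup>2 * (g a j)\<^sup>2" for j
        by algebra
      moreover have "\<Phi> L = (\<Sum>j<m. (c j)\<^sup>2)" by (simp add: \<Phi>_def c_def)
      ultimately show ?thesis by (simp add: sum.distrib sum_subtractf sum_distrib_left)
    qed
    also have "\<dots> \<le> (1 - t)\<^sup>2 * \<Phi> L + 2 * t\<^sup>2 + t\<^sup>2 * (m * B\<^sup>2)"
    proof -
      have "2 * t * (1 - t) * (- (\<Sum>j<m. c j * g a j)) \<le> 2 * t * (1 - t) * t"
        using t a(2) by (intro mult_left_mono) auto
      also have "\<dots> \<le> 2 * 1 * t\<^sup>2"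
          using t by (simp add: power2_eq_square mult_left_le)
      finally have 1: "- (2 * t * (1 - t) * (\<Sum>j<m. c j * g a j)) \<le> 2 * t\<^sup>2" by simp
      have "(\<Sum>j<m. (g a j)\<^sup>2) \<le> (\<Sum>j<m. B\<^sup>2)"
        using bnd[OF a(1)] by (intro sum_mono abs_le_square_iff[THEN iffD1]) force
      then have "t\<^sup>2 * (\<Sum>j<m. (g a j)\<^sup>2) \<le> t\<^sup>2 * (m * B\<^sup>2)"
        by (intro mult_left_mono) auto
      with 1 show ?thesis by linarith
    qed
    finally show ?thesis using low[OF L'] unfolding B'_def by (simp add: algebra_simps)
  qed
  have "\<delta> \<le> t * B'" if t: "0 < t" "t \<le> 1" for t
  proof -
    \<comment> \<open>The infimum over L is taken in \<open>step\<close>. At t = 1 the coefficient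
      of \<open>\<Phi> L\<close> vanishes and cannot be divided by, so that case uses any mean. The
      result sets a gain of first order in t against a loss of second order.\<close>
    have "\<delta> \<le> (1 - t)\<^sup>2 * \<delta> + t\<^sup>2 * B'"
    proof (cases "t = 1")
      case True
      obtain L where "L \<in> finite_means D" using ne by blast
      from step[OF this t] True show ?thesis by simp
    next
      case False
      then have pos: "0 < (1 - t)\<^sup>2" by simp
      have "(\<delta> - t\<^sup>2 * B') / (1 - t)\<^sup>2 \<le> \<Phi> L" if "L \<in> finite_means D" for L
        using step[OF that t] pos by (simp add: pos_divide_le_eq mult.commute)
      then have "(\<delta> - t\<^sup>2 * B') / (1 - t)\<^sup>2 \<le> Inf (\<Phi> ` finite_means D)"
        by (rule cINF_greatest[OF ne])
      then have "(\<delta> - t\<^sup>2 * B') / (1 - t)\<^sup>2 \<le> \<delta>" by (simp only: \<delta>_def)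
      then show ?thesis using pos by (simp add: pos_divide_le_eq mult.commute)
    qed
    moreover have "(1 - t)\<^sup>2 * \<delta> = \<delta> - t * (\<delta> * (2 - t))" by algebra
    ultimately have "t * (\<delta> * (2 - t)) \<le> t * (t * B')" by (simp add: power2_eq_square)
    then have "\<delta> * (2 - t) \<le> t * B'" using t by simp
    moreover have "\<delta> * 1 \<le> \<delta> * (2 - t)" using t \<delta>0 by (intro mult_left_mono) auto
    ultimately show ?thesis by simp
  qed
  note small = this
  have "\<delta> < \<epsilon>\<^sup>2"
  proof -
    have B'2: "2 \<le> B'" unfolding B'_def by simp
    define t where "t = min 1 (\<epsilon>\<^sup>2 / (2 * B'))"
    have "0 < t" "t \<le> 1" using \<open>0 < \<epsilon>\<close> B'2 by (auto simp: t_def)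
    then have "\<delta> \<le> t * B'" by (rule small)
    also have "\<dots> \<le> \<epsilon>\<^sup>2 / (2 * B') * B'" using B'2 by (intro mult_right_mono) (auto simp: t_def)
    also have "\<dots> < \<epsilon>\<^sup>2" using B'2 \<open>0 < \<epsilon>\<close> by (simp add: divide_simps)
    finally show ?thesis .
  qed
  then obtain L where L: "L \<in> finite_means D" "\<Phi> L < \<epsilon>\<^sup>2"
    using cINF_less_iff[OF ne bdd_belowI2[of _ 0 \<Phi>], of "\<epsilon>\<^sup>2"] \<Phi>0
    unfolding \<delta>_def by blast
  have "- \<epsilon> \<le> L (\<lambda>a. g a j)" if "j < m" for j
  proof -
    have "(max 0 (- L (\<lambda>a. g a j)))\<^sup>2 \<le> \<Phi> L"
      unfolding \<Phi>_def by (rule member_le_sum) (use that in auto)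
    with L(2) have "(max 0 (- L (\<lambda>a. g a j)))\<^sup>2 < \<epsilon>\<^sup>2" by linarith
    then have "max 0 (- L (\<lambda>a. g a j)) < \<epsilon>" by (rule power2_less_imp_less) (use \<open>0 < \<epsilon>\<close> in simp)
    then show ?thesis by linarith
  qed
  with L(1) show ?thesis by blast
qed

text \<open>Quantifying over upper bounds \<open>W\<close> replaces the supremum over
  \<open>D\<close>, and p-th powers replace roots, so \<open>C\<close> is the p-th power of a usual
  summing constant. The function \<open>N\<close> stands for the norm of the image under an
  operator.\<close>

definition p_summing_on ::
    "('e \<Rightarrow> 'k::real_normed_vector) set \<Rightarrow> real \<Rightarrow> real \<Rightarrow> ('e::real_normed_vector \<Rightarrow> real) \<Rightarrow> bool"
  where "p_summing_on D p C N \<longleftrightarrow>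
    (\<forall>k. \<forall>x :: nat \<Rightarrow> 'e. \<forall>W. (\<forall>\<phi>\<in>D. (\<Sum>j<k. norm (\<phi> (x j)) powr p) \<le> W) \<longrightarrow>
       (\<Sum>j<k. N (x j) powr p) \<le> C * W)"

definition pos_homogeneous :: "('e::real_normed_vector \<Rightarrow> real) \<Rightarrow> bool"
  where "pos_homogeneous N \<longleftrightarrow> (\<forall>x. 0 \<le> N x) \<and> (\<forall>t\<ge>0. \<forall>x. N (t *\<^sub>R x) = t * N x)"

lemma p_summing_onD:
  fixes x :: "nat \<Rightarrow> 'e::real_normed_vector"
  assumes "p_summing_on D p C N" and "\<And>\<phi>. \<phi> \<in> D \<Longrightarrow> (\<Sum>j<k. norm (\<phi> (x j)) powr p) \<le> W"
  shows "(\<Sum>j<k. N (x j) powr p) \<le> C * W"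
  using assms(1)[unfolded p_summing_on_def, THEN spec, of k, THEN spec, of x, THEN spec, of W]
    assms(2) by blast

lemma p_summing_on_mono: "p_summing_on D p C N \<Longrightarrow> D \<noteq> {} \<Longrightarrow> C \<le> C' \<Longrightarrow> p_summing_on D p C' N"
  unfolding p_summing_on_def
proof (intro allI impI)
  fix k :: nat and x :: "nat \<Rightarrow> 'a" and W
  assume *: "\<forall>k (x::nat \<Rightarrow> 'a) W. (\<forall>\<phi>\<in>D. (\<Sum>j<k. norm (\<phi> (x j)) powr p) \<le> W) \<longrightarrow>
       (\<Sum>j<k. N (x j) powr p) \<le> C * W" and "D \<noteq> {}" "C \<le> C'"
    and W: "\<forall>\<phi>\<in>D. (\<Sum>j<k. norm (\<phi> (x j)) powr p) \<le> W"
  obtain \<phi> where "\<phi> \<in> D" using \<open>D \<noteq> {}\<close> by blast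
  have "0 \<le> (\<Sum>j<k. norm (\<phi> (x j)) powr p)" by (intro sum_nonneg) auto
  then have "0 \<le> W" using W \<open>\<phi> \<in> D\<close> by force
  then have "C * W \<le> C' * W" using \<open>C \<le> C'\<close> by (intro mult_right_mono)
  then show "(\<Sum>j<k. N (x j) powr p) \<le> C' * W" using * W by force
qed

text \<open>A Young inequality with free parameter: comparing s with
  \<open>\<eta> powr (1 / p) * y\<close> decides which of the two terms on the right suffices alone.
  A small \<open>\<eta>\<close> lets the y term be absorbed.\<close>

lemma powr_mix_le:
  fixes s y \<eta> :: real
  assumes "0 < p" "p \<le> q" "0 \<le> s" "0 \<le> y" "0 < \<eta>"
  shows "y powr (q - p) * s powr p \<le> \<eta> * y powr q + \<eta> powr (- (q - p) / p) * s powr q"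
proof (cases "s \<le> \<eta> powr (1 / p) * y")
  case True
  have "s powr p \<le> (\<eta> powr (1 / p) * y) powr p"
    using True assms by (intro powr_mono2) auto
  also have "\<dots> = \<eta> * y powr p" using assms by (simp add: powr_mult powr_powr)
  finally have "y powr (q - p) * s powr p \<le> y powr (q - p) * (\<eta> * y powr p)"
    by (intro mult_left_mono) auto
  also have "\<dots> = \<eta> * y powr q"
    by (simp add: mult.left_commute powr_add[symmetric])
  finally show ?thesis by (smt (verit) powr_ge_zero mult_nonneg_nonneg)
next
  case False
  then have "s > 0" using assms by (smt (verit) powr_ge_zero mult_nonneg_nonneg)
  have "y \<le> \<eta> powr (- (1 / p)) * s"
    using False assms by (auto simp: powr_minus divide_simps mult.commute)
  then have "y powr (q - p) \<le> (\<eta> powr (- (1 / p)) * s) powr (q - p)"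
    using assms by (intro powr_mono2) auto
  also have "\<dots> = \<eta> powr (- (1 / p) * (q - p)) * s powr (q - p)"
    using assms by (simp add: powr_mult powr_powr)
  also have "- (1 / p) * (q - p) = - (q - p) / p" by (simp add: diff_divide_distrib)
  finally have "y powr (q - p) * s powr p \<le> \<eta> powr (- (q - p) / p) * s powr (q - p) * s powr p"
    by (intro mult_right_mono) auto
  also have "\<dots> = \<eta> powr (- (q - p) / p) * s powr q"
    by (simp add: mult.assoc powr_add[symmetric])
  finally show ?thesis using assms by (smt (verit) powr_ge_zero mult_nonneg_nonneg)
qed

text \<open>Rescaling \<open>x j\<close> by \<open>l j\<close> turns
  \<open>N (l j *\<^sub>R x j) powr p\<close> into \<open>N (x j) powr q\<close>. The test sums of
  the rescaled points are split by \<open>powr_mix_le\<close> with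
  \<open>\<eta> = 1 / (2 * C)\<close>, which leaves half of the finite sum \<open>T\<close> to be
  absorbed.\<close>

lemma p_summing_on_inclusion:
  fixes D :: "('e::real_normed_vector \<Rightarrow> 'k::real_normed_vector) set"
  assumes "0 < p" "p \<le> q" "p_summing_on D p C N" "0 < C"
    and hom: "pos_homogeneous N"
    and D: "\<And>\<phi> t x. \<phi> \<in> D \<Longrightarrow> norm (\<phi> (t *\<^sub>R x)) = \<bar>t\<bar> * norm (\<phi> x)"
  shows "\<exists>C'>0. p_summing_on D q C' N"
proof (intro exI conjI)
  define \<eta> where "\<eta> = 1 / (2 * C)"
  have \<eta>: "0 < \<eta>" using \<open>0 < C\<close> by (simp add: \<eta>_def)
  define K where "K = \<eta> powr (- (q - p) / p)"
  show "0 < 2 * C * K" using \<open>0 < C\<close> \<eta> by (simp add: K_def)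
  show "p_summing_on D q (2 * C * K) N"
    unfolding p_summing_on_def
  proof (intro allI impI)
    fix k :: nat and x :: "nat \<Rightarrow> 'e" and W
    assume W: "\<forall>\<phi>\<in>D. (\<Sum>j<k. norm (\<phi> (x j)) powr q) \<le> W"
    have N0: "0 \<le> N v" for v using hom by (auto simp: pos_homogeneous_def)
    define T where "T = (\<Sum>j<k. N (x j) powr q)"
    define l where "l j = N (x j) powr ((q - p) / p)" for j
    have l: "l j powr p = N (x j) powr (q - p)" "0 \<le> l j" for j
      using \<open>0 < p\<close> by (auto simp: l_def powr_powr)
    have "(\<Sum>j<k. N (l j *\<^sub>R x j) powr p) \<le> C * (\<eta> * T + K * W)"
    proof (rule p_summing_onD[OF assms(3)])
      fix \<phi> assume \<phi>: "\<phi> \<in> D"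
      have "(\<Sum>j<k. norm (\<phi> (l j *\<^sub>R x j)) powr p) = (\<Sum>j<k. N (x j) powr (q - p) * norm (\<phi> (x j)) powr p)"
        using l by (intro sum.cong) (auto simp: D[OF \<phi>] powr_mult)
      also have "\<dots> \<le> (\<Sum>j<k. \<eta> * N (x j) powr q + K * norm (\<phi> (x j)) powr q)"
        unfolding K_def using N0 \<eta> assms(1,2) by (intro sum_mono powr_mix_le) auto
      also have "\<dots> = \<eta> * T + K * (\<Sum>j<k. norm (\<phi> (x j)) powr q)"
        by (simp add: T_def sum.distrib sum_distrib_left)
      also have "\<dots> \<le> \<eta> * T + K * W"
        using W \<phi> by (auto intro!: mult_left_mono simp: K_def)
      finally show "(\<Sum>j<k. norm (\<phi> (l j *\<^sub>R x j)) powr p) \<le> \<eta> * T + K * W" .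
    qed
    moreover have "N (l j *\<^sub>R x j) powr p = N (x j) powr q" for j
    proof -
      have "N (l j *\<^sub>R x j) powr p = N (x j) powr (q - p) * N (x j) powr p"
        using hom l[of j] N0 by (auto simp: pos_homogeneous_def powr_mult)
      then show ?thesis by (simp add: powr_add[symmetric])
    qed
    ultimately have "T \<le> C * (\<eta> * T + K * W)" by (simp add: T_def)
    also have "\<dots> = T / 2 + C * K * W" using \<open>0 < C\<close> by (simp add: \<eta>_def algebra_simps)
    finally show "(\<Sum>j<k. N (x j) powr q) \<le> 2 * C * K * W" by (simp add: T_def)
  qed
qed

text \<open>Pietsch domination for finitely many points. By homogeneity the weights
  \<open>c j\<close> of the minimax condition are absorbed into the points, so the summing
  inequality covers every weighted sum; \<open>\<epsilon>\<close> is the slack left by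
  \<open>finite_minimax\<close>.\<close>

lemma finite_domination:
  fixes D :: "('e::real_normed_vector \<Rightarrow> 'k::real_normed_vector) set" and x :: "nat \<Rightarrow> 'e"
  assumes "0 < p" and N: "p_summing_on D p C N" and "0 < C" and "D \<noteq> {}"
    and hom: "pos_homogeneous N"
    and D: "\<And>\<phi> t x. \<phi> \<in> D \<Longrightarrow> norm (\<phi> (t *\<^sub>R x)) = \<bar>t\<bar> * norm (\<phi> x)"
      "\<And>\<phi> x. \<phi> \<in> D \<Longrightarrow> norm (\<phi> x) \<le> norm x"
    and "0 < \<epsilon>"
  shows "\<exists>L\<in>finite_means D. \<forall>j<m. N (x j) powr p \<le> C * L (\<lambda>\<phi>. norm (\<phi> (x j)) powr p) + \<epsilon>"
proof -
  define g where "g \<phi> j = C * norm (\<phi> (x j)) powr p - N (x j) powr p" for \<phi> :: "'e \<Rightarrow> 'k" and j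
  define B where "B = (\<Sum>j<m. C * norm (x j) powr p + N (x j) powr p)"
  have N0: "0 \<le> N v" for v using hom by (auto simp: pos_homogeneous_def)
  have bnd: "\<bar>g \<phi> j\<bar> \<le> B" if "\<phi> \<in> D" "j < m" for \<phi> j
  proof -
    have "\<bar>g \<phi> j\<bar> \<le> C * norm (\<phi> (x j)) powr p + N (x j) powr p"
      unfolding g_def using \<open>0 < C\<close> by (smt (verit) powr_ge_zero mult_nonneg_nonneg)
    also have "\<dots> \<le> C * norm (x j) powr p + N (x j) powr p"
      using D(2)[OF that(1)] \<open>0 < C\<close> \<open>0 < p\<close> by (auto intro!: powr_mono2 mult_left_mono)
    also have "\<dots> \<le> B"
      unfolding B_def by (rule member_le_sum) (use that \<open>0 < C\<close> in auto)
    finally show ?thesis .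
  qed
  have "\<exists>L\<in>finite_means D. \<forall>j<m. - \<epsilon> \<le> L (\<lambda>\<phi>. g \<phi> j)"
  proof (rule finite_minimax[OF bnd \<open>D \<noteq> {}\<close> _ \<open>0 < \<epsilon>\<close>])
    fix c :: "nat \<Rightarrow> real" and \<eta> :: real
    assume c: "\<And>j. 0 \<le> c j" and \<eta>: "0 < \<eta>"
    show "\<exists>\<phi>\<in>D. - \<eta> \<le> (\<Sum>j<m. c j * g \<phi> j)"
    proof (rule ccontr)
      assume "\<not> ?thesis"
      then have neg: "(\<Sum>j<m. c j * g \<phi> j) < - \<eta>" if "\<phi> \<in> D" for \<phi> using that by force
      define y where "y j = (c j powr (1 / p)) *\<^sub>R x j" for j
      have Ny: "N (y j) powr p = c j * N (x j) powr p" for j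
        using hom c[of j] \<open>0 < p\<close> N0 by (auto simp: pos_homogeneous_def y_def powr_mult powr_powr)
      have \<phi>y: "norm (\<phi> (y j)) powr p = c j * norm (\<phi> (x j)) powr p" if "\<phi> \<in> D" for \<phi> j
        using c[of j] \<open>0 < p\<close> by (auto simp: D(1)[OF that] y_def powr_mult powr_powr)
      define S where "S = (\<Sum>j<m. c j * N (x j) powr p)"
      \<comment> \<open>If every \<open>\<phi>\<close> fails, \<open>(S - \<eta>) / C\<close> is an
        admissible bound \<open>W\<close>, and the summing inequality reads S \<le> S -
        \<eta>.\<close>
      have "(\<Sum>j<m. N (y j) powr p) \<le> C * ((S - \<eta>) / C)"
      proof (rule p_summing_onD[OF N])
        fix \<phi> assume \<phi>: "\<phi> \<in> D"
        have "(\<Sum>j<m. c j * g \<phi> j) = C * (\<Sum>j<m. c j * norm (\<phi> (x j)) powr p) - S"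
          unfolding g_def S_def sum_distrib_left sum_subtractf[symmetric]
          by (intro sum.cong) (auto simp: algebra_simps)
        with neg[OF \<phi>] have "C * (\<Sum>j<m. c j * norm (\<phi> (x j)) powr p) \<le> S - \<eta>" by simp
        then show "(\<Sum>j<m. norm (\<phi> (y j)) powr p) \<le> (S - \<eta>) / C"
          using \<open>0 < C\<close> by (simp add: \<phi>y[OF \<phi>] field_simps)
      qed
      then show False using \<open>0 < C\<close> \<eta> by (simp add: Ny S_def)
    qed
  qed
  then obtain L where L: "L \<in> finite_means D" "\<And>j. j < m \<Longrightarrow> - \<epsilon> \<le> L (\<lambda>\<phi>. g \<phi> j)" by blast
  have Lg: "L (\<lambda>\<phi>. g \<phi> j) = C * L (\<lambda>\<phi>. norm (\<phi> (x j)) powr p) - N (x j) powr p" for j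
  proof -
    have "L (\<lambda>\<phi>. g \<phi> j) = L (\<lambda>\<phi>. C * norm (\<phi> (x j)) powr p + (- (N (x j) powr p)))"
      by (simp add: g_def)
    then show ?thesis
      by (simp only: finite_means_add[OF L(1)] finite_means_scale[OF L(1)] finite_means_const[OF L(1)])
  qed
  then have "N (x j) powr p \<le> C * L (\<lambda>\<phi>. norm (\<phi> (x j)) powr p) + \<epsilon>" if "j < m" for j
    using L(2)[OF that] unfolding Lg by linarith
  with L(1) show ?thesis by blast
qed

section \<open>Rademacher averages and cotype 2\<close>

lemma sum_lessThan_plus:
  fixes f :: "nat \<Rightarrow> 'a::comm_monoid_add"
  shows "(\<Sum>i<m + n. f i) = (\<Sum>i<m. f i) + (\<Sum>i<n. f (m + i))"
  by (induction n) (simp_all add: add.assoc)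

lemma rademacher_Suc_double: "rademacher (Suc j) t = rademacher j (2 * t)"
  by (simp add: rademacher_def mult_ac)

text \<open>Only the indices from 1 on have period 1; \<open>rademacher 0\<close> changes sign under
  this shift. By periodicity both halves of the unit interval, stretched by 2, show the same
  functions.\<close>

lemma rademacher_shift: "rademacher (Suc j) (t - 1) = rademacher (Suc j) t"
proof -
  have "2 ^ Suc j * pi * (t - 1) = 2 ^ Suc j * pi * t - 2 * real (2 ^ j) * pi"
    by (simp add: algebra_simps)
  moreover have "sin (y - 2 * real n * pi) = sin y" for y n
    by (simp only: sin_diff sin_2npi cos_2npi mult_1_right mult_zero_right diff_zero)
  ultimately show ?thesis
    unfolding rademacher_def by metis
qed

lemma rademacher_1:
  "0 < t \<Longrightarrow> t < 1 / 2 \<Longrightarrow> rademacher (Suc 0) t = 1"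
  "1 / 2 < t \<Longrightarrow> t < 1 \<Longrightarrow> rademacher (Suc 0) t = - 1"
proof -
  assume "0 < t" "t < 1 / 2"
  then have "0 < sin (2 * pi * t)" by (intro sin_gt_zero) auto
  then show "rademacher (Suc 0) t = 1" by (simp add: rademacher_def)
next
  assume "1 / 2 < t" "t < 1"
  then have "0 < sin (2 * pi * (t - 1 / 2))" by (intro sin_gt_zero) (auto simp: algebra_simps)
  also have "2 * pi * (t - 1 / 2) = 2 * pi * t - pi" by (simp add: algebra_simps)
  finally show "rademacher (Suc 0) t = - 1" by (simp add: rademacher_def)
qed

text \<open>The self-similarity \<^term>\<open>rademacher (Suc j) t = rademacher j (2 * t)\<close> turns the integral
  over the first \<open>k\<close> Rademacher functions into an average over sign vectors, by induction on \<open>k\<close>.\<close>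

lemma rademacher_average:
  "\<exists>M>0. \<exists>\<sigma> :: nat \<Rightarrow> nat \<Rightarrow> real.
     (\<forall>F :: (nat \<Rightarrow> real) \<Rightarrow> real.
        ((\<lambda>t. F (\<lambda>j. if j < k then rademacher (Suc j) t else 0)) has_integral
          (\<Sum>i<M. F (\<lambda>j. if j < k then \<sigma> i j else 0)) / real M) {0..1}) \<and>
     (\<forall>a :: nat \<Rightarrow> real. (\<Sum>i<M. (\<Sum>j<k. \<sigma> i j * a j)\<^sup>2) = real M * (\<Sum>j<k. (a j)\<^sup>2)) \<and>
     (\<forall>a :: nat \<Rightarrow> real. (\<Sum>i<M. (\<Sum>j<k. \<sigma> i j * a j) ^ 4) \<le> 3 * real M * (\<Sum>j<k. (a j)\<^sup>2)\<^sup>2)"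
proof (induction k)
  case 0
  show ?case
    by (rule exI[of _ 1]) (use has_integral_const_real[of _ 0 1] in auto)
next
  case (Suc k)
  then obtain M :: nat and \<sigma> :: "nat \<Rightarrow> nat \<Rightarrow> real" where "M > 0"
    and int: "\<forall>F :: (nat \<Rightarrow> real) \<Rightarrow> real.
        ((\<lambda>t. F (\<lambda>j. if j < k then rademacher (Suc j) t else 0)) has_integral
          (\<Sum>i<M. F (\<lambda>j. if j < k then \<sigma> i j else 0)) / real M) {0..1}"
    and two: "\<forall>a :: nat \<Rightarrow> real. (\<Sum>i<M. (\<Sum>j<k. \<sigma> i j * a j)\<^sup>2) = real M * (\<Sum>j<k. (a j)\<^sup>2)"
    and four: "\<forall>a :: nat \<Rightarrow> real. (\<Sum>i<M. (\<Sum>j<k. \<sigma> i j * a j) ^ 4) \<le> 3 * real M * (\<Sum>j<k. (a j)\<^sup>2)\<^sup>2"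
    by (elim exE conjE) (rule that)
  \<comment> \<open>The new sign goes in front: inside each half of the interval
    \<open>rademacher (Suc 0)\<close> is constant, and doubling shifts the old functions up by one
    index.\<close>
  define \<tau> where "\<tau> i = (if i < M then case_nat 1 (\<sigma> i) else case_nat (- 1) (\<sigma> (i - M)))" for i
  have \<tau>: "\<tau> i = case_nat 1 (\<sigma> i)" "\<tau> (M + i) = case_nat (- 1) (\<sigma> i)" if "i < M" for i
    using that by (auto simp: \<tau>_def)
  have split: "(\<Sum>i<M + M. G (\<tau> i)) = (\<Sum>i<M. G (case_nat 1 (\<sigma> i))) + (\<Sum>i<M. G (case_nat (- 1) (\<sigma> i)))"
    for G :: "(nat \<Rightarrow> real) \<Rightarrow> real"
    unfolding sum_lessThan_plus by (intro arg_cong2[of _ _ _ _ "(+)"] sum.cong) (auto simp: \<tau>)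
  have shift: "(\<lambda>j. if j < Suc k then case_nat c s j else 0) = case_nat c (\<lambda>j. if j < k then s j else 0)"
    for c :: real and s by (auto simp: fun_eq_iff split: nat.split)
  show ?case
  proof (intro exI[of _ "M + M"] exI[of _ \<tau>] conjI allI)
    show "M + M > 0" using \<open>M > 0\<close> by simp
  next
    fix F :: "(nat \<Rightarrow> real) \<Rightarrow> real"
    define I where "I c = (\<Sum>i<M. F (case_nat c (\<lambda>j. if j < k then \<sigma> i j else 0))) / real M" for c
    let ?r = "\<lambda>t j. if j < k then rademacher (Suc j) t else 0"
    let ?R = "\<lambda>t. F (\<lambda>j. if j < Suc k then rademacher (Suc j) t else 0)"
    have pw: "(\<lambda>j. if j < Suc k then rademacher (Suc j) t else 0) =
        case_nat (rademacher (Suc 0) t) (?r (2 * t))" for t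
      by (auto simp: fun_eq_iff rademacher_Suc_double[of "Suc _"] split: nat.split)
    have r1: "?r (2 * t - 1) = ?r (2 * t)" for t by (auto simp: fun_eq_iff rademacher_shift)
    have aff: "((\<lambda>t. F (case_nat c (?r (2 * t + d)))) has_integral I c / 2) {- d / 2..(1 - d) / 2}" for c d
      using has_integral_affinity[of "\<lambda>t. F (case_nat c (?r t))" "I c" 0 1 2 d, unfolded real_scaleR_def]
        int[THEN spec, of "\<lambda>s. F (case_nat c s)"]
      by (simp add: I_def image_affinity_atLeastAtMost[of "1/2" "- d / 2", simplified] diff_divide_distrib mult.commute)
    \<comment> \<open>The spike set removes the end points, where \<open>rademacher (Suc 0)\<close>
      is 0.\<close>
    have "(?R has_integral I 1 / 2) {0..1/2}"
      by (rule has_integral_spike_finite[of "{0, 1/2}", OF _ _ aff[of 1 0, unfolded minus_zero div_0 diff_zero add_0_right]])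
        (auto simp: pw rademacher_1)
    moreover have "(?R has_integral I (- 1) / 2) {1/2..1}"
      by (rule has_integral_spike_finite[of "{1/2, 1}", OF _ _ aff[of "- 1" "- 1", unfolded diff_conv_add_uminus[symmetric], simplified r1, simplified]])
        (auto simp: pw rademacher_1 r1)
    ultimately have "(?R has_integral I 1 / 2 + I (- 1) / 2) {0..1}"
      by (rule has_integral_combine[rotated 2]) auto
    also have "I 1 / 2 + I (- 1) / 2 =
        (\<Sum>i<M + M. F (\<lambda>j. if j < Suc k then \<tau> i j else 0)) / real (M + M)"
      using split[of "\<lambda>s. F (\<lambda>j. if j < Suc k then s j else 0)"] \<open>M > 0\<close>
      by (simp add: I_def shift field_simps)
    finally show "(?R has_integral (\<Sum>i<M + M. F (\<lambda>j. if j < Suc k then \<tau> i j else 0)) / real (M + M)) {0..1}" .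
  next
    fix a :: "nat \<Rightarrow> real"
    let ?X = "\<lambda>i. \<Sum>j<k. \<sigma> i j * a (Suc j)"
    have "(\<Sum>i<M + M. (\<Sum>j<Suc k. \<tau> i j * a j)\<^sup>2) = (\<Sum>i<M. (a 0 + ?X i)\<^sup>2) + (\<Sum>i<M. (- a 0 + ?X i)\<^sup>2)"
      using split[of "\<lambda>s. (\<Sum>j<Suc k. s j * a j)\<^sup>2"] by (simp only: sum.lessThan_Suc_shift) simp
    also have "\<dots> = (\<Sum>i<M. 2 * (a 0)\<^sup>2 + 2 * (?X i)\<^sup>2)"
      unfolding sum.distrib[symmetric] by (intro sum.cong refl) algebra
    also have "\<dots> = real (M + M) * (\<Sum>j<Suc k. (a j)\<^sup>2)"
      by (simp add: sum.distrib sum_distrib_left[symmetric] two[rule_format] sum.lessThan_Suc_shift algebra_simps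
          del: sum.lessThan_Suc)
    finally show "(\<Sum>i<M + M. (\<Sum>j<Suc k. \<tau> i j * a j)\<^sup>2) = real (M + M) * (\<Sum>j<Suc k. (a j)\<^sup>2)" .
  next
    fix a :: "nat \<Rightarrow> real"
    let ?X = "\<lambda>i. \<Sum>j<k. \<sigma> i j * a (Suc j)"
    let ?S = "\<Sum>j<k. (a (Suc j))\<^sup>2"
    have "(\<Sum>i<M + M. (\<Sum>j<Suc k. \<tau> i j * a j) ^ 4) = (\<Sum>i<M. (a 0 + ?X i) ^ 4) + (\<Sum>i<M. (- a 0 + ?X i) ^ 4)"
      using split[of "\<lambda>s. (\<Sum>j<Suc k. s j * a j) ^ 4"] by (simp only: sum.lessThan_Suc_shift) simp
    also have "\<dots> = (\<Sum>i<M. 2 * (a 0) ^ 4 + 12 * (a 0)\<^sup>2 * (?X i)\<^sup>2 + 2 * (?X i) ^ 4)"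
      unfolding sum.distrib[symmetric] by (intro sum.cong refl) algebra
    also have "\<dots> = 2 * M * (a 0) ^ 4 + 12 * (a 0)\<^sup>2 * (M * ?S) + 2 * (\<Sum>i<M. (?X i) ^ 4)"
      by (simp add: sum.distrib sum_distrib_left[symmetric] two[rule_format])
    also have "\<dots> \<le> 2 * M * (a 0) ^ 4 + 12 * (a 0)\<^sup>2 * (M * ?S) + 2 * (3 * M * ?S\<^sup>2)"
      using four[THEN spec, of "\<lambda>j. a (Suc j)"] by simp
    \<comment> \<open>Raising 2 to 6 completes the square, since 6 u^2 + 12 u v + 6 v^2 = 6 (u +
      v)^2. The cross term 12 is what forces the factor 3 in the claim.\<close>
    also have "\<dots> \<le> 6 * M * (a 0) ^ 4 + 12 * (a 0)\<^sup>2 * (M * ?S) + 6 * M * ?S\<^sup>2"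
      by simp
    also have "\<dots> = 3 * real (M + M) * ((a 0)\<^sup>2 + ?S)\<^sup>2"
      by (simp add: power2_eq_square power4_eq_xxxx algebra_simps)
    also have "(a 0)\<^sup>2 + ?S = (\<Sum>j<Suc k. (a j)\<^sup>2)"
      by (simp only: sum.lessThan_Suc_shift)
    finally show "(\<Sum>i<M + M. (\<Sum>j<Suc k. \<tau> i j * a j) ^ 4) \<le> 3 * real (M + M) * (\<Sum>j<Suc k. (a j)\<^sup>2)\<^sup>2" .
  qed
qed

text \<open>The rows of \<open>\<sigma>\<close> are the sign vectors, but of these only the fourth moment bound is needed.\<close>

definition finite_cotype2 :: "'e::real_normed_vector itself \<Rightarrow> real \<Rightarrow> bool"
  where "finite_cotype2 _ C \<longleftrightarrow>
    (\<forall>k. \<exists>M>0. \<exists>\<sigma> :: nat \<Rightarrow> nat \<Rightarrow> real.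
       (\<forall>a :: nat \<Rightarrow> real. (\<Sum>i<M. (\<Sum>j<k. \<sigma> i j * a j) ^ 4) \<le> 3 * real M * (\<Sum>j<k. (a j)\<^sup>2)\<^sup>2) \<and>
       (\<forall>v :: nat \<Rightarrow> 'e. real M * (\<Sum>j<k. (norm (v j))\<^sup>2) \<le> C\<^sup>2 * (\<Sum>i<M. (norm (\<Sum>j<k. \<sigma> i j *\<^sub>R v j))\<^sup>2)))"

text \<open>The integral over the unit interval becomes the average over the rows of
  \<open>\<sigma>\<close>. Increasing the constant by 1 makes it positive, so that the truncation
  height built from it is positive.\<close>

lemma has_cotype_imp_finite_cotype2:
  assumes "has_cotype TYPE('e::real_normed_vector) 2"
  shows "\<exists>C>0. finite_cotype2 TYPE('e) C"
proof -
  obtain C where "C \<ge> 0" and C: "\<And>k (x :: nat \<Rightarrow> 'e).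
       (\<Sum>j=1..k. norm (x j) powr 2) powr (1 / 2)
       \<le> C * sqrt (LBINT t:{0..1}. (norm (\<Sum>j=1..k. rademacher j t *\<^sub>R x j))\<^sup>2)"
    using assms unfolding has_cotype_def by blast
  have "finite_cotype2 TYPE('e) (C + 1)"
    unfolding finite_cotype2_def
  proof (intro allI)
    fix k
    obtain M :: nat and \<sigma> :: "nat \<Rightarrow> nat \<Rightarrow> real" where "M > 0"
      and int: "\<forall>F :: (nat \<Rightarrow> real) \<Rightarrow> real.
        ((\<lambda>t. F (\<lambda>j. if j < k then rademacher (Suc j) t else 0)) has_integral
          (\<Sum>i<M. F (\<lambda>j. if j < k then \<sigma> i j else 0)) / real M) {0..1}"
      and four: "\<forall>a :: nat \<Rightarrow> real. (\<Sum>i<M. (\<Sum>j<k. \<sigma> i j * a j) ^ 4) \<le> 3 * real M * (\<Sum>j<k. (a j)\<^sup>2)\<^sup>2"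
      using rademacher_average[of k] by (elim exE conjE) (rule that)
    have "real M * (\<Sum>j<k. (norm (v j))\<^sup>2) \<le> (C + 1)\<^sup>2 * (\<Sum>i<M. (norm (\<Sum>j<k. \<sigma> i j *\<^sub>R v j))\<^sup>2)"
      for v :: "nat \<Rightarrow> 'e"
    proof -
      define F where "F s = (norm (\<Sum>j<k. s j *\<^sub>R v j))\<^sup>2" for s :: "nat \<Rightarrow> real"
      define A where "A = (\<Sum>i<M. F (\<sigma> i)) / M"
      have cut: "F (\<lambda>j. if j < k then s j else 0) = F s" for s
        unfolding F_def by (intro arg_cong[of _ _ "\<lambda>z. (norm z)\<^sup>2"] sum.cong) auto
      have A0: "0 \<le> A" unfolding A_def F_def by (intro divide_nonneg_nonneg sum_nonneg) auto
      have hi: "((\<lambda>t. F (\<lambda>j. rademacher (Suc j) t)) has_integral A) {0..1}"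
        using int[THEN spec, of F] unfolding cut A_def .
      let ?L = "LBINT t:{0..1}. F (\<lambda>j. rademacher (Suc j) t)"
      \<comment> \<open>An inequality is enough: if the integrand is not integrable,
        \<open>?L\<close> is 0 by convention, so no measurability has to be checked.\<close>
      have "?L \<le> A"
      proof (cases "set_integrable lborel {0..1} (\<lambda>t. F (\<lambda>j. rademacher (Suc j) t))")
        case True
        from set_borel_integral_eq_integral(2)[OF this] hi show ?thesis
          by (simp add: integral_unique)
      next
        case False
        then have "?L = 0"
          unfolding set_integrable_def set_lebesgue_integral_def by (rule not_integrable_integral_eq)
        with A0 show ?thesis by simp
      qed
      have "sqrt (\<Sum>j<k. (norm (v j))\<^sup>2) = (\<Sum>j=1..k. norm (v (j - 1)) powr 2) powr (1 / 2)"
        by (simp add: sum.atLeast1_atMost_eq powr_half_sqrt sum_nonneg)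
      also have "\<dots> \<le> C * sqrt (LBINT t:{0..1}. (norm (\<Sum>j=1..k. rademacher j t *\<^sub>R v (j - 1)))\<^sup>2)"
        using C[of "\<lambda>j. v (j - 1)" k] .
      also have "\<dots> = C * sqrt ?L"
        by (simp add: sum.atLeast1_atMost_eq F_def)
      also have "\<dots> \<le> (C + 1) * sqrt A"
        using mult_left_mono[OF real_sqrt_le_mono[OF \<open>?L \<le> A\<close>] \<open>C \<ge> 0\<close>] A0
          real_sqrt_ge_zero[OF A0]
        unfolding distrib_right mult_1_left by linarith
      finally have "(sqrt (\<Sum>j<k. (norm (v j))\<^sup>2))\<^sup>2 \<le> ((C + 1) * sqrt A)\<^sup>2"
        by (intro power_mono) (auto simp: sum_nonneg)
      then have "(\<Sum>j<k. (norm (v j))\<^sup>2) \<le> (C + 1)\<^sup>2 * A"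
        using A0 by (simp add: sum_nonneg power_mult_distrib)
      then show ?thesis
        using \<open>M > 0\<close> unfolding A_def F_def by (simp add: field_simps)
    qed
    with \<open>M > 0\<close> four show "\<exists>M>0. \<exists>\<sigma> :: nat \<Rightarrow> nat \<Rightarrow> real.
       (\<forall>a :: nat \<Rightarrow> real. (\<Sum>i<M. (\<Sum>j<k. \<sigma> i j * a j) ^ 4) \<le> 3 * real M * (\<Sum>j<k. (a j)\<^sup>2)\<^sup>2) \<and>
       (\<forall>v :: nat \<Rightarrow> 'e. real M * (\<Sum>j<k. (norm (v j))\<^sup>2)
          \<le> (C + 1)\<^sup>2 * (\<Sum>i<M. (norm (\<Sum>j<k. \<sigma> i j *\<^sub>R v j))\<^sup>2))"
      by (intro exI conjI allI) auto
  qed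
  then show ?thesis using \<open>C \<ge> 0\<close> by (intro exI[of _ "C + 1"]) auto
qed

text \<open>An operator from a finite-dimensional \<open>\<ell>\<^sub>\<infinity>\<close> into a space of cotype 2 is 2-summing, with a
  constant independent of the dimension. Truncating the Rademacher sums \<open>g\<close> at height \<open>T\<close>, the small
  parts are controlled by the operator norm and the large parts by \<open>K\<close> times their second
  moment, which is at most \<open>3 / T\<^sup>2\<close> by the fourth moment bound; a suitable \<open>T\<close> lets the second
  term be absorbed. Here \<open>K\<close> is the optimal squared constant, finite for trivial reasons.\<close>

lemma finite_cotype2_two_summing:
  fixes x :: "nat \<Rightarrow> 'e::real_normed_vector" and f :: "nat \<Rightarrow> nat \<Rightarrow> real"
  assumes "finite_cotype2 TYPE('e) C" and "0 < C" and "0 \<le> M"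
    and M: "\<And>a. (\<And>j. j < m \<Longrightarrow> \<bar>a j\<bar> \<le> 1) \<Longrightarrow> norm (\<Sum>j<m. a j *\<^sub>R x j) \<le> M"
    and f: "\<And>j. j < m \<Longrightarrow> (\<Sum>i<k. (f i j)\<^sup>2) \<le> 1"
  shows "(\<Sum>i<k. (norm (\<Sum>j<m. f i j *\<^sub>R x j))\<^sup>2) \<le> 48 * C ^ 4 * M\<^sup>2"
proof -
  define w where "w a = (\<Sum>j<m. a j *\<^sub>R x j)" for a
  have w_add: "w (\<lambda>j. a j + b j) = w a + w b" for a b
    by (simp add: w_def scaleR_add_left sum.distrib)
  have w_scale: "w (\<lambda>j. t * a j) = t *\<^sub>R w a" for a t
    by (simp add: w_def scaleR_right.sum)
  have w_sum: "w (\<lambda>j. \<Sum>i<k. s i * f i j) = (\<Sum>i<k. s i *\<^sub>R w (f i))" for s f and k :: nat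
    by (induction k) (simp_all add: w_add w_scale, simp add: w_def)
  have w_M: "norm (w a) \<le> T * M" if "\<And>j. j < m \<Longrightarrow> \<bar>a j\<bar> \<le> T" "0 < T" for a T
  proof -
    have "norm (w (\<lambda>j. (1 / T) * a j)) \<le> M"
      unfolding w_def by (rule M) (use that in \<open>auto simp: abs_mult\<close>)
    then show ?thesis using \<open>0 < T\<close> unfolding w_scale by (simp add: field_simps)
  qed
  define Q where "Q = {(\<Sum>i<k. (norm (w (f i)))\<^sup>2) | k f. \<forall>j<m. (\<Sum>i<(k::nat). (f i j)\<^sup>2) \<le> 1}"
  define K where "K = Sup Q"
  have "bdd_above Q"
  proof (rule bdd_aboveI)
    fix z assume "z \<in> Q"
    then obtain k f where z: "z = (\<Sum>i<k. (norm (w (f i)))\<^sup>2)" and f: "\<forall>j<m. (\<Sum>i<(k::nat). (f i j)\<^sup>2) \<le> 1"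
      unfolding Q_def by blast
    have "(norm (w a))\<^sup>2 \<le> (\<Sum>j<m. (a j)\<^sup>2) * (\<Sum>j<m. (norm (x j))\<^sup>2)" for a
    proof -
      have "norm (w a) \<le> (\<Sum>j<m. \<bar>a j\<bar> * norm (x j))"
        unfolding w_def by (rule order_trans[OF norm_sum]) simp
      then have "(norm (w a))\<^sup>2 \<le> (\<Sum>j<m. \<bar>a j\<bar> * norm (x j))\<^sup>2" by (intro power_mono) auto
      also have "\<dots> \<le> (\<Sum>j<m. \<bar>a j\<bar>\<^sup>2) * (\<Sum>j<m. (norm (x j))\<^sup>2)"
        by (rule Cauchy_Schwarz_ineq_sum)
      finally show ?thesis by simp
    qed
    then have "z \<le> (\<Sum>i<k. (\<Sum>j<m. (f i j)\<^sup>2) * (\<Sum>j<m. (norm (x j))\<^sup>2))"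
      unfolding z by (intro sum_mono) blast
    also have "\<dots> = (\<Sum>j<m. \<Sum>i<k. (f i j)\<^sup>2) * (\<Sum>j<m. (norm (x j))\<^sup>2)"
      unfolding sum_distrib_right[symmetric] by (subst sum.swap) simp
    also have "\<dots> \<le> (\<Sum>j<m. 1) * (\<Sum>j<m. (norm (x j))\<^sup>2)"
      using f by (intro mult_right_mono sum_mono) (auto simp: sum_nonneg)
    finally show "z \<le> (\<Sum>j<m. 1) * (\<Sum>j<m. (norm (x j))\<^sup>2)" .
  qed
  then have K: "(\<Sum>i<k. (norm (w (f i)))\<^sup>2) \<le> K" if "\<And>j. j < m \<Longrightarrow> (\<Sum>i<k. (f i j)\<^sup>2) \<le> 1" for k :: nat and f
  proof -
    have "(\<Sum>i<k. (norm (w (f i)))\<^sup>2) \<in> Q" using that unfolding Q_def by blast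
    with \<open>bdd_above Q\<close> show ?thesis unfolding K_def by (intro cSup_upper)
  qed
  have "K \<le> 24 * C ^ 4 * M\<^sup>2 + K / 2"
    unfolding K_def
  proof (rule cSup_least)
    show "Q \<noteq> {}" unfolding Q_def by (auto intro!: exI[of _ 0])
  next
    fix z assume "z \<in> Q"
    then obtain k f where z: "z = (\<Sum>i<k. (norm (w (f i)))\<^sup>2)"
      and f: "\<And>j. j < m \<Longrightarrow> (\<Sum>i<(k::nat). (f i j)\<^sup>2) \<le> 1"
      unfolding Q_def by blast
    obtain N :: nat and \<sigma> :: "nat \<Rightarrow> nat \<Rightarrow> real" where "N > 0"
      and four: "\<forall>a :: nat \<Rightarrow> real. (\<Sum>l<N. (\<Sum>i<k. \<sigma> l i * a i) ^ 4) \<le> 3 * real N * (\<Sum>i<k. (a i)\<^sup>2)\<^sup>2"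
      and cotype: "\<forall>v :: nat \<Rightarrow> 'e. real N * (\<Sum>i<k. (norm (v i))\<^sup>2) \<le> C\<^sup>2 * (\<Sum>l<N. (norm (\<Sum>i<k. \<sigma> l i *\<^sub>R v i))\<^sup>2)"
      using assms(1)[unfolded finite_cotype2_def, THEN spec, of k] by (elim exE conjE) (rule that)
    \<comment> \<open>With T^2 = 12 C^2 the large parts contribute 6 C^2 K / T^2 = K / 2, and the
      small parts 2 C^2 T^2 M^2 = 24 C^4 M^2.\<close>
    define T where "T = sqrt 12 * C"
    have T: "0 < T" "T\<^sup>2 = 12 * C\<^sup>2" using \<open>0 < C\<close> by (auto simp: T_def power_mult_distrib)
    define g where "g l j = (\<Sum>i<k. \<sigma> l i * f i j)" for l j
    define h where "h l j = (if \<bar>g l j\<bar> \<le> T then 0 else g l j)" for l j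
    \<comment> \<open>This factor makes \<open>c * h l j\<close> a competitor in the definition of
      \<open>K\<close>: pointwise h^2 T^2 \<le> g^4, and the fourth powers of \<open>g l j\<close>
      sum over l to at most 3 N.\<close>
    define c where "c = T / sqrt (3 * N)"
    have c: "0 < c" "c\<^sup>2 = T\<^sup>2 / (3 * N)"
      using T \<open>N > 0\<close> by (auto simp: c_def power_divide)
    have "(\<Sum>l<N. (norm (w (\<lambda>j. c * h l j)))\<^sup>2) \<le> K"
    proof (rule K)
      fix j assume "j < m"
      have pw: "(h l j)\<^sup>2 * T\<^sup>2 \<le> (g l j) ^ 4" for l
      proof (cases "\<bar>g l j\<bar> \<le> T")
        case False
        then have "T\<^sup>2 \<le> (g l j)\<^sup>2" using T by (intro abs_le_square_iff[THEN iffD1]) auto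
        then have "(g l j)\<^sup>2 * T\<^sup>2 \<le> (g l j)\<^sup>2 * (g l j)\<^sup>2" by (intro mult_left_mono) auto
        then show ?thesis using False by (simp add: h_def power4_eq_xxxx power2_eq_square mult.assoc)
      qed (simp add: h_def)
      have "(\<Sum>l<N. (c * h l j)\<^sup>2) = (\<Sum>l<N. (h l j)\<^sup>2 * T\<^sup>2) / (3 * N)"
        by (simp add: power_mult_distrib c sum_divide_distrib mult.commute)
      also have "\<dots> \<le> (\<Sum>l<N. (g l j) ^ 4) / (3 * N)"
        using pw by (intro divide_right_mono sum_mono) auto
      also have "\<dots> \<le> (\<Sum>i<k. (f i j)\<^sup>2)\<^sup>2"
        using four[THEN spec, of "\<lambda>i. f i j"] \<open>N > 0\<close> by (simp add: g_def field_simps)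
      also have "\<dots> \<le> 1" using f[OF \<open>j < m\<close>] by (simp add: power_le_one sum_nonneg)
      finally show "(\<Sum>l<N. (c * h l j)\<^sup>2) \<le> 1" .
    qed
    then have "c\<^sup>2 * (\<Sum>l<N. (norm (w (h l)))\<^sup>2) \<le> K"
      by (simp add: w_scale power_mult_distrib sum_distrib_left)
    then have wh: "(\<Sum>l<N. (norm (w (h l)))\<^sup>2) \<le> 3 * N * K / T\<^sup>2"
      using T(1) \<open>N > 0\<close> unfolding c(2) by (simp add: field_simps)
    have wg: "(norm (w (g l)))\<^sup>2 \<le> 2 * T\<^sup>2 * M\<^sup>2 + 2 * (norm (w (h l)))\<^sup>2" for l
    proof -
      have "w (g l) = w (\<lambda>j. g l j - h l j) + w (h l)"
        by (simp add: w_add[symmetric])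
      moreover have "norm (w (\<lambda>j. g l j - h l j)) \<le> T * M"
        by (rule w_M) (use T in \<open>auto simp: h_def\<close>)
      ultimately have "norm (w (g l)) \<le> T * M + norm (w (h l))"
        using norm_triangle_ineq[of "w (\<lambda>j. g l j - h l j)" "w (h l)"] by simp
      then have "(norm (w (g l)))\<^sup>2 \<le> (T * M + norm (w (h l)))\<^sup>2" by (intro power_mono) auto
      also have "\<dots> \<le> 2 * (T * M)\<^sup>2 + 2 * (norm (w (h l)))\<^sup>2"
        using sum_squares_bound[of "T * M" "norm (w (h l))"] by (simp add: power2_sum)
      finally show ?thesis by (simp add: power_mult_distrib)
    qed
    have "N * z \<le> C\<^sup>2 * (\<Sum>l<N. (norm (w (g l)))\<^sup>2)"
      using cotype[THEN spec, of "\<lambda>i. w (f i)"] unfolding z g_def w_sum .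
    also have "\<dots> \<le> C\<^sup>2 * (\<Sum>l<N. 2 * T\<^sup>2 * M\<^sup>2 + 2 * (norm (w (h l)))\<^sup>2)"
      using wg by (intro mult_left_mono sum_mono) auto
    also have "\<dots> = C\<^sup>2 * (N * (2 * T\<^sup>2 * M\<^sup>2) + 2 * (\<Sum>l<N. (norm (w (h l)))\<^sup>2))"
      by (simp add: sum.distrib sum_distrib_left[symmetric])
    also have "\<dots> \<le> C\<^sup>2 * (N * (2 * T\<^sup>2 * M\<^sup>2) + 2 * (3 * N * K / T\<^sup>2))"
      using wh by (intro mult_left_mono add_left_mono) auto
    also have "\<dots> = N * (24 * C ^ 4 * M\<^sup>2 + K / 2)"
      unfolding T(2) using \<open>0 < C\<close> by (simp add: field_simps power2_eq_square power4_eq_xxxx)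
    finally have "N * z \<le> N * (24 * C ^ 4 * M\<^sup>2 + K / 2)" .
    then have "z \<le> 24 * C ^ 4 * M\<^sup>2 + K / 2" using \<open>N > 0\<close> by simp
    then show "z \<le> 24 * C ^ 4 * M\<^sup>2 + Sup Q / 2" by (simp add: K_def)
  qed
  then have "K \<le> 48 * C ^ 4 * M\<^sup>2" by simp
  moreover have "(\<Sum>i<k. (norm (w (f i)))\<^sup>2) \<le> K" using f by (rule K)
  ultimately show ?thesis by (simp add: w_def)
qed

section \<open>Extrapolation of summing functions\<close>

text \<open>These are the properties of the dual ball on which the extrapolation rests, with
  linearity over the reals. The constant 2 leaves room for a complex functional built from a real
  one at half its size. \<open>D_parts\<close> splits a scalar into two real coordinates; for real
  scalars the second can be 0.\<close>

locale norming_functionals =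
  fixes D :: "('e::real_normed_vector \<Rightarrow> 'k::real_normed_vector) set"
  assumes D_nonempty: "D \<noteq> {}"
    and D_linear: "\<phi> \<in> D \<Longrightarrow> linear \<phi>"
    and D_bound: "\<phi> \<in> D \<Longrightarrow> norm (\<phi> x) \<le> norm x"
    and D_norming: "(\<And>\<phi>. \<phi> \<in> D \<Longrightarrow> norm (\<phi> x) \<le> b) \<Longrightarrow> norm x \<le> 2 * b"
    and D_parts: "\<exists>re im :: 'k \<Rightarrow> real. linear re \<and> linear im \<and> (\<forall>z. (norm z)\<^sup>2 = (re z)\<^sup>2 + (im z)\<^sup>2)"
begin

definition mean_norm :: "((('e \<Rightarrow> 'k) \<Rightarrow> real) \<Rightarrow> real) \<Rightarrow> 'e \<Rightarrow> real"
  where "mean_norm L x = sqrt (L (\<lambda>\<phi>. (norm (\<phi> x))\<^sup>2))"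

lemma D_scale: "\<phi> \<in> D \<Longrightarrow> norm (\<phi> (t *\<^sub>R x)) = \<bar>t\<bar> * norm (\<phi> x)"
  using D_linear by (simp add: linear_scale)

lemma mean_norm_sq: "L \<in> finite_means D \<Longrightarrow> (mean_norm L x)\<^sup>2 = L (\<lambda>\<phi>. (norm (\<phi> x))\<^sup>2)"
  by (simp add: mean_norm_def finite_means_nonneg)

lemma mean_norm_nonneg: "L \<in> finite_means D \<Longrightarrow> 0 \<le> mean_norm L x"
  by (simp add: mean_norm_def finite_means_nonneg)

lemma mean_norm_le:
  assumes "L \<in> finite_means D"
  shows "mean_norm L x \<le> norm x"
  unfolding mean_norm_def
proof (rule real_le_lsqrt)
  show "L (\<lambda>\<phi>. (norm (\<phi> x))\<^sup>2) \<le> (norm x)\<^sup>2"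
    by (rule finite_means_le[OF assms]) (simp add: power_mono D_bound)
qed simp

lemma mean_norm_homogeneous: "L \<in> finite_means D \<Longrightarrow> pos_homogeneous (mean_norm L)"
proof -
  assume L: "L \<in> finite_means D"
  have "L (\<lambda>\<phi>. (norm (\<phi> (t *\<^sub>R x)))\<^sup>2) = L (\<lambda>\<phi>. t\<^sup>2 * (norm (\<phi> x))\<^sup>2)" for t x
    by (rule antisym) (auto intro!: finite_means_mono[OF L] simp: D_scale power_mult_distrib)
  then have "mean_norm L (t *\<^sub>R x) = t * mean_norm L x" if "0 \<le> t" for t x
    using that by (simp add: mean_norm_def finite_means_scale[OF L] real_sqrt_mult)
  then show ?thesis using mean_norm_nonneg[OF L] by (simp add: pos_homogeneous_def)
qed

text \<open>By duality: the sum of the \<open>\<ell>\<^sub>2\<close> norms of the vectors \<open>(sqrt (w k) * \<psi> k (x j))\<^sub>k\<close> is obtained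
  by pairing them with their normalisations \<open>b\<close>, and this pairing only involves the vectors
  \<open>\<Sum>j. b k j *\<^sub>R x j\<close>.\<close>

lemma sum_l2_le:
  fixes x :: "nat \<Rightarrow> 'e" and \<psi> :: "nat \<Rightarrow> 'e \<Rightarrow> real"
  assumes C: "finite_cotype2 TYPE('e) C" "0 < C"
    and \<psi>: "\<And>k. k < r \<Longrightarrow> linear (\<psi> k)" "\<And>k v. k < r \<Longrightarrow> \<bar>\<psi> k v\<bar> \<le> norm v"
    and w: "\<And>k. k < r \<Longrightarrow> 0 \<le> w k" "(\<Sum>k<r. w k) = 1"
    and W: "\<And>\<phi>. \<phi> \<in> D \<Longrightarrow> (\<Sum>j<m. norm (\<phi> (x j))) \<le> W"
  shows "(\<Sum>j<m. sqrt (\<Sum>k<r. w k * (\<psi> k (x j))\<^sup>2)) \<le> 14 * C\<^sup>2 * W"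
proof -
  obtain \<phi> where "\<phi> \<in> D" using D_nonempty by blast
  have "0 \<le> (\<Sum>j<m. norm (\<phi> (x j)))" by (intro sum_nonneg) auto
  with W[OF \<open>\<phi> \<in> D\<close>] have W0: "0 \<le> W" by linarith
  define N where "N j = sqrt (\<Sum>k<r. w k * (\<psi> k (x j))\<^sup>2)" for j
  have N2: "(N j)\<^sup>2 = (\<Sum>k<r. w k * (\<psi> k (x j))\<^sup>2)" for j
    unfolding N_def by (rule real_sqrt_pow2) (use w in \<open>auto intro!: sum_nonneg\<close>)
  \<comment> \<open>If \<open>N j\<close> is 0, division makes \<open>b k j\<close> vanish.
    Therefore \<open>b1\<close> is only an inequality, while \<open>bN\<close> still holds.\<close>
  define b where "b k j = sqrt (w k) * \<psi> k (x j) / N j" for k j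
  have sw: "(sqrt (w k))\<^sup>2 = w k" if "k < r" for k using w(1)[OF that] by simp
  have b1: "(\<Sum>k<r. (b k j)\<^sup>2) \<le> 1" for j
  proof -
    have "(\<Sum>k<r. (b k j)\<^sup>2) = (\<Sum>k<r. w k * (\<psi> k (x j))\<^sup>2) / (N j)\<^sup>2"
      unfolding sum_divide_distrib
      by (intro sum.cong) (auto simp: b_def power_divide power_mult_distrib sw)
    then show ?thesis unfolding N2[symmetric] by simp
  qed
  have bN: "(\<Sum>k<r. sqrt (w k) * (b k j * \<psi> k (x j))) = N j" for j
  proof -
    have "(\<Sum>k<r. sqrt (w k) * (b k j * \<psi> k (x j))) = (\<Sum>k<r. w k * (\<psi> k (x j))\<^sup>2) / N j"
      unfolding sum_divide_distrib
    proof (intro sum.cong refl)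
      fix k assume "k \<in> {..<r}"
      then have "sqrt (w k) * sqrt (w k) = w k" using w(1) by simp
      then show "sqrt (w k) * (b k j * \<psi> k (x j)) = w k * (\<psi> k (x j))\<^sup>2 / N j"
        unfolding b_def power2_eq_square by (metis (no_types, lifting) mult.assoc mult.left_commute times_divide_eq_left times_divide_eq_right)
    qed
    then show ?thesis unfolding N2[symmetric] by (simp add: power2_eq_square)
  qed
  define v where "v k = (\<Sum>j<m. b k j *\<^sub>R x j)" for k
  have "(\<Sum>k<r. (norm (v k))\<^sup>2) \<le> 48 * C ^ 4 * (2 * W)\<^sup>2"
    unfolding v_def
  proof (rule finite_cotype2_two_summing[OF C])
    fix a :: "nat \<Rightarrow> real" assume a: "\<And>j. j < m \<Longrightarrow> \<bar>a j\<bar> \<le> 1"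
    show "norm (\<Sum>j<m. a j *\<^sub>R x j) \<le> 2 * W"
    proof (rule D_norming)
      fix \<phi> assume \<phi>: "\<phi> \<in> D"
      have "norm (\<phi> (\<Sum>j<m. a j *\<^sub>R x j)) \<le> (\<Sum>j<m. norm (\<phi> (a j *\<^sub>R x j)))"
        unfolding linear_sum[OF D_linear[OF \<phi>]] by (rule norm_sum)
      also have "\<dots> \<le> (\<Sum>j<m. 1 * norm (\<phi> (x j)))"
        unfolding D_scale[OF \<phi>] using a by (intro sum_mono mult_right_mono) auto
      finally show "norm (\<phi> (\<Sum>j<m. a j *\<^sub>R x j)) \<le> W" using W[OF \<phi>] by simp
    qed
  qed (use W0 b1 in auto)
  \<comment> \<open>The bound 2 W on the sign sums carries the factor 2 of \<open>D_norming\<close>;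
    192 is rounded up to 196 = 14^2 in order to take the root.\<close>
  also have "48 * C ^ 4 * (2 * W)\<^sup>2 = 192 * (C\<^sup>2 * W)\<^sup>2" by algebra
  also have "\<dots> \<le> 196 * (C\<^sup>2 * W)\<^sup>2" by simp
  also have "\<dots> = (14 * C\<^sup>2 * W)\<^sup>2" by algebra
  finally have v: "(\<Sum>k<r. (norm (v k))\<^sup>2) \<le> (14 * C\<^sup>2 * W)\<^sup>2" .
  have "(\<Sum>j<m. N j) = (\<Sum>k<r. \<Sum>j<m. sqrt (w k) * (b k j * \<psi> k (x j)))"
    unfolding bN[symmetric] by (rule sum.swap)
  also have "\<dots> = (\<Sum>k<r. sqrt (w k) * \<psi> k (v k))"
    unfolding v_def by (intro sum.cong refl) (simp add: linear_sum[OF \<psi>(1)] linear_scale[OF \<psi>(1)] sum_distrib_left)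
  also have "\<dots> \<le> (\<Sum>k<r. sqrt (w k) * norm (v k))"
  proof (intro sum_mono mult_left_mono)
    fix k assume k: "k \<in> {..<r}"
    then show "\<psi> k (v k) \<le> norm (v k)" using \<psi>(2)[of k "v k"] by simp
    show "0 \<le> sqrt (w k)" using k w(1) by simp
  qed
  also have "\<dots> \<le> 14 * C\<^sup>2 * W"
  proof (rule power2_le_imp_le)
    have "(\<Sum>k<r. sqrt (w k) * norm (v k))\<^sup>2 \<le> (\<Sum>k<r. (sqrt (w k))\<^sup>2) * (\<Sum>k<r. (norm (v k))\<^sup>2)"
      by (rule Cauchy_Schwarz_ineq_sum)
    also have "(\<Sum>k<r. (sqrt (w k))\<^sup>2) = 1" using sw w(2) by simp
    finally show "(\<Sum>k<r. sqrt (w k) * norm (v k))\<^sup>2 \<le> (14 * C\<^sup>2 * W)\<^sup>2" using v by simp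
    show "0 \<le> 14 * C\<^sup>2 * W" using W0 by simp
  qed
  finally show ?thesis by (simp add: N_def)
qed

text \<open>Real and imaginary parts are treated separately by \<open>sum_l2_le\<close>; the root of
  a sum is at most the sum of the roots, so the two constants 14 add up.\<close>

lemma mean_norm_one_summing:
  assumes C: "finite_cotype2 TYPE('e) C" "0 < C" and L: "L \<in> finite_means D"
  shows "p_summing_on D 1 (28 * C\<^sup>2) (mean_norm L)"
  unfolding p_summing_on_def
proof (intro allI impI)
  fix m :: nat and x :: "nat \<Rightarrow> 'e" and W
  assume "\<forall>\<phi>\<in>D. (\<Sum>j<m. norm (\<phi> (x j)) powr 1) \<le> W"
  then have W: "(\<Sum>j<m. norm (\<phi> (x j))) \<le> W" if "\<phi> \<in> D" for \<phi> using that by simp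
  obtain r :: nat and w a where r: "\<forall>k<r. 0 \<le> w k \<and> a k \<in> D" "(\<Sum>k<r. w k) = 1"
    and L_eq: "\<forall>f. L f = (\<Sum>k<r. w k * f (a k))"
    using finite_means_representation[OF L] by (elim exE conjE) (rule that)
  obtain re im :: "'k \<Rightarrow> real" where ri: "linear re" "linear im" "\<And>z. (norm z)\<^sup>2 = (re z)\<^sup>2 + (im z)\<^sup>2"
    using D_parts by blast
  have le: "\<bar>re z\<bar> \<le> norm z" "\<bar>im z\<bar> \<le> norm z" for z
    by (rule abs_le_square_iff[THEN iffD2, of _ "norm z", simplified abs_norm_cancel], simp add: ri(3))+
  have part: "(\<Sum>j<m. sqrt (\<Sum>k<r. w k * (f (a k (x j)))\<^sup>2)) \<le> 14 * C\<^sup>2 * W"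
    if f: "linear f" "\<And>z. \<bar>f z\<bar> \<le> norm z" for f :: "'k \<Rightarrow> real"
  proof (rule sum_l2_le[OF C, where \<psi> = "\<lambda>k v. f (a k v)"])
    show "linear (\<lambda>v. f (a k v))" if "k < r" for k
      using linear_compose[OF D_linear f(1)] r(1) that by (simp add: o_def)
    show "\<bar>f (a k v)\<bar> \<le> norm v" if "k < r" for k v
      using order_trans[OF f(2) D_bound] r(1) that by blast
  qed (use r W in auto)
  have "(\<Sum>j<m. mean_norm L (x j) powr 1) =
      (\<Sum>j<m. sqrt ((\<Sum>k<r. w k * (re (a k (x j)))\<^sup>2) + (\<Sum>k<r. w k * (im (a k (x j)))\<^sup>2)))"
    using mean_norm_nonneg[OF L]
    by (simp add: mean_norm_def L_eq[rule_format] ri(3) distrib_left sum.distrib)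
  also have "\<dots> \<le> (\<Sum>j<m. sqrt (\<Sum>k<r. w k * (re (a k (x j)))\<^sup>2) + sqrt (\<Sum>k<r. w k * (im (a k (x j)))\<^sup>2))"
    using r(1) by (intro sum_mono sqrt_add_le_add_sqrt sum_nonneg) auto
  also have "\<dots> \<le> 28 * C\<^sup>2 * W"
    using part[OF ri(1) le(1)] part[OF ri(2) le(2)] by (simp add: sum.distrib)
  finally show "(\<Sum>j<m. mean_norm L (x j) powr 1) \<le> 28 * C\<^sup>2 * W" .
qed

end

section \<open>Extrapolation to exponents below 1 and Maurey's theorem\<close>

lemma powr_add_le_two:
  fixes a b :: real
  assumes "0 \<le> a" "0 \<le> b" "0 < p" "p \<le> 1"
  shows "(a + b) powr p \<le> 2 * (a powr p + b powr p)"
proof -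
  have "(a + b) powr p \<le> (2 * max a b) powr p"
    using assms by (intro powr_mono2) auto
  also have "\<dots> = 2 powr p * max a b powr p" using assms by (simp add: powr_mult)
  also have "\<dots> \<le> 2 * max a b powr p"
    using powr_mono[of p 1 "2::real"] assms by (intro mult_right_mono) auto
  also have "\<dots> \<le> 2 * (a powr p + b powr p)" by (simp add: max_def)
  finally show ?thesis .
qed

text \<open>If the left-hand side is not dominated by the quadratic mean, then the quadratic mean is
  bounded by a multiple of \<open>L f\<close>, and \<open>f \<le> f\<^sup>2 / \<theta> + \<theta> powr (1 - p) * f powr p\<close> with \<open>\<theta>\<close> a large
  multiple of \<open>L f\<close> does the rest.\<close>

lemma mean_interpolation:
  fixes p \<kappa> :: real
  assumes p: "0 < p" "p \<le> 1" and "0 < \<kappa>"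
  shows "\<exists>c>0. \<forall>L\<in>finite_means D. \<forall>f. (\<forall>\<phi>\<in>D. 0 \<le> f \<phi>) \<longrightarrow>
    L f powr p \<le> \<kappa> * L (\<lambda>\<phi>. (f \<phi>)\<^sup>2) powr (p / 2) + c * L (\<lambda>\<phi>. f \<phi> powr p)"
proof -
  \<comment> \<open>Solving \<open>\<kappa> * z powr (p / 2) < y powr p\<close> for z gives z \<le>
    l y^2, and with \<theta> = 2 l y the quadratic term is then at most y / 2. Absorbing it doubles
    the other term, whence \<open>c\<close>.\<close>
  define l where "l = \<kappa> powr (- (2 / p))"
  define c where "c = 2 * (2 * l) powr (1 - p)"
  have "0 < l" "0 < c" using \<open>0 < \<kappa>\<close> by (auto simp: l_def c_def)
  have "L f powr p \<le> \<kappa> * L (\<lambda>\<phi>. (f \<phi>)\<^sup>2) powr (p / 2) + c * L (\<lambda>\<phi>. f \<phi> powr p)"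
    if L: "L \<in> finite_means D" and f: "\<forall>\<phi>\<in>D. 0 \<le> f \<phi>" for L f
  proof -
    define y where "y = L f"
    define z where "z = L (\<lambda>\<phi>. (f \<phi>)\<^sup>2)"
    define B where "B = L (\<lambda>\<phi>. f \<phi> powr p)"
    have nn: "0 \<le> y" "0 \<le> z" "0 \<le> B"
      unfolding y_def z_def B_def using f by (auto intro!: finite_means_nonneg[OF L])
    have "y powr p \<le> \<kappa> * z powr (p / 2) + c * B"
    proof (cases "y powr p \<le> \<kappa> * z powr (p / 2) \<or> y = 0")
      case True
      then show ?thesis using nn \<open>0 < c\<close> \<open>0 < \<kappa>\<close> by (auto intro: add_increasing2)
    next
      case False
      then have "0 < y" and less: "\<kappa> * z powr (p / 2) < y powr p" using nn by auto
      have "z powr (p / 2) \<le> y powr p / \<kappa>" using less \<open>0 < \<kappa>\<close> by (simp add: field_simps)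
      then have "(z powr (p / 2)) powr (2 / p) \<le> (y powr p / \<kappa>) powr (2 / p)"
        using p by (intro powr_mono2) auto
      then have z: "z \<le> l * y\<^sup>2"
        using p nn \<open>0 < \<kappa>\<close> \<open>0 < y\<close>
        by (simp add: powr_powr powr_divide l_def powr_minus divide_simps mult.commute)
      define \<theta> where "\<theta> = 2 * l * y"
      have "0 < \<theta>" using \<open>0 < l\<close> \<open>0 < y\<close> by (simp add: \<theta>_def)
      have pw: "s \<le> (1 / \<theta>) * s\<^sup>2 + \<theta> powr (1 - p) * s powr p" if "0 \<le> s" for s :: real
      proof (cases "s \<le> \<theta>")
        case True
        have "s = s powr (1 - p) * s powr p" using that by (cases "s = 0") (auto simp: powr_add[symmetric])
        also have "\<dots> \<le> \<theta> powr (1 - p) * s powr p"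
          using True that p by (intro mult_right_mono powr_mono2) auto
        finally show ?thesis using \<open>0 < \<theta>\<close> by (simp add: add_increasing)
      next
        case False
        then have "s \<le> (1 / \<theta>) * s\<^sup>2"
          using \<open>0 < \<theta>\<close> by (simp add: divide_simps power2_eq_square mult.commute)
        then show ?thesis by (simp add: add_increasing2)
      qed
      have "y \<le> (1 / \<theta>) * z + \<theta> powr (1 - p) * B"
        using finite_means_mono[OF L, of f "\<lambda>\<phi>. (1 / \<theta>) * (f \<phi>)\<^sup>2 + \<theta> powr (1 - p) * f \<phi> powr p"] pw f
        unfolding y_def z_def B_def finite_means_add[OF L] finite_means_scale[OF L] by blast
      moreover have "(1 / \<theta>) * z \<le> y / 2"
        using z \<open>0 < l\<close> \<open>0 < y\<close> by (simp add: \<theta>_def divide_simps power2_eq_square mult_ac)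
      ultimately have "y \<le> 2 * (\<theta> powr (1 - p) * B)" by linarith
      also have "\<dots> = y powr (1 - p) * (c * B)"
        using \<open>0 < l\<close> \<open>0 < y\<close> by (simp add: \<theta>_def c_def powr_mult)
      finally have "y powr (1 - p) * y powr p \<le> y powr (1 - p) * (c * B)"
        using \<open>0 < y\<close> by (simp add: powr_add[symmetric])
      then have "y powr p \<le> c * B" using \<open>0 < y\<close> by simp
      then show ?thesis using \<open>0 < \<kappa>\<close> by (simp add: add_increasing)
    qed
    then show ?thesis by (simp add: y_def z_def B_def)
  qed
  with \<open>0 < c\<close> show ?thesis by (intro exI[of _ c]) blast
qed

context norming_functionals
begin

lemma mean_norm_p_summing:
  assumes cot: "finite_cotype2 TYPE('e) C" "0 < C" and p: "0 < p" "p \<le> 1"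
  shows "\<exists>c>0. \<forall>L\<in>finite_means D. p_summing_on D p c (mean_norm L)"
proof -
  define K where "K = 28 * C\<^sup>2"
  have "0 < K" using \<open>0 < C\<close> by (simp add: K_def)
  have one: "p_summing_on D 1 K (mean_norm L)" if "L \<in> finite_means D" for L
    unfolding K_def by (rule mean_norm_one_summing[OF cot that])
  \<comment> \<open>Passing from one mean to the next costs a factor 2 K^p, so with the coefficient
    1 / (4 K^p) half of the power of the new mean norm is left.\<close>
  obtain c where "0 < c" and c: "\<forall>L\<in>finite_means D. \<forall>f. (\<forall>\<phi>\<in>D. 0 \<le> f \<phi>) \<longrightarrow>
      L f powr p \<le> 1 / (4 * K powr p) * L (\<lambda>\<phi>. (f \<phi>)\<^sup>2) powr (p / 2) + c * L (\<lambda>\<phi>. f \<phi> powr p)"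
    using mean_interpolation[OF p, of "1 / (4 * K powr p)" D] \<open>0 < K\<close> by auto
  have "p_summing_on D p (4 * K powr p * c) (mean_norm L0)" if L0: "L0 \<in> finite_means D" for L0
    unfolding p_summing_on_def
  proof (intro allI impI)
    fix m :: nat and x :: "nat \<Rightarrow> 'e" and W
    assume W: "\<forall>\<phi>\<in>D. (\<Sum>j<m. norm (\<phi> (x j)) powr p) \<le> W"
    define s where "s L = (\<Sum>j<m. mean_norm L (x j) powr p)" for L
    \<comment> \<open>Each \<open>s L\<close> is at most the same sum with \<open>norm\<close> in
      place of \<open>mean_norm L\<close>, so \<open>S\<close> is a genuine supremum and can absorb
      S / 2.\<close>
    define S where "S = Sup (s ` finite_means D)"
    have "s L \<le> (\<Sum>j<m. norm (x j) powr p)" if "L \<in> finite_means D" for L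
      unfolding s_def using that p by (intro sum_mono powr_mono2 mean_norm_le mean_norm_nonneg) auto
    then have s_le: "s L \<le> S" if "L \<in> finite_means D" for L
      unfolding S_def using that by (intro cSUP_upper) (auto intro!: bdd_aboveI2)
    have "s L \<le> S / 2 + 2 * K powr p * c * W + \<delta>" if L: "L \<in> finite_means D" and "0 < \<delta>" for L \<delta>
    proof -
      \<comment> \<open>Chosen so that 2 \<epsilon>^p = \<delta> / (m + 1); the m errors then sum to
        at most \<delta>, and m + 1 avoids division by 0.\<close>
      define \<epsilon> where "\<epsilon> = (\<delta> / (2 * Suc m)) powr (1 / p)"
      have \<epsilon>: "0 < \<epsilon>" "\<epsilon> powr p = \<delta> / (2 * Suc m)"
        using \<open>0 < \<delta>\<close> p by (auto simp: \<epsilon>_def powr_powr)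
      obtain L' where L': "L' \<in> finite_means D"
        and dom: "\<forall>j<m. mean_norm L (x j) powr 1 \<le> K * L' (\<lambda>\<phi>. norm (\<phi> (x j)) powr 1) + \<epsilon>"
      proof (rule bexE)
        show "\<exists>L'\<in>finite_means D. \<forall>j<m. mean_norm L (x j) powr 1 \<le> K * L' (\<lambda>\<phi>. norm (\<phi> (x j)) powr 1) + \<epsilon>"
          by (rule finite_domination[OF zero_less_one one[OF L]])
            (simp_all add: \<open>0 < K\<close> D_nonempty mean_norm_homogeneous[OF L] D_scale D_bound \<epsilon>(1))
      qed
      have "mean_norm L (x j) powr p \<le> mean_norm L' (x j) powr p / 2
          + 2 * K powr p * c * L' (\<lambda>\<phi>. norm (\<phi> (x j)) powr p) + \<delta> / Suc m" if "j < m" for j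
      proof -
        let ?y = "L' (\<lambda>\<phi>. norm (\<phi> (x j)))"
        have y0: "0 \<le> ?y" by (rule finite_means_nonneg[OF L']) simp
        have "mean_norm L (x j) \<le> K * ?y + \<epsilon>"
          using dom[rule_format, OF that] mean_norm_nonneg[OF L, of "x j"] by simp
        then have "mean_norm L (x j) powr p \<le> (K * ?y + \<epsilon>) powr p"
          using mean_norm_nonneg[OF L] p by (intro powr_mono2) auto
        also have "\<dots> \<le> 2 * ((K * ?y) powr p + \<epsilon> powr p)"
          using y0 \<open>0 < K\<close> \<epsilon> p by (intro powr_add_le_two) auto
        also have "(K * ?y) powr p = K powr p * ?y powr p"
          using y0 \<open>0 < K\<close> by (simp add: powr_mult)
        finally have 1: "mean_norm L (x j) powr p \<le> 2 * (K powr p * ?y powr p + \<epsilon> powr p)" .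
        have sq: "L' (\<lambda>\<phi>. (norm (\<phi> (x j)))\<^sup>2) powr (p / 2) = mean_norm L' (x j) powr p"
          unfolding mean_norm_sq[OF L', symmetric]
          using mean_norm_nonneg[OF L', of "x j"] by (simp add: powr_powr flip: powr_numeral)
        have "K powr p * ?y powr p \<le> K powr p * (1 / (4 * K powr p) * mean_norm L' (x j) powr p
            + c * L' (\<lambda>\<phi>. norm (\<phi> (x j)) powr p))"
          using c[rule_format, OF L', of "\<lambda>\<phi>. norm (\<phi> (x j))"] unfolding sq
          by (intro mult_left_mono) auto
        also have "\<dots> = mean_norm L' (x j) powr p / 4 + K powr p * c * L' (\<lambda>\<phi>. norm (\<phi> (x j)) powr p)"
          using \<open>0 < K\<close> by (simp add: distrib_left)
        finally have 2: "K powr p * ?y powr p \<le> mean_norm L' (x j) powr p / 4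
            + K powr p * c * L' (\<lambda>\<phi>. norm (\<phi> (x j)) powr p)" .
        have 3: "2 * (\<epsilon> powr p) = \<delta> / Suc m" unfolding \<epsilon>(2) by (simp add: field_simps)
        have "a \<le> 2 * (u + e) \<Longrightarrow> u \<le> b / 4 + v \<Longrightarrow> 2 * e = d \<Longrightarrow> a \<le> b / 2 + 2 * v + d"
          for a b d e u v :: real by simp
        from this[OF 1 2 3] show ?thesis by (simp only: mult.assoc)
      qed
      then have "s L \<le> (\<Sum>j<m. mean_norm L' (x j) powr p / 2
          + 2 * K powr p * c * L' (\<lambda>\<phi>. norm (\<phi> (x j)) powr p) + \<delta> / Suc m)"
        unfolding s_def by (intro sum_mono) auto
      also have "\<dots> = s L' / 2 + 2 * K powr p * c * L' (\<lambda>\<phi>. \<Sum>j<m. norm (\<phi> (x j)) powr p) + m * (\<delta> / Suc m)"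
        by (simp add: sum.distrib s_def finite_means_sum[OF L'] sum_distrib_left sum_divide_distrib)
      also have "\<dots> \<le> S / 2 + 2 * K powr p * c * W + \<delta>"
      proof (intro add_mono mult_left_mono)
        show "s L' / 2 \<le> S / 2" using s_le[OF L'] by simp
        show "L' (\<lambda>\<phi>. \<Sum>j<m. norm (\<phi> (x j)) powr p) \<le> W" using W by (intro finite_means_le[OF L']) auto
        show "m * (\<delta> / Suc m) \<le> \<delta>" using \<open>0 < \<delta>\<close> by (simp add: field_simps)
      qed (use \<open>0 < c\<close> \<open>0 < K\<close> in auto)
      finally show ?thesis .
    qed
    then have "s L \<le> S / 2 + 2 * K powr p * c * W" if "L \<in> finite_means D" for L
      by (rule field_le_epsilon) (rule that)
    then have "Sup (s ` finite_means D) \<le> S / 2 + 2 * K powr p * c * W"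
      by (intro cSUP_least) (use L0 in blast)+
    then have "S \<le> S / 2 + 2 * K powr p * c * W" by (simp only: S_def)
    then have "S \<le> 4 * K powr p * c * W" by simp
    then show "(\<Sum>j<m. mean_norm L0 (x j) powr p) \<le> 4 * K powr p * c * W"
      using s_le[OF L0] by (simp add: s_def)
  qed
  with \<open>0 < K\<close> \<open>0 < c\<close> show ?thesis by (intro exI[of _ "4 * K powr p * c"]) auto
qed

text \<open>On a given finite set of points, domination bounds \<open>N\<close> by a multiple of
  some \<open>mean_norm L\<close>, up to an error. The mean depends on the points, so what counts is
  that the constant \<open>c\<close> serves all means at once.\<close>

theorem two_summing_imp_p_summing:
  assumes cot: "finite_cotype2 TYPE('e) C" "0 < C" and p: "0 < p" "p \<le> 2"
    and N: "p_summing_on D 2 A N" "0 < A" "pos_homogeneous N"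
  shows "\<exists>A'>0. p_summing_on D p A' N"
proof -
  have le1: "\<exists>A'>0. p_summing_on D p A' N" if p: "0 < p" "p \<le> 1" for p
  proof -
    obtain c where "0 < c" and c: "\<forall>L\<in>finite_means D. p_summing_on D p c (mean_norm L)"
      using mean_norm_p_summing[OF cot p] by (elim exE conjE) (rule that)
    have N0: "0 \<le> N v" for v using N(3) by (simp add: pos_homogeneous_def)
    have "p_summing_on D p (2 * A powr (p / 2) * c) N"
      unfolding p_summing_on_def
    proof (intro allI impI)
      fix m :: nat and x :: "nat \<Rightarrow> 'e" and W
      assume W: "\<forall>\<phi>\<in>D. (\<Sum>j<m. norm (\<phi> (x j)) powr p) \<le> W"
      show "(\<Sum>j<m. N (x j) powr p) \<le> 2 * A powr (p / 2) * c * W"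
      proof (rule field_le_epsilon)
        fix \<delta> :: real assume "0 < \<delta>"
        define \<epsilon> where "\<epsilon> = (\<delta> / (2 * Suc m)) powr (2 / p)"
        have \<epsilon>: "0 < \<epsilon>" "\<epsilon> powr (p / 2) = \<delta> / (2 * Suc m)"
          using \<open>0 < \<delta>\<close> p by (auto simp: \<epsilon>_def powr_powr)
        obtain L where L: "L \<in> finite_means D"
          and dom: "\<forall>j<m. N (x j) powr 2 \<le> A * L (\<lambda>\<phi>. norm (\<phi> (x j)) powr 2) + \<epsilon>"
        proof (rule bexE)
          show "\<exists>L\<in>finite_means D. \<forall>j<m. N (x j) powr 2 \<le> A * L (\<lambda>\<phi>. norm (\<phi> (x j)) powr 2) + \<epsilon>"
            by (rule finite_domination[OF _ N(1)]) (simp_all add: D_nonempty N D_scale D_bound \<epsilon>(1))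
        qed
        have "N (x j) powr p \<le> 2 * A powr (p / 2) * mean_norm L (x j) powr p + \<delta> / Suc m" if "j < m" for j
        proof -
          have "N (x j) powr p = (N (x j) powr 2) powr (p / 2)" by (simp add: powr_powr)
          also have "\<dots> \<le> (A * (mean_norm L (x j))\<^sup>2 + \<epsilon>) powr (p / 2)"
            using dom[rule_format, OF that] p unfolding mean_norm_sq[OF L] by (intro powr_mono2) auto
          also have "\<dots> \<le> 2 * ((A * (mean_norm L (x j))\<^sup>2) powr (p / 2) + \<epsilon> powr (p / 2))"
            using p N(2) \<epsilon> by (intro powr_add_le_two) auto
          also have "(A * (mean_norm L (x j))\<^sup>2) powr (p / 2) = A powr (p / 2) * mean_norm L (x j) powr p"
            using N(2) mean_norm_nonneg[OF L, of "x j"]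
            by (simp add: powr_mult powr_powr flip: powr_numeral)
          finally show ?thesis by (simp add: \<epsilon>(2) field_simps)
        qed
        then have "(\<Sum>j<m. N (x j) powr p) \<le> (\<Sum>j<m. 2 * A powr (p / 2) * mean_norm L (x j) powr p + \<delta> / Suc m)"
          by (intro sum_mono) auto
        also have "\<dots> = 2 * A powr (p / 2) * (\<Sum>j<m. mean_norm L (x j) powr p) + m * (\<delta> / Suc m)"
          by (simp add: sum.distrib sum_distrib_left)
        also have "\<dots> \<le> 2 * A powr (p / 2) * (c * W) + \<delta>"
        proof (intro add_mono mult_left_mono)
          show "(\<Sum>j<m. mean_norm L (x j) powr p) \<le> c * W"
            using W by (intro p_summing_onD[OF c[rule_format, OF L]]) auto
          show "m * (\<delta> / Suc m) \<le> \<delta>" using \<open>0 < \<delta>\<close> by (simp add: field_simps)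
        qed auto
        finally show "(\<Sum>j<m. N (x j) powr p) \<le> 2 * A powr (p / 2) * c * W + \<delta>" by (simp add: mult_ac)
      qed
    qed
    with N(2) \<open>0 < c\<close> show ?thesis by (intro exI[of _ "2 * A powr (p / 2) * c"]) auto
  qed
  show ?thesis
  proof (cases "p \<le> 1")
    case True
    with le1 p show ?thesis by blast
  next
    case False
    obtain A1 where "0 < A1" "p_summing_on D 1 A1 N" using le1[of 1] by auto
    with False N(3) show ?thesis by (intro p_summing_on_inclusion[of 1 p D A1 N]) (auto simp: D_scale)
  qed
qed

end

section \<open>Regular measures from finitely additive set functions\<close>

text \<open>The set function \<open>m\<close> is only finitely additive. It is turned into a regular measure that dominates
  it on closed sets, which is enough to bound integrals of continuous functions from below.\<close>

locale compact_content =
  fixes T :: "'a topology" and m :: "'a set \<Rightarrow> real"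
  assumes compact: "compact_space T" and Hausdorff: "Hausdorff_space T"
    and m_nonneg: "0 \<le> m A"
    and m_space: "m (topspace T) = 1"
    and m_Un: "A \<subseteq> topspace T \<Longrightarrow> B \<subseteq> topspace T \<Longrightarrow> A \<inter> B = {} \<Longrightarrow> m (A \<union> B) = m A + m B"
begin

definition inner_content :: "'a set \<Rightarrow> ennreal"
  where "inner_content U = (SUP K\<in>{K. closedin T K \<and> K \<subseteq> U}. ennreal (m K))"

definition outer_content :: "'a set \<Rightarrow> ennreal"
  where "outer_content A = (INF U\<in>{U. openin T U \<and> A \<subseteq> U}. inner_content U)"

lemma m_mono:
  assumes "A \<subseteq> B" "B \<subseteq> topspace T"
  shows "m A \<le> m B"
proof -
  have "m (A \<union> (B - A)) = m A + m (B - A)" by (rule m_Un) (use assms in auto)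
  moreover have "A \<union> (B - A) = B" using assms by auto
  ultimately show ?thesis using m_nonneg[of "B - A"] by simp
qed

lemma m_subadditive: "A \<subseteq> topspace T \<Longrightarrow> B \<subseteq> topspace T \<Longrightarrow> m (A \<union> B) \<le> m A + m B"
  using m_Un[of A "B - A"] m_mono[of "B - A" B] by (simp add: Diff_subset[THEN subset_trans])

lemma m_empty: "m {} = 0"
  using m_Un[of "{}" "{}"] by simp

lemma inner_content_upper: "closedin T K \<Longrightarrow> K \<subseteq> U \<Longrightarrow> ennreal (m K) \<le> inner_content U"
  unfolding inner_content_def by (intro SUP_upper) auto

lemma inner_content_least: "(\<And>K. closedin T K \<Longrightarrow> K \<subseteq> U \<Longrightarrow> ennreal (m K) \<le> c) \<Longrightarrow> inner_content U \<le> c"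
  unfolding inner_content_def by (intro SUP_least) auto

lemma inner_content_mono: "U \<subseteq> V \<Longrightarrow> inner_content U \<le> inner_content V"
  by (intro inner_content_least inner_content_upper) auto

lemma inner_content_empty: "inner_content {} = 0"
  using inner_content_least[of "{}" 0] by (auto simp: m_empty)

text \<open>Normality separates the disjoint closed sets \<open>K - U\<close> and
  \<open>K - V\<close> by open sets \<open>A\<close> and \<open>B\<close>; then \<open>K - A\<close>
  and \<open>K - B\<close> are closed, lie in \<open>U\<close> and \<open>V\<close>, and cover
  \<open>K\<close>.\<close>

lemma inner_content_Un:
  assumes U: "openin T U" and V: "openin T V"
  shows "inner_content (U \<union> V) \<le> inner_content U + inner_content V"
proof (rule inner_content_least)
  fix K assume K: "closedin T K" "K \<subseteq> U \<union> V"
  have "closedin T (K - U)" "closedin T (K - V)" using K U V by (auto intro: closedin_diff)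
  moreover have "disjnt (K - U) (K - V)" using K by (auto simp: disjnt_def)
  ultimately obtain A B where AB: "openin T A" "openin T B" "K - U \<subseteq> A" "K - V \<subseteq> B" "disjnt A B"
    using compact_Hausdorff_or_regular_imp_normal_space[OF compact] Hausdorff
    unfolding normal_space_def by meson
  have cl: "closedin T (K - A)" "closedin T (K - B)" using K AB by (auto intro: closedin_diff)
  have sub: "K - A \<subseteq> topspace T" "K - B \<subseteq> topspace T" using cl by (auto dest: closedin_subset)
  have "K = (K - A) \<union> (K - B)" using AB(5) by (auto simp: disjnt_def)
  then have "ennreal (m K) \<le> ennreal (m (K - A) + m (K - B))"
    using m_subadditive[OF sub] by (intro ennreal_leI) simp
  also have "\<dots> = ennreal (m (K - A)) + ennreal (m (K - B))" by (simp add: m_nonneg)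
  also have "\<dots> \<le> inner_content U + inner_content V"
    using cl AB by (intro add_mono inner_content_upper) auto
  finally show "ennreal (m K) \<le> inner_content U + inner_content V" .
qed

lemma inner_content_finite_UN:
  fixes U :: "nat \<Rightarrow> 'a set"
  assumes "\<And>i. openin T (U i)"
  shows "inner_content (\<Union>i<n. U i) \<le> (\<Sum>i<n. inner_content (U i))"
proof (induction n)
  case (Suc n)
  have "inner_content (\<Union>i<Suc n. U i) = inner_content ((\<Union>i<n. U i) \<union> U n)" by (simp add: lessThan_Suc Un_commute)
  also have "\<dots> \<le> inner_content (\<Union>i<n. U i) + inner_content (U n)" using assms by (intro inner_content_Un) auto
  finally show ?case using Suc by (simp add: order_trans[OF _ add_right_mono])
qed (simp add: inner_content_empty)

text \<open>Compactness of \<open>K\<close> reduces the countable union to a finite one, which is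
  how countable subadditivity arises although \<open>m\<close> is only finitely additive.\<close>

lemma inner_content_UN:
  fixes U :: "nat \<Rightarrow> 'a set"
  assumes "\<And>i. openin T (U i)"
  shows "inner_content (\<Union>i. U i) \<le> (\<Sum>i. inner_content (U i))"
proof (rule inner_content_least)
  fix K assume K: "closedin T K" "K \<subseteq> (\<Union>i. U i)"
  then have "compactin T K" using compact by (simp add: closedin_compact_space)
  then obtain \<F> where F: "finite \<F>" "\<F> \<subseteq> range U" "K \<subseteq> \<Union>\<F>"
    using K assms unfolding compactin_def by (metis (no_types, lifting) rangeE)
  then obtain I where I: "finite I" "\<F> = U ` I" by (meson finite_subset_image)
  obtain n where "I \<subseteq> {..<n}" using I(1) finite_nat_iff_bounded by blast
  then have "K \<subseteq> (\<Union>i<n. U i)" using F I by blast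
  then have "ennreal (m K) \<le> inner_content (\<Union>i<n. U i)" using K by (intro inner_content_upper)
  also have "\<dots> \<le> (\<Sum>i<n. inner_content (U i))" using assms by (rule inner_content_finite_UN)
  also have "\<dots> \<le> (\<Sum>i. inner_content (U i))" by (intro sum_le_suminf) auto
  finally show "ennreal (m K) \<le> (\<Sum>i. inner_content (U i))" .
qed

lemma outer_content_lower: "openin T U \<Longrightarrow> A \<subseteq> U \<Longrightarrow> outer_content A \<le> inner_content U"
  unfolding outer_content_def by (intro INF_lower) auto

lemma outer_content_open: "openin T U \<Longrightarrow> outer_content U = inner_content U"
  by (intro antisym outer_content_lower) (auto simp: outer_content_def intro!: INF_greatest inner_content_mono)

lemma outer_content_mono: "A \<subseteq> B \<Longrightarrow> outer_content A \<le> outer_content B"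
  unfolding outer_content_def by (intro INF_superset_mono) auto

lemma outer_content_closed: "closedin T F \<Longrightarrow> ennreal (m F) \<le> outer_content F"
  unfolding outer_content_def by (intro INF_greatest inner_content_upper) auto

lemma outer_content_space: "outer_content (topspace T) = 1"
proof -
  have "inner_content (topspace T) \<le> 1"
  proof (rule inner_content_least)
    fix K assume "closedin T K" "K \<subseteq> topspace T"
    then show "ennreal (m K) \<le> 1" using m_mono[of K "topspace T"] by (simp add: m_space)
  qed
  moreover have "1 \<le> inner_content (topspace T)"
    using inner_content_upper[of "topspace T" "topspace T"] by (simp add: m_space)
  ultimately show ?thesis by (simp add: outer_content_open)
qed

lemma outer_content_countably_subadditive:
  fixes A :: "nat \<Rightarrow> 'a set"
  assumes "\<And>i. A i \<subseteq> topspace T"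
  shows "outer_content (\<Union>i. A i) \<le> (\<Sum>i. outer_content (A i))"
proof (rule ennreal_le_epsilon)
  fix e :: real assume fin: "(\<Sum>i. outer_content (A i)) < top" and e: "0 < e"
  have "\<exists>U. openin T U \<and> A i \<subseteq> U \<and> inner_content U \<le> outer_content (A i) + ennreal (e * (1 / 2) ^ Suc i)" for i
  proof -
    have "outer_content (A i) < top" using fin by (auto simp: less_top dest!: ennreal_suminf_lessD)
    then have "outer_content (A i) < outer_content (A i) + ennreal (e * (1 / 2) ^ Suc i)"
      using e by auto
    then show ?thesis
      by (subst (asm) outer_content_def) (auto simp: INF_less_iff intro: less_imp_le)
  qed
  then obtain U where U: "\<And>i. openin T (U i)" "\<And>i. A i \<subseteq> U i"
    "\<And>i. inner_content (U i) \<le> outer_content (A i) + ennreal (e * (1 / 2) ^ Suc i)"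
    by metis
  have "outer_content (\<Union>i. A i) \<le> inner_content (\<Union>i. U i)"
    using U by (intro outer_content_lower) auto
  also have "\<dots> \<le> (\<Sum>i. inner_content (U i))" using U(1) by (rule inner_content_UN)
  also have "\<dots> \<le> (\<Sum>i. outer_content (A i) + ennreal (e * (1 / 2) ^ Suc i))"
    using U(3) by (intro suminf_le) auto
  also have "\<dots> = (\<Sum>i. outer_content (A i)) + (\<Sum>i. ennreal e * ennreal ((1 / 2) ^ Suc i))"
    using e by (subst suminf_add[symmetric])
      (auto simp del: ennreal_suminf_cmult simp add: ennreal_mult[symmetric])
  also have "\<dots> = (\<Sum>i. outer_content (A i)) + ennreal e"
    unfolding ennreal_suminf_cmult
    by (subst suminf_ennreal_eq[OF zero_le_power power_half_series]) auto
  finally show "outer_content (\<Union>i. A i) \<le> (\<Sum>i. outer_content (A i)) + ennreal e" .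
qed

lemma outer_measure_space_outer: "outer_measure_space (Pow (topspace T)) outer_content"
  unfolding outer_measure_space_def
proof (intro conjI)
  show "positive (Pow (topspace T)) outer_content"
    by (simp add: positive_def outer_content_open inner_content_empty)
  show "increasing (Pow (topspace T)) outer_content"
    by (auto simp: increasing_def intro: outer_content_mono)
  show "countably_subadditive (Pow (topspace T)) outer_content"
    unfolding countably_subadditive_def by (auto intro!: outer_content_countably_subadditive)
qed

lemma outer_content_Un: "A \<subseteq> topspace T \<Longrightarrow> B \<subseteq> topspace T \<Longrightarrow> A \<inter> B = {} \<Longrightarrow> outer_content (A \<union> B) \<le> outer_content A + outer_content B"
  using ring_of_sets.countably_subadditive_subadditive[of "topspace T" "Pow (topspace T)" outer_content]
    outer_measure_space_outer ring_of_sets_Pow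
  by (auto simp: outer_measure_space_def subadditive_def)

text \<open>Caratheodory's criterion is tested on open \<open>G\<close> containing \<open>A\<close>.
  For closed \<open>K\<close> inside \<open>G \<inter> U\<close> the set \<open>G - K\<close> is
  open and contains \<open>G - U\<close>, and every closed \<open>K'\<close> in it is disjoint from
  \<open>K\<close>, so additivity of \<open>m\<close> applies to
  \<open>K \<union> K'\<close>.\<close>

lemma open_in_lambda_system:
  assumes U: "openin T U"
  shows "U \<in> lambda_system (topspace T) (Pow (topspace T)) outer_content"
  unfolding lambda_system_def
proof (intro CollectI conjI ballI)
  show "U \<in> Pow (topspace T)" using openin_subset[OF U] by simp
  fix A assume "A \<in> Pow (topspace T)"
  then have A: "A \<subseteq> topspace T" by simp
  have "outer_content (U \<inter> A) + outer_content ((topspace T - U) \<inter> A) \<le> outer_content A"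
    unfolding outer_content_def[of A]
  proof (rule INF_greatest)
    fix G assume "G \<in> {U. openin T U \<and> A \<subseteq> U}"
    then have G: "openin T G" "A \<subseteq> G" by auto
    have "outer_content (U \<inter> A) + outer_content ((topspace T - U) \<inter> A) \<le> inner_content (G \<inter> U) + outer_content (G - U)"
      using G U A openin_subset[OF G(1)] by (intro add_mono outer_content_lower outer_content_mono) auto
    also have "\<dots> \<le> inner_content G"
    proof -
      have "ennreal (m K) + outer_content (G - U) \<le> inner_content G" if K: "closedin T K" "K \<subseteq> G \<inter> U" for K
      proof -
        have "outer_content (G - U) \<le> inner_content (G - K)" using G K by (intro outer_content_lower) auto
        then have "ennreal (m K) + outer_content (G - U) \<le> ennreal (m K) + inner_content (G - K)"
          by (rule add_left_mono)
        also have "\<dots> = (SUP K'\<in>{K'. closedin T K' \<and> K' \<subseteq> G - K}. ennreal (m K) + ennreal (m K'))"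
          unfolding inner_content_def by (rule ennreal_SUP_add_right) (auto intro!: exI[of _ "{}"])
        also have "\<dots> \<le> inner_content G"
        proof (rule SUP_least)
          fix K' assume "K' \<in> {K'. closedin T K' \<and> K' \<subseteq> G - K}"
          then have K': "closedin T K'" "K' \<subseteq> G - K" by auto
          have "ennreal (m K) + ennreal (m K') = ennreal (m K + m K')" by (simp add: m_nonneg)
          also have "m K + m K' = m (K \<union> K')"
            using K K' by (intro m_Un[symmetric] closedin_subset) auto
          also have "ennreal (m (K \<union> K')) \<le> inner_content G"
            using K K' by (intro inner_content_upper closedin_Un) auto
          finally show "ennreal (m K) + ennreal (m K') \<le> inner_content G" .
        qed
        finally show ?thesis .
      qed
      then show ?thesis
        unfolding inner_content_def[of "G \<inter> U"]
        by (subst ennreal_SUP_add_left[symmetric]) (auto intro!: SUP_least exI[of _ "{}"])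
    qed
    finally show "outer_content (U \<inter> A) + outer_content ((topspace T - U) \<inter> A) \<le> inner_content G" .
  qed
  moreover have "A = (U \<inter> A) \<union> ((topspace T - U) \<inter> A)" using A by auto
  then have "outer_content A \<le> outer_content (U \<inter> A) + outer_content ((topspace T - U) \<inter> A)"
    using outer_content_Un[of "U \<inter> A" "(topspace T - U) \<inter> A"] A by auto
  ultimately show "outer_content (U \<inter> A) + outer_content ((topspace T - U) \<inter> A) = outer_content A" by (rule antisym)
qed

text \<open>Outer regularity is built into \<open>outer_content\<close>. Inner regularity comes from
  approximating the complement from outside by open sets: the total mass is 1 and closed sets are
  compact.\<close>

lemma regular_measure_exists:
  "\<exists>\<mu>. regular_borel_prob T \<mu> \<and> (\<forall>F. closedin T F \<longrightarrow> m F \<le> measure \<mu> F)"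
proof -
  let ?X = "topspace T" and ?O = "{U. openin T U}"
  interpret P: sigma_algebra ?X "Pow ?X" by (rule sigma_algebra_Pow)
  define \<Lambda> where "\<Lambda> = lambda_system ?X (Pow ?X) outer_content"
  have ms: "measure_space ?X \<Lambda> outer_content"
    unfolding \<Lambda>_def by (rule P.caratheodory_lemma[OF outer_measure_space_outer])
  then interpret \<Lambda>: sigma_algebra ?X \<Lambda> by (simp add: measure_space_def)
  have sub: "sigma_sets ?X ?O \<subseteq> \<Lambda>"
    using open_in_lambda_system by (intro \<Lambda>.sigma_sets_subset) (auto simp: \<Lambda>_def)
  have O: "?O \<subseteq> Pow ?X" by (auto dest: openin_subset)
  define \<mu> where "\<mu> = measure_of ?X ?O outer_content"
  have sets: "sets \<mu> = sigma_sets ?X ?O" and space: "space \<mu> = ?X"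
    using O by (simp_all add: \<mu>_def)
  have em: "emeasure \<mu> A = outer_content A" if "A \<in> sets \<mu>" for A
  proof (rule emeasure_measure_of[OF \<mu>_def O _ _ that])
    show "positive (sets \<mu>) outer_content"
      using ms by (simp add: measure_space_def positive_def)
    show "countably_additive (sets \<mu>) outer_content"
    proof (rule countably_additiveI)
      fix A :: "nat \<Rightarrow> 'a set"
      assume A: "range A \<subseteq> sets \<mu>" "disjoint_family A" "(\<Union>i. A i) \<in> sets \<mu>"
      have "countably_additive \<Lambda> outer_content" using ms by (simp add: measure_space_def)
      moreover have "range A \<subseteq> \<Lambda>" "(\<Union>i. A i) \<in> \<Lambda>" using A sub by (auto simp: sets)
      ultimately show "(\<Sum>i. outer_content (A i)) = outer_content (\<Union>i. A i)"
        using A(2) unfolding countably_additive_def by blast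
    qed
  qed
  have open_sets: "U \<in> sets \<mu>" if "openin T U" for U
    using that by (auto simp: sets)
  have closed_sets: "F \<in> sets \<mu>" if "closedin T F" for F
    using sets.compl_sets[OF open_sets[OF openin_diff[OF openin_topspace that]]] closedin_subset[OF that]
    by (simp add: space double_diff)
  have "emeasure \<mu> (space \<mu>) = 1" using em[of ?X] open_sets[of ?X] by (simp add: space outer_content_space)
  then interpret prob_space \<mu> by (rule prob_spaceI)
  have outer_reg: "emeasure \<mu> A = (INF U\<in>{U. openin T U \<and> A \<subseteq> U}. emeasure \<mu> U)" if "A \<in> sets \<mu>" for A
    unfolding em[OF that] outer_content_def by (intro INF_cong) (auto simp: em open_sets outer_content_open)
  have "emeasure \<mu> A = (SUP K\<in>{K. compactin T K \<and> K \<subseteq> A}. emeasure \<mu> K)" if A: "A \<in> sets \<mu>" for A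
  proof (rule antisym)
    show "(SUP K\<in>{K. compactin T K \<and> K \<subseteq> A}. emeasure \<mu> K) \<le> emeasure \<mu> A"
      using A by (intro SUP_least emeasure_mono) auto
    show "emeasure \<mu> A \<le> (SUP K\<in>{K. compactin T K \<and> K \<subseteq> A}. emeasure \<mu> K)"
    proof (rule ennreal_le_epsilon)
      fix e :: real assume "0 < e"
      have cA: "?X - A \<in> sets \<mu>" using sets.compl_sets[OF A] by (simp add: space)
      have "emeasure \<mu> (?X - A) < emeasure \<mu> (?X - A) + ennreal e"
        using \<open>0 < e\<close> by (simp add: emeasure_eq_measure)
      then have "(INF U\<in>{U. openin T U \<and> ?X - A \<subseteq> U}. emeasure \<mu> U) < emeasure \<mu> (?X - A) + ennreal e"
        unfolding outer_reg[OF cA] .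
      then obtain U where U: "openin T U" "?X - A \<subseteq> U" "emeasure \<mu> U < emeasure \<mu> (?X - A) + ennreal e"
        unfolding INF_less_iff by auto
      have K: "compactin T (?X - U)" using U(1) compact by (intro closedin_compact_space) auto
      have "measure \<mu> U < measure \<mu> (?X - A) + e"
        using U(3) \<open>0 < e\<close> by (simp add: emeasure_eq_measure ennreal_less_iff flip: ennreal_plus)
      then have "measure \<mu> A \<le> measure \<mu> (?X - U) + e"
        using prob_compl[OF A] prob_compl[OF open_sets[OF U(1)]] by (simp add: space)
      then have "emeasure \<mu> A \<le> emeasure \<mu> (?X - U) + ennreal e"
        using \<open>0 < e\<close> by (simp add: emeasure_eq_measure flip: ennreal_plus)
      also have "\<dots> \<le> (SUP K\<in>{K. compactin T K \<and> K \<subseteq> A}. emeasure \<mu> K) + ennreal e"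
        using K U(2) by (intro add_right_mono SUP_upper) auto
      finally show "emeasure \<mu> A \<le> (SUP K\<in>{K. compactin T K \<and> K \<subseteq> A}. emeasure \<mu> K) + ennreal e" .
    qed
  qed
  with outer_reg have "regular_borel_prob T \<mu>"
    unfolding regular_borel_prob_def using prob_space_axioms sets space by blast
  moreover have "m F \<le> measure \<mu> F" if "closedin T F" for F
    using outer_content_closed[OF that] em[OF closed_sets[OF that]]
    by (metis emeasure_eq_measure ennreal_le_iff measure_nonneg)
  ultimately show ?thesis by blast
qed

end

lemma regular_borel_prob_measurable:
  assumes "regular_borel_prob T \<mu>" and "continuous_map T euclideanreal f"
  shows "f \<in> borel_measurable \<mu>"
proof (rule borel_measurableI)
  fix S :: "real set" assume "open S"
  have "f -` S \<inter> space \<mu> = {a \<in> topspace T. f a \<in> S}"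
    using assms(1) by (auto simp: regular_borel_prob_def)
  moreover have "openin T {a \<in> topspace T. f a \<in> S}"
    using openin_continuous_map_preimage[OF assms(2)] \<open>open S\<close> by simp
  ultimately show "f -` S \<inter> space \<mu> \<in> sets \<mu>"
    using assms(1) by (auto simp: regular_borel_prob_def)
qed

text \<open>The sum counts the levels \<open>l * \<epsilon>\<close> not exceeding \<open>s\<close>,
  that is, it equals the floor of s / \<epsilon>. The number \<open>N\<close> of levels does not
  depend on \<open>s\<close>, so it can be fixed for a whole function bounded by
  \<open>b\<close>.\<close>

lemma staircase_bounds:
  fixes s \<epsilon> :: real
  assumes "0 \<le> s" "s \<le> b" "0 < \<epsilon>" and N: "N = nat \<lfloor>b / \<epsilon>\<rfloor>"
  shows "s \<le> \<epsilon> + \<epsilon> * (\<Sum>l=1..N. of_bool (real l * \<epsilon> \<le> s))"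
    and "\<epsilon> * (\<Sum>l=1..N. of_bool (real l * \<epsilon> \<le> s)) \<le> s"
proof -
  define k where "k = nat \<lfloor>s / \<epsilon>\<rfloor>"
  have s0: "0 \<le> s / \<epsilon>" using assms by simp
  have k: "real k \<le> s / \<epsilon>" "s / \<epsilon> < real k + 1"
  proof -
    have "real k = of_int \<lfloor>s / \<epsilon>\<rfloor>" using s0 by (simp add: k_def)
    then show "real k \<le> s / \<epsilon>" "s / \<epsilon> < real k + 1"
      using floor_correct[of "s / \<epsilon>"] by simp_all
  qed
  have "s / \<epsilon> \<le> b / \<epsilon>" using assms by (intro divide_right_mono) auto
  then have "k \<le> N" unfolding k_def N by (intro nat_mono floor_mono)
  have "{l \<in> {1..N}. real l * \<epsilon> \<le> s} = {1..k}"
  proof -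
    have "real l * \<epsilon> \<le> s \<longleftrightarrow> l \<le> k" for l
    proof -
      have "real l * \<epsilon> \<le> s \<longleftrightarrow> real l \<le> s / \<epsilon>" using \<open>0 < \<epsilon>\<close> by (simp add: pos_le_divide_eq)
      also have "\<dots> \<longleftrightarrow> l \<le> k" using k by linarith
      finally show ?thesis .
    qed
    then have "{l \<in> {1..N}. real l * \<epsilon> \<le> s} = {l \<in> {1..N}. l \<le> k}" by (simp only:)
    also have "\<dots> = {1..k}" using \<open>k \<le> N\<close> by auto
    finally show ?thesis .
  qed
  then have "(\<Sum>l=1..N. of_bool (real l * \<epsilon> \<le> s)) = real k"
    by (simp add: sum_of_bool_eq Int_def)
  then show "s \<le> \<epsilon> + \<epsilon> * (\<Sum>l=1..N. of_bool (real l * \<epsilon> \<le> s))"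
    "\<epsilon> * (\<Sum>l=1..N. of_bool (real l * \<epsilon> \<le> s)) \<le> s"
    using k \<open>0 < \<epsilon>\<close> by (simp_all add: field_simps)
qed

text \<open>The finitely supported means give finitely additive set functions; these form a subset of
  the compact space of functions \<open>'a set \<Rightarrow> {0..1}\<close>, so that the conditions imposed
  by finitely many indices can be met simultaneously. Replacing \<open>f i\<close> by a staircase
  function turns each condition into one on finitely many values of the set function.\<close>

lemma regular_measure_from_finite_means:
  fixes T :: "'a topology" and f :: "'i \<Rightarrow> 'a \<Rightarrow> real" and g b :: "'i \<Rightarrow> real"
  assumes T: "compact_space T" "Hausdorff_space T"
    and cont: "\<And>i. continuous_map T euclideanreal (f i)"
    and bnd: "\<And>i a. a \<in> topspace T \<Longrightarrow> 0 \<le> f i a \<and> f i a \<le> b i"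
    and fin: "\<And>I \<epsilon>. finite I \<Longrightarrow> 0 < \<epsilon> \<Longrightarrow> \<exists>L\<in>finite_means (topspace T). \<forall>i\<in>I. g i \<le> L (f i) + \<epsilon>"
  shows "\<exists>\<mu>. regular_borel_prob T \<mu> \<and> (\<forall>i. g i \<le> (LINT a|\<mu>. f i a))"
proof -
  let ?X = "topspace T"
  \<comment> \<open>The inequality is non-strict to make these sets closed, since on closed sets the
    measure will dominate the set function.\<close>
  define F where "F i \<epsilon> l = {a \<in> ?X. real l * \<epsilon> \<le> f i a}" for i and \<epsilon> :: real and l :: nat
  define n where "n i \<epsilon> = nat \<lfloor>b i / \<epsilon>\<rfloor>" for i and \<epsilon> :: real
  \<comment> \<open>One \<open>\<epsilon>\<close> pays for the staircase, the other for the slack in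
    \<open>fin\<close>. Only finitely many coordinates of \<open>c\<close> occur, so the condition
    is closed in the product topology.\<close>
  define R where "R = (\<lambda>(i, \<epsilon>). {c :: 'a set \<Rightarrow> real. g i \<le> 2 * \<epsilon> + \<epsilon> * (\<Sum>l=1..n i \<epsilon>. c (F i \<epsilon> l))})"
  define Z where "Z = (PiE UNIV (\<lambda>_. {0..1})) \<inter> {c :: 'a set \<Rightarrow> real. c ?X = 1} \<inter>
    (\<Inter>(A, B)\<in>{(A, B). A \<subseteq> ?X \<and> B \<subseteq> ?X \<and> A \<inter> B = {}}. {c. c (A \<union> B) = c A + c B})"
  have ev: "continuous_on UNIV (\<lambda>c :: 'a set \<Rightarrow> real. c A)" for A
    by (rule continuous_on_product_coordinates)
  have "compact (PiE UNIV (\<lambda>_ :: 'a set. {0..1 :: real}))"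
    unfolding compactin_euclidean_iff[symmetric] euclidean_product_topology[symmetric] compactin_PiE
    by simp
  then have "compact Z"
    unfolding Z_def Int_assoc
    by (rule compact_Int_closed)
      (auto intro!: closed_Int closed_INT closed_Collect_eq continuous_on_add ev)
  have closed: "closed (R q)" for q
    unfolding R_def
    by (cases q) (auto intro!: closed_Collect_le continuous_on_add continuous_on_mult continuous_on_sum ev)
  have "Z \<inter> (\<Inter>q\<in>UNIV \<times> {0<..}. R q) \<noteq> {}"
  proof (rule compact_imp_fip_image[OF \<open>compact Z\<close> closed])
    fix J assume J: "finite J" "J \<subseteq> (UNIV :: 'i set) \<times> {0 :: real<..}"
    define e where "e = Min (insert 1 (snd ` J))"
    have "0 < e" unfolding e_def using J by (subst Min_gr_iff) auto
    have e_le: "e \<le> \<epsilon>" if "(i, \<epsilon>) \<in> J" for i \<epsilon>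
      unfolding e_def using J that by (intro Min_le) force+
    obtain L where L: "L \<in> finite_means ?X" "\<forall>i\<in>fst ` J. g i \<le> L (f i) + e"
      using fin[of "fst ` J" e] J \<open>0 < e\<close> by auto
    define c where "c A = L (\<lambda>a. of_bool (a \<in> A))" for A
    have "0 \<le> c A" "c A \<le> 1" for A
      unfolding c_def by (auto intro!: finite_means_nonneg[OF L(1)] finite_means_le[OF L(1)])
    moreover have "c ?X = 1"
    proof (rule antisym)
      show "1 \<le> c ?X" unfolding c_def
        using finite_means_mono[OF L(1), of "\<lambda>_. 1" "\<lambda>a. of_bool (a \<in> ?X)"] finite_means_const[OF L(1), of 1]
        by simp
    qed fact
    moreover have "c (A \<union> B) = c A + c B" if "A \<inter> B = {}" for A B
    proof -
      have "(\<lambda>a. of_bool (a \<in> A \<union> B)) = (\<lambda>a. of_bool (a \<in> A) + of_bool (a \<in> B) :: real)"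
        using that by (auto simp: fun_eq_iff)
      then show ?thesis unfolding c_def by (simp only: finite_means_add[OF L(1)])
    qed
    ultimately have "c \<in> Z" unfolding Z_def by auto
    moreover have "c \<in> R q" if "q \<in> J" for q
    proof -
      obtain i \<epsilon> where q: "q = (i, \<epsilon>)" by (cases q)
      have "0 < \<epsilon>" using J that q by auto
      have "L (f i) \<le> L (\<lambda>a. \<epsilon> + \<epsilon> * (\<Sum>l=1..n i \<epsilon>. of_bool (a \<in> F i \<epsilon> l)))"
      proof (rule finite_means_mono[OF L(1)])
        fix a assume "a \<in> ?X"
        with bnd[OF this, of i] staircase_bounds(1)[of "f i a" "b i" \<epsilon> "n i \<epsilon>"] \<open>0 < \<epsilon>\<close>
        show "f i a \<le> \<epsilon> + \<epsilon> * (\<Sum>l=1..n i \<epsilon>. of_bool (a \<in> F i \<epsilon> l))"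
          by (simp add: F_def n_def)
      qed
      also have "\<dots> = \<epsilon> + \<epsilon> * (\<Sum>l=1..n i \<epsilon>. c (F i \<epsilon> l))"
        unfolding c_def by (simp only: finite_means_add[OF L(1)] finite_means_scale[OF L(1)]
            finite_means_sum[OF L(1)] finite_means_const[OF L(1)])
      finally show ?thesis
        using L(2) e_le[of i \<epsilon>] that q unfolding R_def by force
    qed
    ultimately show "Z \<inter> (\<Inter>q\<in>J. R q) \<noteq> {}" by blast
  qed
  then obtain c where c: "c \<in> Z" and "\<forall>q\<in>UNIV \<times> {0<..}. c \<in> R q" by auto
  then have cR: "g i \<le> 2 * \<epsilon> + \<epsilon> * (\<Sum>l=1..n i \<epsilon>. c (F i \<epsilon> l))" if "0 < \<epsilon>" for i \<epsilon>
    using that unfolding R_def by auto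
  interpret compact_content T c
    by standard (use T c in \<open>auto simp: Z_def PiE_iff\<close>)
  obtain \<mu> where \<mu>: "regular_borel_prob T \<mu>" and c_le: "\<forall>F. closedin T F \<longrightarrow> c F \<le> measure \<mu> F"
    using regular_measure_exists by blast
  interpret prob_space \<mu> using \<mu> by (simp add: regular_borel_prob_def)
  have space: "space \<mu> = ?X" and sets: "sets \<mu> = sigma_sets ?X {U. openin T U}"
    using \<mu> by (auto simp: regular_borel_prob_def)
  have closed_sets: "F \<in> sets \<mu>" if "closedin T F" for F
  proof -
    have "?X - F \<in> sets \<mu>" unfolding sets using that by (intro sigma_sets.Basic) auto
    from sets.compl_sets[OF this] closedin_subset[OF that] show ?thesis
      by (simp add: space double_diff)
  qed
  have cF: "closedin T (F i \<epsilon> l)" for i \<epsilon> l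
    unfolding F_def using closedin_continuous_map_preimage[OF cont, of "{real l * \<epsilon>..}" i] by simp
  have meas: "f i \<in> borel_measurable \<mu>" for i
    using regular_borel_prob_measurable[OF \<mu> cont] .
  have ind: "integrable \<mu> (\<lambda>a. indicator (F i \<epsilon> l) a :: real)" for i \<epsilon> l
    by (rule integrable_real_indicator[OF closed_sets[OF cF]]) (simp add: emeasure_eq_measure)
  have int: "integrable \<mu> (f i)" for i
    using meas bnd by (intro integrable_const_bound[of _ "b i"]) (auto simp: space)
  have "g i \<le> (LINT a|\<mu>. f i a)" for i
  proof (rule field_le_epsilon)
    fix \<delta> :: real assume "0 < \<delta>"
    define \<epsilon> where "\<epsilon> = \<delta> / 2"
    have "0 < \<epsilon>" using \<open>0 < \<delta>\<close> by (simp add: \<epsilon>_def)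
    have "g i \<le> 2 * \<epsilon> + \<epsilon> * (\<Sum>l=1..n i \<epsilon>. c (F i \<epsilon> l))" using cR[OF \<open>0 < \<epsilon>\<close>] .
    also have "\<dots> \<le> 2 * \<epsilon> + \<epsilon> * (\<Sum>l=1..n i \<epsilon>. measure \<mu> (F i \<epsilon> l))"
      using c_le cF \<open>0 < \<epsilon>\<close> by (intro add_left_mono mult_left_mono sum_mono) auto
    also have "\<epsilon> * (\<Sum>l=1..n i \<epsilon>. measure \<mu> (F i \<epsilon> l)) =
        (LINT a|\<mu>. \<epsilon> * (\<Sum>l=1..n i \<epsilon>. indicator (F i \<epsilon> l) a))"
      using closed_sets[OF cF] by (simp add: Bochner_Integration.integral_sum[OF ind])
    also have "\<dots> \<le> (LINT a|\<mu>. f i a)"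
    proof (rule integral_mono[OF _ int])
      show "integrable \<mu> (\<lambda>a. \<epsilon> * (\<Sum>l=1..n i \<epsilon>. indicator (F i \<epsilon> l) a))"
        by (intro integrable_mult_right Bochner_Integration.integrable_sum ind)
      fix a assume "a \<in> space \<mu>"
      then have "a \<in> ?X" by (simp add: space)
      with bnd[OF this, of i] staircase_bounds(2)[of "f i a" "b i" \<epsilon> "n i \<epsilon>"] \<open>0 < \<epsilon>\<close>
      show "\<epsilon> * (\<Sum>l=1..n i \<epsilon>. indicator (F i \<epsilon> l) a) \<le> f i a"
        by (simp add: F_def n_def indicator_def)
    qed
    finally show "g i \<le> (LINT a|\<mu>. f i a) + \<delta>" by (simp add: \<epsilon>_def)
  qed
  with \<mu> show ?thesis by blast
qed

section \<open>The dual ball\<close>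

definition sublinear :: "('e::real_vector \<Rightarrow> real) \<Rightarrow> bool"
  where "sublinear q \<longleftrightarrow> (\<forall>x y. q (x + y) \<le> q x + q y) \<and> (\<forall>t\<ge>0. \<forall>x. q (t *\<^sub>R x) = t * q x)"

lemma sublinear_zero: "sublinear q \<Longrightarrow> q 0 = 0"
  unfolding sublinear_def by (metis mult_zero_left order_refl scaleR_zero_left)

lemma sublinear_minus: "sublinear q \<Longrightarrow> - q (- x) \<le> q x"
  using sublinear_zero[of q] unfolding sublinear_def
  by (metis add.right_inverse add.commute neg_le_iff_le le_add_same_cancel2 minus_le_iff add_le_same_cancel1 diff_ge_0_iff_ge diff_minus_eq_add)

text \<open>An upper estimate for positive t suffices in homogeneity: applied with 1 / t to the
  scaled vector it gives the lower one.\<close>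

lemma sublinearI:
  assumes add: "\<And>x y. q (x + y) \<le> q x + q y" and "q 0 = 0"
    and scale: "\<And>t x. 0 < t \<Longrightarrow> q (t *\<^sub>R x) \<le> t * q x"
  shows "sublinear q"
proof -
  have "q (t *\<^sub>R x) = t * q x" if "0 \<le> t" for t x
  proof (cases "t = 0")
    case False
    with that have t: "0 < t" by simp
    have "q ((1 / t) *\<^sub>R (t *\<^sub>R x)) \<le> (1 / t) * q (t *\<^sub>R x)" using t by (intro scale) simp
    then have "t * q x \<le> q (t *\<^sub>R x)" using t by (simp add: field_simps)
    with scale[OF t, of x] show ?thesis by simp
  qed (simp add: \<open>q 0 = 0\<close>)
  with add show ?thesis by (simp add: sublinear_def)
qed

text \<open>The infimal convolution of \<open>q\<close> with the function sending -t y to -t q(y) on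
  the ray t \<ge> 0. It stays below \<open>q\<close>, while its value at -y is pushed down to at
  most -q(y).\<close>

definition shift_inf :: "'e::real_vector \<Rightarrow> ('e \<Rightarrow> real) \<Rightarrow> 'e \<Rightarrow> real"
  where "shift_inf y q x = (INF t\<in>{0..}. q (x + t *\<^sub>R y) - t * q y)"

lemma
  assumes q: "sublinear q"
  shows sublinear_shift_inf: "sublinear (shift_inf y q)"
    and shift_inf_le: "shift_inf y q x \<le> q x"
    and shift_inf_minus: "shift_inf y q (- y) \<le> - q y"
proof -
  have add: "q (x + z) \<le> q x + q z" and scale: "0 \<le> t \<Longrightarrow> q (t *\<^sub>R x) = t * q x" for x z t
    using q by (auto simp: sublinear_def)
  have lower: "shift_inf y q x \<le> q (x + t *\<^sub>R y) - t * q y" if "0 \<le> t" for t x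
    unfolding shift_inf_def
  proof (rule cINF_lower)
    show "bdd_below ((\<lambda>t. q (x + t *\<^sub>R y) - t * q y) ` {0..})"
    proof (rule bdd_belowI2)
      fix t :: real assume "t \<in> {0..}"
      then show "- q (- x) \<le> q (x + t *\<^sub>R y) - t * q y"
        using add[of "x + t *\<^sub>R y" "- x"] scale[of t y] by simp
    qed
  qed (use that in simp)
  have greatest: "c \<le> shift_inf y q x" if "\<And>t. 0 \<le> t \<Longrightarrow> c \<le> q (x + t *\<^sub>R y) - t * q y" for c x
    unfolding shift_inf_def by (rule cINF_greatest) (use that in auto)
  show "shift_inf y q x \<le> q x" using lower[of 0 x] by simp
  show "shift_inf y q (- y) \<le> - q y" using lower[of 1 "- y"] sublinear_zero[OF q] by simp
  show "sublinear (shift_inf y q)"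
  proof (rule sublinearI)
    fix x z
    have "shift_inf y q (x + z) - (q (z + t *\<^sub>R y) - t * q y) \<le> shift_inf y q x" if t: "0 \<le> t" for t
    proof (rule greatest)
      fix s :: real assume s: "0 \<le> s"
      have "shift_inf y q (x + z) \<le> q ((x + s *\<^sub>R y) + (z + t *\<^sub>R y)) - (s + t) * q y"
        using lower[of "s + t" "x + z"] s t by (simp add: scaleR_add_left add_ac)
      also have "\<dots> \<le> q (x + s *\<^sub>R y) + q (z + t *\<^sub>R y) - (s + t) * q y"
        using add by simp
      finally show "shift_inf y q (x + z) - (q (z + t *\<^sub>R y) - t * q y) \<le> q (x + s *\<^sub>R y) - s * q y"
        by (simp add: algebra_simps)
    qed
    then have "shift_inf y q (x + z) - shift_inf y q x \<le> q (z + t *\<^sub>R y) - t * q y" if "0 \<le> t" for t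
      using that by (simp add: algebra_simps)
    then have "shift_inf y q (x + z) - shift_inf y q x \<le> shift_inf y q z" by (rule greatest)
    then show "shift_inf y q (x + z) \<le> shift_inf y q x + shift_inf y q z" by simp
  next
    show "shift_inf y q 0 = 0"
    proof (rule antisym)
      show "shift_inf y q 0 \<le> 0" using lower[of 0 0] sublinear_zero[OF q] by simp
      show "0 \<le> shift_inf y q 0" by (rule greatest) (simp add: scale)
    qed
  next
    fix a :: real and x assume a: "0 < a"
    have "(1 / a) * shift_inf y q (a *\<^sub>R x) \<le> shift_inf y q x"
    proof (rule greatest)
      fix t :: real assume t: "0 \<le> t"
      have "shift_inf y q (a *\<^sub>R x) \<le> q (a *\<^sub>R x + (a * t) *\<^sub>R y) - (a * t) * q y"
        using a t by (intro lower) simp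
      also have "a *\<^sub>R x + (a * t) *\<^sub>R y = a *\<^sub>R (x + t *\<^sub>R y)" by (simp add: scaleR_add_right)
      also have "q (a *\<^sub>R (x + t *\<^sub>R y)) = a * q (x + t *\<^sub>R y)" using a by (intro scale) simp
      finally show "(1 / a) * shift_inf y q (a *\<^sub>R x) \<le> q (x + t *\<^sub>R y) - t * q y"
        using a by (simp add: field_simps)
    qed
    then show "shift_inf y q (a *\<^sub>R x) \<le> a * shift_inf y q x" using a by (simp add: field_simps)
  qed
qed

text \<open>A minimal sublinear functional \<open>q\<close> is linear, because \<open>shift_inf y q \<le> q\<close> forces
  \<open>q x + q y \<le> q (x + y)\<close>.\<close>

lemma hahn_banach_sublinear:
  fixes p :: "'e::real_vector \<Rightarrow> real"
  assumes p: "sublinear p"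
  shows "\<exists>l. linear l \<and> (\<forall>x. l x \<le> p x)"
proof -
  define A where "A = {q. sublinear q \<and> (\<forall>x. q x \<le> p x)}"
  \<comment> \<open>The order is reversed, so that the maximal elements of Zorn's lemma are minimal
    functionals.\<close>
  define P where "P q r \<longleftrightarrow> (\<forall>x. r x \<le> q x)" for q r :: "'e \<Rightarrow> real"
  have "\<exists>q\<in>A. \<forall>r\<in>A. P q r \<longrightarrow> r = q"
  proof (rule predicate_Zorn)
    show "partial_order_on A (relation_of P A)"
      unfolding partial_order_on_def preorder_on_def refl_on_def trans_def antisym_def relation_of_def P_def
      by (auto simp: fun_eq_iff intro: order_trans order_antisym)
  next
    fix C assume C: "C \<in> Chains (relation_of P A)"
    then have CA: "C \<subseteq> A" and chain: "\<And>q r. q \<in> C \<Longrightarrow> r \<in> C \<Longrightarrow> P q r \<or> P r q"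
      unfolding Chains_def relation_of_def by auto
    show "\<exists>u\<in>A. \<forall>q\<in>C. P q u"
    proof (cases "C = {}")
      case True
      with p show ?thesis by (auto simp: A_def)
    next
      case False
      define I where "I x = (INF q\<in>C. q x)" for x
      have lower: "I x \<le> q x" if "q \<in> C" for q x
        unfolding I_def
      proof (rule cINF_lower[OF bdd_belowI2 that])
        fix r assume "r \<in> C"
        then have "sublinear r" "r (- x) \<le> p (- x)" using CA by (auto simp: A_def)
        then show "- p (- x) \<le> r x" using sublinear_minus[of r x] by simp
      qed
      have greatest: "c \<le> I x" if "\<And>q. q \<in> C \<Longrightarrow> c \<le> q x" for c x
        unfolding I_def by (rule cINF_greatest[OF False that])
      have sub: "q (x + y) \<le> q x + q y" "0 \<le> t \<Longrightarrow> q (t *\<^sub>R x) = t * q x" "q 0 = 0"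
        if "q \<in> C" for q x y t
      proof -
        have "sublinear q" using CA that by (auto simp: A_def)
        then show "q (x + y) \<le> q x + q y" "0 \<le> t \<Longrightarrow> q (t *\<^sub>R x) = t * q x" "q 0 = 0"
          by (auto simp: sublinear_zero) (auto simp: sublinear_def)
      qed
      have "sublinear I"
      proof (rule sublinearI)
        fix x y
        have "I (x + y) - r y \<le> q x" if qr: "q \<in> C" "r \<in> C" for q r
        proof -
          obtain h where h: "h \<in> C" "h x \<le> q x" "h y \<le> r y"
            using chain[OF qr] qr unfolding P_def by blast
          with lower[OF h(1), of "x + y"] sub(1)[OF h(1), of x y] show ?thesis by linarith
        qed
        then have "I (x + y) - r y \<le> I x" if "r \<in> C" for r
          using that by (intro greatest)
        then have "I (x + y) - I x \<le> r y" if "r \<in> C" for r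
          using that by (metis diff_le_eq add.commute)
        then have "I (x + y) - I x \<le> I y" by (rule greatest)
        then show "I (x + y) \<le> I x + I y" by simp
      next
        obtain q where "q \<in> C" using False by blast
        have "0 \<le> I 0" by (rule greatest) (simp add: sub(3))
        then show "I 0 = 0"
          using lower[OF \<open>q \<in> C\<close>, of 0] sub(3)[OF \<open>q \<in> C\<close>] by simp
      next
        fix t :: real and x assume t: "0 < t"
        have "(1 / t) * I (t *\<^sub>R x) \<le> I x"
        proof (rule greatest)
          fix q assume "q \<in> C"
          then show "(1 / t) * I (t *\<^sub>R x) \<le> q x"
            using lower[of q "t *\<^sub>R x"] sub(2)[of q t x] t by (simp add: field_simps)
        qed
        then show "I (t *\<^sub>R x) \<le> t * I x" using t by (simp add: field_simps)
      qed
      moreover have "I x \<le> p x" for x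
      proof -
        obtain q where "q \<in> C" using False by blast
        then have "q x \<le> p x" using CA by (auto simp: A_def)
        with lower[OF \<open>q \<in> C\<close>, of x] show ?thesis by linarith
      qed
      ultimately show ?thesis
        using lower by (intro bexI[of _ I]) (auto simp: P_def A_def)
    qed
  qed
  then obtain q where q: "sublinear q" "\<And>x. q x \<le> p x" and min: "\<And>r. r \<in> A \<Longrightarrow> P q r \<Longrightarrow> r = q"
    unfolding A_def by blast
  have eq: "shift_inf y q = q" for y
  proof (rule min)
    show "P q (shift_inf y q)" unfolding P_def using shift_inf_le[OF q(1)] by blast
    show "shift_inf y q \<in> A"
      using sublinear_shift_inf[OF q(1), of y] order_trans[OF shift_inf_le[OF q(1)] q(2)] by (auto simp: A_def)
  qed
  \<comment> \<open>Oddness is the form in which minimality is used: subadditivity at -x and -y then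
    gives the missing inequality for x and y.\<close>
  have neg: "q (- y) = - q y" for y
    using shift_inf_minus[OF q(1), of y] sublinear_minus[OF q(1), of y] unfolding eq by simp
  have "linear q"
  proof (rule linearI)
    fix x y
    have "q (x + y) \<le> q x + q y" "q (- x + - y) \<le> q (- x) + q (- y)"
      using q(1) unfolding sublinear_def by blast+
    moreover have "q (- x + - y) = - q (x + y)" using neg[of "x + y"] by simp
    ultimately show "q (x + y) = q x + q y" by (simp add: neg)
  next
    fix t :: real and x
    show "q (t *\<^sub>R x) = t *\<^sub>R q x"
    proof (cases "0 \<le> t")
      case True
      with q(1) show ?thesis by (simp add: sublinear_def)
    next
      case False
      have "\<forall>t\<ge>0. \<forall>x. q (t *\<^sub>R x) = t * q x" using q(1) by (simp add: sublinear_def)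
      then have "q ((- t) *\<^sub>R x) = (- t) * q x" using False by (metis linear neg_0_le_iff_le)
      then show ?thesis using neg[of "t *\<^sub>R x"] by simp
    qed
  qed
  with q(2) show ?thesis by blast
qed

text \<open>Dominating by \<open>shift_inf x0 norm\<close> instead of \<open>norm\<close> forces
  \<open>l (- x0) \<le> - norm x0\<close>, so no functional has to be extended from a
  subspace.\<close>

lemma hahn_banach_norming:
  fixes x0 :: "'e::real_normed_vector"
  shows "\<exists>l. linear l \<and> (\<forall>x. \<bar>l x\<bar> \<le> norm x) \<and> l x0 = norm x0"
proof -
  have nrm: "sublinear (norm :: 'e \<Rightarrow> real)" by (simp add: sublinear_def norm_triangle_ineq)
  obtain l where l: "linear l" "\<And>x. l x \<le> shift_inf x0 norm x"
    using hahn_banach_sublinear[OF sublinear_shift_inf[OF nrm]] by blast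
  have le: "l x \<le> norm x" for x using l(2)[of x] shift_inf_le[OF nrm, of x0 x] by simp
  have "\<bar>l x\<bar> \<le> norm x" for x using le[of x] le[of "- x"] by (simp add: linear_neg[OF l(1)] abs_le_iff)
  moreover have "l (- x0) \<le> - norm x0" using l(2)[of "- x0"] shift_inf_minus[OF nrm, of x0] by simp
  then have "l x0 = norm x0" using le[of x0] by (simp add: linear_neg[OF l(1)])
  ultimately show ?thesis using l(1) by blast
qed

text \<open>Each condition on the right concerns finitely many values of \<open>\<phi>\<close>; in
  this form the ball is seen to be a closed subset of a product.\<close>

lemma dual_ball_iff:
  assumes s: "normed_scaling s"
  shows "\<phi> \<in> dual_ball s \<longleftrightarrow>
    (\<forall>x y. \<phi> (x + y) = \<phi> x + \<phi> y) \<and> (\<forall>c x. \<phi> (s c x) = c * \<phi> x) \<and> (\<forall>x. norm (\<phi> x) \<le> norm x)"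
    (is "_ \<longleftrightarrow> ?R")
proof -
  have vs: "vector_space s" and real: "\<And>r x. s (of_real r) x = r *\<^sub>R x"
    using s by (auto simp: normed_scaling_def)
  have lin_iff: "Vector_Spaces.linear s (*) \<phi> \<longleftrightarrow>
      (\<forall>x y. \<phi> (x + y) = \<phi> x + \<phi> y) \<and> (\<forall>c x. \<phi> (s c x) = c * \<phi> x)"
    using vs vector_space_over_itself.vector_space_axioms
    by (auto simp: Vector_Spaces.linear_def module_hom_iff module_iff_vector_space)
  have lin: "linear \<phi>" if "Vector_Spaces.linear s (*) \<phi>"
  proof (rule linearI)
    fix r x
    have "\<phi> (s (of_real r) x) = of_real r * \<phi> x" using that lin_iff by blast
    then show "\<phi> (r *\<^sub>R x) = r *\<^sub>R \<phi> x" by (simp add: real scaleR_conv_of_real)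
  qed (use that lin_iff in blast)
  show ?thesis
  proof
    assume "\<phi> \<in> dual_ball s"
    then have \<phi>: "Vector_Spaces.linear s (*) \<phi>" "continuous_on UNIV \<phi>" "onorm \<phi> \<le> 1"
      by (auto simp: dual_ball_def continuous_dual_def)
    note l = lin[OF \<phi>(1)]
    \<comment> \<open>Boundedness must come from continuity before \<open>onorm\<close> can be used,
      as the supremum of an unbounded set carries no information.\<close>
    have "isCont \<phi> 0" using \<phi>(2) by (simp add: continuous_on_eq_continuous_at)
    then obtain d where d: "0 < d" "\<And>x. norm x < d \<Longrightarrow> norm (\<phi> x) < 1"
      using linear_0[OF l] unfolding continuous_at_eps_delta
      by (metis dist_0_norm dist_commute zero_less_one)
    have "norm (\<phi> x) \<le> norm x * (2 / d)" for x
    proof (cases "x = 0")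
      case False
      have "norm (\<phi> ((d / (2 * norm x)) *\<^sub>R x)) < 1" using d(1) False by (intro d(2)) simp
      then show ?thesis using d(1) False by (simp add: linear_scale[OF l] field_simps)
    qed (simp add: linear_0[OF l])
    then have "bounded_linear \<phi>"
      using l by (intro bounded_linear_intro[where K = "2 / d"]) (auto simp: linear_add linear_scale)
    then have "norm (\<phi> x) \<le> norm x" for x
      using onorm[of \<phi> x] mult_right_mono[OF \<phi>(3), of "norm x"] by simp
    with \<phi>(1) show ?R unfolding lin_iff by blast
  next
    assume R: ?R
    then have vl: "Vector_Spaces.linear s (*) \<phi>" unfolding lin_iff by blast
    have "bounded_linear \<phi>"
      using lin[OF vl] R by (intro bounded_linear_intro[where K = 1]) (auto simp: linear_add linear_scale)
    moreover have "onorm \<phi> \<le> 1" using R by (intro onorm_bound) auto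
    ultimately show "\<phi> \<in> dual_ball s"
      using vl by (auto simp: dual_ball_def continuous_dual_def intro: linear_continuous_on)
  qed
qed

lemma scalar_embedding:
  obtains f :: "'k::real_or_complex_field \<Rightarrow> complex"
  where "linear f" "\<And>x y. f (x * y) = f x * f y" "\<And>x. norm (f x) = norm x" "f 1 = 1"
    "range f = \<real> \<or> range f = UNIV"
proof -
  obtain f :: "'k \<Rightarrow> complex" where f: "\<And>x y. f (x + y) = f x + f y" "\<And>x y. f (x * y) = f x * f y"
    "\<And>r x. f (r *\<^sub>R x) = r *\<^sub>R f x" "\<And>x. norm (f x) = norm x" "range f = \<real> \<or> range f = UNIV"
    using real_or_complex[where 'a = 'k] by blast
  have "f 1 * f 1 = f 1" "f 1 \<noteq> 0" using f(2)[of 1 1] f(4)[of 1] by auto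
  then have "f 1 = 1" by simp
  with f show thesis by (intro that[of f] linearI) auto
qed

text \<open>The scalars embed isometrically into the complex numbers with closed range, so the ball
  is the image of a compact set under the inverse isometry.\<close>

lemma compact_cball_scalar: "compact (cball (0 :: 'k::real_or_complex_field) r)"
proof -
  obtain f :: "'k \<Rightarrow> complex" where f: "linear f" "\<And>x. norm (f x) = norm x"
    "range f = \<real> \<or> range f = UNIV"
    using scalar_embedding by metis
  have dist: "dist (f x) (f y) = dist x y" for x y
    by (simp add: dist_norm f(2) flip: linear_diff[OF f(1)])
  then have inj: "inj f" by (metis dist_eq_0_iff injI)
  have "closed (range f)" using f(3) closed_complex_Reals by auto
  then have "compact (cball 0 r \<inter> range f)" by (intro compact_Int_closed) auto
  moreover have "cball 0 r \<inter> range f = f ` cball 0 r" by (auto simp: f(2))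
  ultimately have "compact (f ` cball 0 r)" by simp
  moreover have "continuous_on (f ` cball 0 r) (inv f)"
    unfolding continuous_on_iff by (auto simp: inv_f_f[OF inj] dist)
  ultimately have "compact (inv f ` f ` cball 0 r)" by (rule compact_continuous_image[rotated])
  then show ?thesis by (simp add: image_image inv_f_f[OF inj])
qed

text \<open>Banach-Alaoglu: Tychonoff's theorem for the balls of radius \<open>norm x\<close>,
  intersected with the closed linearity conditions of \<open>dual_ball_iff\<close>.\<close>

lemma
  fixes s :: "'k::real_or_complex_field \<Rightarrow> 'e::real_normed_vector \<Rightarrow> 'e"
  assumes s: "normed_scaling s"
  shows compact_space_dual_ball: "compact_space (dual_ball_topology s)"
    and Hausdorff_space_dual_ball: "Hausdorff_space (dual_ball_topology s)"
proof -
  have ev: "continuous_on UNIV (\<lambda>\<phi> :: 'e \<Rightarrow> 'k. \<phi> x)" for x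
    by (rule continuous_on_product_coordinates)
  have "compact (PiE UNIV (\<lambda>x :: 'e. cball (0 :: 'k) (norm x)))"
    unfolding compactin_euclidean_iff[symmetric] euclidean_product_topology[symmetric] compactin_PiE
    by (simp add: compact_cball_scalar)
  moreover have "closed ((\<Inter>(x, y). {\<phi> :: 'e \<Rightarrow> 'k. \<phi> (x + y) = \<phi> x + \<phi> y}) \<inter>
      (\<Inter>(c, x). {\<phi>. \<phi> (s c x) = c * \<phi> x}))"
    by (intro closed_Int closed_INT ballI)
      (auto intro!: closed_Collect_eq continuous_on_add continuous_on_mult continuous_on_const ev)
  ultimately have "compact (PiE UNIV (\<lambda>x :: 'e. cball (0 :: 'k) (norm x)) \<inter>
      ((\<Inter>(x, y). {\<phi> :: 'e \<Rightarrow> 'k. \<phi> (x + y) = \<phi> x + \<phi> y}) \<inter> (\<Inter>(c, x). {\<phi>. \<phi> (s c x) = c * \<phi> x})))"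
    by (rule compact_Int_closed)
  also have "PiE UNIV (\<lambda>x :: 'e. cball (0 :: 'k) (norm x)) \<inter>
      ((\<Inter>(x, y). {\<phi> :: 'e \<Rightarrow> 'k. \<phi> (x + y) = \<phi> x + \<phi> y}) \<inter> (\<Inter>(c, x). {\<phi>. \<phi> (s c x) = c * \<phi> x}))
      = dual_ball s"
    by (auto simp: dual_ball_iff[OF s] PiE_iff)
  finally show "compact_space (dual_ball_topology s)"
    unfolding dual_ball_topology_def by (intro compact_space_subtopology) simp
  show "Hausdorff_space (dual_ball_topology s)"
    unfolding dual_ball_topology_def euclidean_product_topology[symmetric]
    by (intro Hausdorff_space_subtopology) (simp add: Hausdorff_space_product_topology)
qed

lemma topspace_dual_ball: "topspace (dual_ball_topology s) = dual_ball s"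
  by (simp add: dual_ball_topology_def)

text \<open>In the complex case, a real functional \<open>l\<close> is complexified to
  \<open>\<phi> x = (l x - i l (i x)) / 2\<close>. The factor \<open>1/2\<close> keeps it in the unit ball without a rotation
  argument, at the price of the constant 2 in the norming property.\<close>

lemma dual_ball_norming:
  fixes s :: "'k::real_or_complex_field \<Rightarrow> 'e::real_normed_vector \<Rightarrow> 'e"
  assumes s: "normed_scaling s"
  shows "\<exists>\<phi>\<in>dual_ball s. norm x0 \<le> 2 * norm (\<phi> x0)"
proof -
  have vs: "vector_space s" and real: "\<And>r x. s (of_real r) x = r *\<^sub>R x"
    and nrm: "\<And>c x. norm (s c x) = norm c * norm x"
    using s by (auto simp: normed_scaling_def)
  have s_add: "s c (x + y) = s c x + s c y" and s_add': "s (c + d) x = s c x + s d x"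
    and s_mult: "s (c * d) x = s c (s d x)" for c d x y
    using vs by (auto simp: vector_space_def)
  obtain l where l: "linear l" "\<And>x. \<bar>l x\<bar> \<le> norm x" "l x0 = norm x0"
    using hahn_banach_norming[of x0] by blast
  obtain f :: "'k \<Rightarrow> complex" where f: "linear f" "\<And>x y. f (x * y) = f x * f y"
    "\<And>x. norm (f x) = norm x" "f 1 = 1" "range f = \<real> \<or> range f = UNIV"
    by (rule scalar_embedding) (rule that)
  have f_of_real: "f (of_real r) = of_real r" for r
    using linear_scale[OF f(1), of r 1] by (simp only: f(4) of_real_def)
  have inj: "f x = f y \<Longrightarrow> x = y" for x y
    using f(3)[of "x - y"] by (simp add: linear_diff[OF f(1)])
  show ?thesis
    using f(5)
  proof
    assume "range f = \<real>"
    have c_real: "\<exists>r. c = of_real r" for c :: 'k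
    proof -
      have "f c \<in> \<real>" using \<open>range f = \<real>\<close> by auto
      then obtain r where "f c = of_real r" by (auto elim: Reals_cases)
      then show ?thesis using inj[of c "of_real r"] f_of_real by auto
    qed
    have "(\<lambda>x. of_real (l x)) \<in> dual_ball s"
      unfolding dual_ball_iff[OF s]
    proof (intro conjI allI)
      fix c :: 'k and x
      obtain r where "c = of_real r" using c_real by blast
      then show "of_real (l (s c x)) = c * (of_real (l x) :: 'k)" by (simp add: real linear_scale[OF l(1)])
    qed (use l in \<open>auto simp: linear_add\<close>)
    then show ?thesis by (rule bexI[rotated]) (simp add: l(3))
  next
    assume "range f = UNIV"
    then obtain i where i: "f i = \<i>" by (metis rangeE UNIV_I)
    have ii: "i * i = - 1" by (rule inj) (simp add: f(2,4) i linear_neg[OF f(1)])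
    have ni: "norm i = 1" using f(3)[of i] by (simp add: i)
    have decomp: "\<exists>a b. c = of_real a + of_real b * i" for c
    proof (intro exI)
      show "c = of_real (Re (f c)) + of_real (Im (f c)) * i"
        by (rule inj) (simp add: linear_add[OF f(1)] f(2) f_of_real i complex_eq mult.commute)
    qed
    define \<phi> where "\<phi> x = (of_real (l x) - i * of_real (l (s i x))) / 2" for x
    have \<phi>_add: "\<phi> (x + y) = \<phi> x + \<phi> y" for x y
      by (simp add: \<phi>_def s_add linear_add[OF l(1)] field_simps)
    have s_real: "s c (r *\<^sub>R x) = r *\<^sub>R s c x" for c r x
      using s_mult[of c "of_real r" x] s_mult[of "of_real r" c x] by (simp add: real mult.commute)
    have \<phi>_real: "\<phi> (s (of_real r) x) = of_real r * \<phi> x" for r x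
      by (simp add: \<phi>_def real s_real linear_scale[OF l(1)] field_simps)
    have "s (i * i) x = - x" for x using real[of "- 1" x] by (simp add: ii)
    then have \<phi>_i: "\<phi> (s i x) = i * \<phi> x" for x
      using ii by (simp add: \<phi>_def linear_neg[OF l(1)] algebra_simps flip: s_mult mult.assoc)
    have "\<phi> \<in> dual_ball s"
      unfolding dual_ball_iff[OF s]
    proof (intro conjI allI)
      fix c x
      obtain a b where c: "c = of_real a + of_real b * i" using decomp by blast
      show "\<phi> (s c x) = c * \<phi> x"
        unfolding c s_add' \<phi>_add s_mult \<phi>_real \<phi>_i by (simp add: algebra_simps)
    next
      fix x
      have "norm (of_real (l x) - i * of_real (l (s i x)) :: 'k) \<le> \<bar>l x\<bar> + \<bar>l (s i x)\<bar>"
        by (rule order_trans[OF norm_triangle_ineq4]) (simp add: norm_mult ni)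
      also have "\<dots> \<le> 2 * norm x" using l(2)[of x] l(2)[of "s i x"] by (simp add: nrm ni)
      finally show "norm (\<phi> x) \<le> norm x" by (simp add: \<phi>_def norm_divide)
    qed (rule \<phi>_add)
    moreover have "norm x0 \<le> 2 * norm (\<phi> x0)"
    proof -
      have "2 * \<phi> x0 = of_real (l x0) - i * of_real (l (s i x0))" by (simp add: \<phi>_def)
      then have "f (2 * \<phi> x0) = of_real (l x0) - \<i> * of_real (l (s i x0))"
        by (simp only: linear_diff[OF f(1)] f(2) f_of_real i)
      then have "norm (Re (f (2 * \<phi> x0))) = norm x0" by (simp add: l(3))
      then have "norm x0 \<le> norm (f (2 * \<phi> x0))" using abs_Re_le_cmod[of "f (2 * \<phi> x0)"] by simp
      then show ?thesis by (simp add: f(3) norm_mult)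
    qed
    ultimately show ?thesis by blast
  qed
qed

lemma norming_functionals_dual_ball:
  fixes s :: "'k::real_or_complex_field \<Rightarrow> 'e::real_normed_vector \<Rightarrow> 'e"
  assumes s: "normed_scaling s"
  shows "norming_functionals (dual_ball s)"
proof (rule norming_functionals.intro)
  show "dual_ball s \<noteq> {}" using dual_ball_norming[OF s] by blast
next
  fix \<phi> assume \<phi>: "\<phi> \<in> dual_ball s"
  show "linear \<phi>"
  proof (rule linearI)
    fix r x
    have "\<phi> (s (of_real r) x) = of_real r * \<phi> x" using \<phi> dual_ball_iff[OF s] by blast
    then show "\<phi> (r *\<^sub>R x) = r *\<^sub>R \<phi> x"
      using s by (simp add: normed_scaling_def scaleR_conv_of_real)
  qed (use \<phi> dual_ball_iff[OF s] in blast)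
  show "norm (\<phi> x) \<le> norm x" for x using \<phi> dual_ball_iff[OF s] by blast
next
  fix x :: 'e and b assume b: "\<And>\<phi>. \<phi> \<in> dual_ball s \<Longrightarrow> norm (\<phi> x) \<le> b"
  obtain \<phi> where "\<phi> \<in> dual_ball s" "norm x \<le> 2 * norm (\<phi> x)" using dual_ball_norming[OF s] by blast
  with b[of \<phi>] show "norm x \<le> 2 * b" by simp
next
  obtain f :: "'k \<Rightarrow> complex" where f: "linear f" "\<And>x. norm (f x) = norm x"
    using scalar_embedding by metis
  have "linear (\<lambda>z. Re (f z))" "linear (\<lambda>z. Im (f z))"
    by (auto intro!: linearI simp: linear_add[OF f(1)] linear_scale[OF f(1)])
  moreover have "(norm z)\<^sup>2 = (Re (f z))\<^sup>2 + (Im (f z))\<^sup>2" for z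
    unfolding f(2)[symmetric] by (rule cmod_power2)
  ultimately show "\<exists>re im :: 'k \<Rightarrow> real. linear re \<and> linear im \<and> (\<forall>z. (norm z)\<^sup>2 = (re z)\<^sup>2 + (im z)\<^sup>2)"
    by blast
qed

section \<open>Summing and dominated polynomials\<close>

text \<open>The definition works with roots, a supremum and indices from 1 to k. Its constant
  \<open>C\<close> becomes \<open>C powr p\<close>, increased by 1 to be positive, and
  \<open>A\<close> becomes \<open>A powr (1 / p)\<close> on the way back.\<close>

lemma summing_inequality_iff:
  fixes s :: "'k::real_or_complex_field \<Rightarrow> 'e::real_normed_vector \<Rightarrow> 'e"
  assumes s: "normed_scaling s" and "0 < p" and N: "pos_homogeneous N"
  shows "(\<exists>C\<ge>0. \<forall>k. \<forall>x :: nat \<Rightarrow> 'e. (\<Sum>j=1..k. N (x j) powr p) powr (1 / p)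
       \<le> C * (SUP \<phi>\<in>dual_ball s. (\<Sum>j=1..k. norm (\<phi> (x j)) powr p) powr (1 / p)))
     \<longleftrightarrow> (\<exists>A>0. p_summing_on (dual_ball s) p A N)" (is "?L \<longleftrightarrow> ?R")
proof -
  interpret norming_functionals "dual_ball s" by (rule norming_functionals_dual_ball[OF s])
  let ?w = "\<lambda>(k :: nat) x. SUP \<phi>\<in>dual_ball s. (\<Sum>j=1..k. norm (\<phi> (x j)) powr p) powr (1 / p)"
  have cancel: "(a powr (1 / p)) powr p = a" "(a powr p) powr (1 / p) = a" if "0 \<le> a" for a
    using that \<open>0 < p\<close> by (auto simp: powr_powr)
  have sum0: "0 \<le> (\<Sum>j=1..k. f j powr p)" for k and f :: "nat \<Rightarrow> real"
    by (intro sum_nonneg) auto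
  show ?thesis
  proof
    assume ?L
    then obtain C where "0 \<le> C" and C: "\<forall>k. \<forall>x :: nat \<Rightarrow> 'e. (\<Sum>j=1..k. N (x j) powr p) powr (1 / p) \<le> C * ?w k x"
      by (elim exE conjE) (rule that)
    have "p_summing_on (dual_ball s) p (C powr p) N"
      unfolding p_summing_on_def
    proof (intro allI impI)
      fix k :: nat and x :: "nat \<Rightarrow> 'e" and W
      assume W: "\<forall>\<phi>\<in>dual_ball s. (\<Sum>j<k. norm (\<phi> (x j)) powr p) \<le> W"
      let ?x = "\<lambda>j. x (j - 1)"
      have shift: "(\<Sum>j=1..k. f (j - 1)) = (\<Sum>j<k. f j)" for f :: "nat \<Rightarrow> real"
        by (simp add: sum.atLeast1_atMost_eq)
      obtain \<phi> where "\<phi> \<in> dual_ball s" using D_nonempty by blast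
      with W have W0: "0 \<le> W" using sum_nonneg[of "{..<k}" "\<lambda>j. norm (\<phi> (x j)) powr p"] by force
      have "?w k ?x \<le> W powr (1 / p)"
      proof (rule cSUP_least[OF D_nonempty])
        fix \<phi> assume "\<phi> \<in> dual_ball s"
        then show "(\<Sum>j=1..k. norm (\<phi> (?x j)) powr p) powr (1 / p) \<le> W powr (1 / p)"
          unfolding shift[of "\<lambda>j. norm (\<phi> (x j)) powr p"]
          using W \<open>0 < p\<close> by (intro powr_mono2) (auto simp: sum_nonneg)
      qed
      then have "(\<Sum>j=1..k. N (?x j) powr p) powr (1 / p) \<le> C * W powr (1 / p)"
        using order_trans[OF C[THEN spec, of k, THEN spec, of ?x] mult_left_mono[OF _ \<open>0 \<le> C\<close>]] by blast
      then have "((\<Sum>j<k. N (x j) powr p) powr (1 / p)) powr p \<le> (C * W powr (1 / p)) powr p"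
        unfolding shift[of "\<lambda>j. N (x j) powr p"] using \<open>0 < p\<close> by (intro powr_mono2) auto
      then show "(\<Sum>j<k. N (x j) powr p) \<le> C powr p * W"
        using \<open>0 \<le> C\<close> W0 by (simp add: powr_mult cancel sum_nonneg)
    qed
    then have "p_summing_on (dual_ball s) p (C powr p + 1) N"
      by (rule p_summing_on_mono) (use D_nonempty in auto)
    then show ?R by (intro exI[of _ "C powr p + 1"]) (auto simp: add_nonneg_pos)
  next
    assume ?R
    then obtain A where "0 < A" and A: "p_summing_on (dual_ball s) p A N" by blast
    have "(\<Sum>j=1..k. N (x j) powr p) powr (1 / p) \<le> A powr (1 / p) * ?w k x" for k and x :: "nat \<Rightarrow> 'e"
    proof -
      let ?q = "\<lambda>\<phi>. (\<Sum>j=1..k. norm (\<phi> (x j)) powr p) powr (1 / p)"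
      have "bdd_above (?q ` dual_ball s)"
        by (rule bdd_aboveI2[where M = "(\<Sum>j=1..k. norm (x j) powr p) powr (1 / p)"])
          (use \<open>0 < p\<close> D_bound in \<open>auto intro!: powr_mono2 sum_mono sum_nonneg\<close>)
      then have le: "?q \<phi> \<le> ?w k x" if "\<phi> \<in> dual_ball s" for \<phi>
        using that by (intro cSUP_upper)
      obtain \<phi> where "\<phi> \<in> dual_ball s" using D_nonempty by blast
      with le have w0: "0 \<le> ?w k x" by (meson order_trans powr_ge_zero)
      have "(\<Sum>j<k. N (x (Suc j)) powr p) \<le> A * ?w k x powr p"
      proof (rule p_summing_onD[OF A])
        fix \<phi> assume "\<phi> \<in> dual_ball s"
        then have "?q \<phi> powr p \<le> ?w k x powr p" using le \<open>0 < p\<close> by (intro powr_mono2) auto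
        then show "(\<Sum>j<k. norm (\<phi> (x (Suc j))) powr p) \<le> ?w k x powr p"
          unfolding cancel(1)[OF sum0] by (simp add: sum.atLeast1_atMost_eq)
      qed
      then have "(\<Sum>j=1..k. N (x j) powr p) \<le> A * ?w k x powr p"
        by (simp add: sum.atLeast1_atMost_eq)
      then have "(\<Sum>j=1..k. N (x j) powr p) powr (1 / p) \<le> (A * ?w k x powr p) powr (1 / p)"
        using \<open>0 < p\<close> sum0 by (intro powr_mono2) auto
      also have "\<dots> = A powr (1 / p) * ?w k x"
        using \<open>0 < A\<close> w0 by (subst powr_mult) (auto simp: cancel)
      finally show ?thesis .
    qed
    then show ?L by (intro exI[of _ "A powr (1 / p)"]) auto
  qed
qed

text \<open>Homogeneity is demanded only for \<open>u\<close> that map into \<open>G\<close> and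
  respect scalars, since \<open>nrm\<close> need not behave well on functions outside
  \<open>G\<close>. For other \<open>u\<close> both sides are false.\<close>

lemma absolutely_summing_cotype2:
  fixes s :: "'k::real_or_complex_field \<Rightarrow> 'e::real_normed_vector \<Rightarrow> 'e"
  assumes s: "normed_scaling s" and cot: "has_cotype TYPE('e) 2" and p: "0 < p" "p \<le> 2"
    and hom: "\<forall>x. u x \<in> G \<Longrightarrow> \<forall>c x. u (s c x) = sG c (u x) \<Longrightarrow> pos_homogeneous (\<lambda>x. nrm (u x))"
  shows "absolutely_summing p s G add sG nrm u \<longleftrightarrow> absolutely_summing 2 s G add sG nrm u"
proof (cases "(\<forall>x. u x \<in> G) \<and> (\<forall>c x. u (s c x) = sG c (u x))")
  case True
  then have N: "pos_homogeneous (\<lambda>x. nrm (u x))" using hom by blast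
  interpret norming_functionals "dual_ball s" by (rule norming_functionals_dual_ball[OF s])
  obtain C where C: "0 < C" "finite_cotype2 TYPE('e) C"
    using has_cotype_imp_finite_cotype2[OF cot] by blast
  have "(\<exists>A>0. p_summing_on (dual_ball s) p A (\<lambda>x. nrm (u x))) \<longleftrightarrow>
      (\<exists>A>0. p_summing_on (dual_ball s) 2 A (\<lambda>x. nrm (u x)))"
    using p_summing_on_inclusion[OF p _ _ N D_scale] two_summing_imp_p_summing[OF C(2,1) p _ _ N]
    by blast
  then show ?thesis
    unfolding absolutely_summing_def using summing_inequality_iff[OF s _ N, of p]
      summing_inequality_iff[OF s _ N, of 2] p(1) by simp
next
  case False
  then show ?thesis unfolding absolutely_summing_def by blast
qed

text \<open>Linearity is used one slot at a time along the sequences \<open>z j\<close>. The entries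
  from k on are set to 0 so that, for small c, the whole sequence can be close to 0 in the product
  topology.\<close>

lemma multilinear_maps_scale:
  assumes A: "A \<in> multilinear_maps k sE sF" and sE: "normed_scaling sE" and sF: "normed_scaling sF"
  shows "A (\<lambda>i. if i < k then c *\<^sub>R x i else 0) = c ^ k *\<^sub>R A x"
proof -
  define z where "z j = (\<lambda>i. if i < j then c *\<^sub>R x i else x i)" for j
  have "A (z j) = c ^ j *\<^sub>R A x" if "j \<le> k" for j
    using that
  proof (induction j)
    case (Suc j)
    have "Vector_Spaces.linear sE sF (\<lambda>v. A ((z j)(j := v)))"
      using A Suc.prems by (auto simp: multilinear_maps_def)
    then have lin: "A ((z j)(j := sE (of_real c) (x j))) = sF (of_real c) (A ((z j)(j := x j)))"
      by (simp add: Vector_Spaces.linear_def module_hom_iff)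
    have "z (Suc j) = (z j)(j := c *\<^sub>R x j)" and zj: "(z j)(j := x j) = z j"
      by (auto simp: z_def fun_eq_iff less_Suc_eq)
    then have "A (z (Suc j)) = A ((z j)(j := sE (of_real c) (x j)))"
      using sE by (simp only: normed_scaling_def)
    also have "\<dots> = c *\<^sub>R A (z j)"
      unfolding lin zj using sF by (simp only: normed_scaling_def)
    finally show ?case using Suc by simp
  qed (simp add: z_def)
  moreover have "A (\<lambda>i. if i < k then c *\<^sub>R x i else 0) = A (z k)"
    using A by (auto simp: multilinear_maps_def z_def)
  ultimately show ?thesis by simp
qed

text \<open>Continuity at 0 provides a basic box whose first k sides contain balls of radius
  exceeding \<open>e\<close>; scaling by \<open>e\<close> brings the sequences of the unit ball into
  the box. The bound makes the supremum in \<open>multilinear_norm\<close> meaningful.\<close>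

lemma multilinear_maps_bounded:
  fixes A :: "(nat \<Rightarrow> 'e::real_normed_vector) \<Rightarrow> 'f::real_normed_vector"
  assumes A: "A \<in> multilinear_maps k sE sF" and sE: "normed_scaling sE" and sF: "normed_scaling sF"
  shows "bdd_above ((\<lambda>x. norm (A x)) ` {x. \<forall>i<k. norm (x i) \<le> 1})"
proof -
  define b where "b = norm (A (\<lambda>_. 0)) + 1"
  have "continuous_on UNIV A" using A by (simp add: multilinear_maps_def)
  then have "open {x. norm (A x) < b}" by (intro open_Collect_less continuous_on_norm continuous_on_const)
  then obtain X where X: "(\<lambda>_. 0) \<in> PiE UNIV X" "\<And>i. open (X i)" "PiE UNIV X \<subseteq> {x. norm (A x) < b}"
    using product_topology_open_contains_basis[of "\<lambda>_. euclidean" UNIV "{x. norm (A x) < b}" "\<lambda>_. 0"]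
    by (auto simp: euclidean_product_topology b_def)
  have "\<exists>d>0. ball 0 d \<subseteq> X i" for i
    using X(1) X(2)[of i] by (auto simp: PiE_iff open_contains_ball)
  then obtain d where d: "\<And>i. 0 < d i" "\<And>i. ball 0 (d i) \<subseteq> X i" by metis
  \<comment> \<open>Halving makes \<open>e < d i\<close> strict, and inserting 1 covers k =
    0.\<close>
  define e where "e = Min (insert 1 (d ` {..<k})) / 2"
  have "0 < Min (insert 1 (d ` {..<k}))" using d(1) by (subst Min_gr_iff) auto
  then have "0 < e" by (simp add: e_def)
  have "e < d i" if "i < k" for i
  proof -
    have "Min (insert 1 (d ` {..<k})) \<le> d i" using that by (intro Min_le) auto
    with \<open>0 < Min (insert 1 (d ` {..<k}))\<close> show ?thesis unfolding e_def by linarith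
  qed
  note e_less = this
  have "norm (A x) \<le> b / e ^ k" if "\<forall>i<k. norm (x i) \<le> 1" for x
  proof -
    let ?y = "\<lambda>i. if i < k then e *\<^sub>R x i else 0"
    have "?y i \<in> X i" for i
    proof (cases "i < k")
      case True
      then have "e * norm (x i) \<le> e" using that \<open>0 < e\<close> by simp
      then have "e * norm (x i) < d i" using e_less[OF True] by linarith
      then have "e *\<^sub>R x i \<in> ball 0 (d i)" using \<open>0 < e\<close> by simp
      then have "e *\<^sub>R x i \<in> X i" using d(2)[of i] by blast
      with True show ?thesis by simp
    qed (use X(1) in \<open>auto simp: PiE_iff\<close>)
    then have "?y \<in> PiE UNIV X" by (simp add: PiE_iff)
    then have "norm (A ?y) < b" using X(3) by blast
    then show ?thesis
      unfolding multilinear_maps_scale[OF assms] using \<open>0 < e\<close> by (simp add: field_simps)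
  qed
  then show ?thesis by (intro bdd_aboveI2) auto
qed

lemma multilinear_norm_nonneg:
  assumes "A \<in> multilinear_maps k sE sF" "normed_scaling sE" "normed_scaling sF"
  shows "0 \<le> multilinear_norm k A"
proof -
  have "norm (A (\<lambda>_. 0)) \<le> multilinear_norm k A"
    unfolding multilinear_norm_def by (rule cSUP_upper[OF _ multilinear_maps_bounded[OF assms]]) simp
  then show ?thesis by (meson norm_ge_zero order_trans)
qed

lemma multilinear_norm_scale:
  fixes A :: "(nat \<Rightarrow> 'e::real_normed_vector) \<Rightarrow> 'f::real_normed_vector"
  assumes A: "A \<in> multilinear_maps k sE sF" "normed_scaling sE" "normed_scaling sF" and "0 \<le> t"
  shows "multilinear_norm k (\<lambda>y. t *\<^sub>R A y) = t * multilinear_norm k A"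
proof (cases "t = 0")
  case True
  have "{x :: nat \<Rightarrow> 'e. \<forall>i<k. norm (x i) \<le> 1} \<noteq> {}" by (auto intro!: exI[of _ "\<lambda>_. 0"])
  from cSUP_const[OF this, of "0 :: real"] True show ?thesis by (simp add: multilinear_norm_def)
next
  case False
  with \<open>0 \<le> t\<close> have t: "0 < t" by simp
  let ?S = "{x :: nat \<Rightarrow> 'e. \<forall>i<k. norm (x i) \<le> 1}"
  have ne: "?S \<noteq> {}" by (auto intro!: exI[of _ "\<lambda>_. 0"])
  have up: "norm (A x) \<le> multilinear_norm k A" if "x \<in> ?S" for x
    unfolding multilinear_norm_def by (rule cSUP_upper[OF that multilinear_maps_bounded[OF A]])
  then have le: "norm (t *\<^sub>R A x) \<le> t * multilinear_norm k A" if "x \<in> ?S" for x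
    using that t by simp
  have up': "norm (t *\<^sub>R A x) \<le> multilinear_norm k (\<lambda>y. t *\<^sub>R A y)" if "x \<in> ?S" for x
    unfolding multilinear_norm_def using le by (intro cSUP_upper[OF that] bdd_aboveI2)
  show ?thesis
  proof (rule antisym)
    show "multilinear_norm k (\<lambda>y. t *\<^sub>R A y) \<le> t * multilinear_norm k A"
      unfolding multilinear_norm_def[of k "\<lambda>y. t *\<^sub>R A y"] by (rule cSUP_least[OF ne le])
    have "multilinear_norm k A \<le> multilinear_norm k (\<lambda>y. t *\<^sub>R A y) / t"
      unfolding multilinear_norm_def[of k A]
      by (rule cSUP_least[OF ne]) (use up' t in \<open>simp add: field_simps\<close>)
    then show "t * multilinear_norm k A \<le> multilinear_norm k (\<lambda>y. t *\<^sub>R A y)"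
      using t by (simp add: field_simps)
  qed
qed

text \<open>The equivalence holds for every map \<open>u\<close> into the multilinear maps, in
  particular for the one that fills slot i of the polar form. For n = 1 the target is the space F
  itself.\<close>

lemma as_polynomials_cotype2:
  fixes sE :: "'k::real_or_complex_field \<Rightarrow> 'e::real_normed_vector \<Rightarrow> 'e"
    and sF :: "'k \<Rightarrow> 'f::real_normed_vector \<Rightarrow> 'f"
  assumes sE: "normed_scaling sE" and cot: "has_cotype TYPE('e) 2" and sF: "normed_scaling sF"
    and p: "0 < p" "p \<le> 2"
  shows "as_polynomials p n sE sF = as_polynomials 2 n sE sF"
proof -
  have real: "sE (of_real r) x = r *\<^sub>R x" "sF (of_real r) y = r *\<^sub>R y" for r x y
    using sE sF by (auto simp: normed_scaling_def)
  have "absolutely_summing p sE UNIV (+) sF norm P \<longleftrightarrow> absolutely_summing 2 sE UNIV (+) sF norm P"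
    for P :: "'e \<Rightarrow> 'f"
  proof (rule absolutely_summing_cotype2[OF sE cot p])
    assume h: "\<forall>c x. P (sE c x) = sF c (P x)"
    have "P (t *\<^sub>R x) = t *\<^sub>R P x" for t x using h[rule_format, of "of_real t" x] by (simp add: real)
    then show "pos_homogeneous (\<lambda>x. norm (P x))" by (simp add: pos_homogeneous_def)
  qed
  moreover have "absolutely_summing p sE (multilinear_maps k sE sF) (\<lambda>A B y. A y + B y)
        (\<lambda>c A y. sF c (A y)) (multilinear_norm k) u \<longleftrightarrow>
      absolutely_summing 2 sE (multilinear_maps k sE sF) (\<lambda>A B y. A y + B y)
        (\<lambda>c A y. sF c (A y)) (multilinear_norm k) u"
    for k and u :: "'e \<Rightarrow> (nat \<Rightarrow> 'e) \<Rightarrow> 'f"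
  proof (rule absolutely_summing_cotype2[OF sE cot p])
    assume mem: "\<forall>x. u x \<in> multilinear_maps k sE sF" and h: "\<forall>c x. u (sE c x) = (\<lambda>y. sF c (u x y))"
    have "u (t *\<^sub>R x) = (\<lambda>y. t *\<^sub>R u x y)" for t x
      using h[rule_format, of "of_real t" x] by (simp add: real)
    then show "pos_homogeneous (\<lambda>x. multilinear_norm k (u x))"
      using multilinear_norm_nonneg[OF mem[rule_format] sE sF]
        multilinear_norm_scale[OF mem[rule_format] sE sF]
      by (simp add: pos_homogeneous_def)
  qed
  ultimately show ?thesis unfolding as_polynomials_def by simp
qed

section \<open>Change of exponent for dominated polynomials\<close>

context
  fixes s :: "'k::real_or_complex_field \<Rightarrow> 'e::real_normed_vector \<Rightarrow> 'e"
  assumes s: "normed_scaling s"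
begin

lemma continuous_map_eval_powr:
  "0 < p \<Longrightarrow> continuous_map (dual_ball_topology s) euclideanreal (\<lambda>\<phi>. norm (\<phi> x) powr p)"
  unfolding dual_ball_topology_def continuous_map_iff_continuous
  by (intro continuous_on_powr' continuous_on_norm continuous_on_const
      continuous_on_subset[OF continuous_on_product_coordinates]) auto

lemma integrable_eval_powr:
  assumes "regular_borel_prob (dual_ball_topology s) \<mu>" and "0 < p"
  shows "integrable \<mu> (\<lambda>\<phi>. norm (\<phi> x) powr p)"
proof -
  interpret prob_space \<mu> using assms(1) by (simp add: regular_borel_prob_def)
  have "space \<mu> = dual_ball s"
    using assms(1) by (simp add: regular_borel_prob_def topspace_dual_ball)
  then show ?thesis
    using regular_borel_prob_measurable[OF assms(1) continuous_map_eval_powr[OF assms(2)]]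
      dual_ball_iff[OF s] assms(2)
    by (intro integrable_const_bound[of _ "norm x powr p"]) (auto intro!: powr_mono2)
qed

text \<open>The measure is kept, and its p-th moments are controlled by its second moments:
  \<open>moment\<close> proves this with the constant 2 by integrating \<open>powr_mix_le\<close> at
  \<eta> = 1.\<close>

lemma dominated_polynomials_mono:
  fixes sF :: "'k \<Rightarrow> 'f::real_normed_vector \<Rightarrow> 'f"
  assumes p: "0 < p" "p \<le> 2"
  shows "dominated_polynomials p n s sF \<subseteq> dominated_polynomials 2 n s sF"
proof
  fix P assume "P \<in> dominated_polynomials p n s sF"
  then obtain C \<mu> where P: "P \<in> polynomials n s sF" "0 \<le> C"
    and \<mu>: "regular_borel_prob (dual_ball_topology s) \<mu>"
    and dom: "\<And>x. norm (P x) \<le> C * (LINT \<phi>|\<mu>. norm (\<phi> x) powr p) powr (real n / p)"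
    unfolding dominated_polynomials_def by blast
  interpret prob_space \<mu> using \<mu> by (simp add: regular_borel_prob_def)
  have moment: "(LINT \<phi>|\<mu>. norm (\<phi> x) powr p) \<le> 2 * (LINT \<phi>|\<mu>. norm (\<phi> x) powr 2) powr (p / 2)" for x
  proof -
    let ?B = "LINT \<phi>|\<mu>. norm (\<phi> x) powr p" and ?Q = "LINT \<phi>|\<mu>. norm (\<phi> x) powr 2"
    have Q0: "0 \<le> ?Q" by simp
    have ineq: "y powr (2 - p) * ?B \<le> y powr 2 + ?Q" if "0 \<le> y" for y
    proof -
      have "(LINT \<phi>|\<mu>. y powr (2 - p) * norm (\<phi> x) powr p) \<le> (LINT \<phi>|\<mu>. y powr 2 + norm (\<phi> x) powr 2)"
        using p that powr_mix_le[of p 2 _ y 1]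
        by (intro integral_mono integrable_mult_right Bochner_Integration.integrable_add
            integrable_eval_powr[OF \<mu>]) auto
      then show ?thesis using integrable_eval_powr[OF \<mu>, of 2 x] by (simp add: prob_space)
    qed
    show ?thesis
    proof (cases "?Q = 0")
      case True
      have "?B \<le> 0"
      proof (rule ccontr)
        assume "\<not> ?thesis"
        then have B: "0 < ?B" by simp
        \<comment> \<open>If the second moment is 0, any positive y with y^p < B contradicts
          \<open>ineq\<close>; this one has y^p = B / 2.\<close>
        define y where "y = (?B / 2) powr (1 / p)"
        have y: "0 < y" "y powr p = ?B / 2" using B p by (auto simp: y_def powr_powr)
        have "y powr (2 - p) * ?B \<le> y powr (2 - p) * y powr p"
          using ineq[of y] y(1) True by (simp add: powr_add[symmetric])
        then have "?B \<le> ?B / 2" using y by simp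
        with B show False by simp
      qed
      moreover have "0 \<le> 2 * ?Q powr (p / 2)" by simp
      ultimately show ?thesis by linarith
    next
      case False
      then have Q: "0 < ?Q" using Q0 by (metis order_le_less)
      \<comment> \<open>At this y the two terms on the right of \<open>ineq\<close> are
        equal.\<close>
      define y where "y = ?Q powr (1 / 2)"
      have y: "0 < y" "y powr 2 = ?Q" "y powr p = ?Q powr (p / 2)"
        unfolding y_def using Q by (simp_all add: powr_powr)
      have "y powr (2 - p) * ?B \<le> y powr (2 - p) * (2 * y powr p)"
        using ineq[of y] y(1,2) by (simp add: mult.left_commute powr_add[symmetric])
      then show ?thesis using y(1) unfolding y(3) by simp
    qed
  qed
  have "norm (P x) \<le> (C * 2 powr (n / p)) * (LINT \<phi>|\<mu>. norm (\<phi> x) powr 2) powr (real n / 2)" for x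
  proof -
    let ?Q = "LINT \<phi>|\<mu>. norm (\<phi> x) powr 2"
    have "norm (P x) \<le> C * (2 * ?Q powr (p / 2)) powr (n / p)"
      using p \<open>0 \<le> C\<close> moment by (intro order_trans[OF dom] mult_left_mono powr_mono2) auto
    also have "(2 * ?Q powr (p / 2)) powr (n / p) = 2 powr (n / p) * ?Q powr (n / 2)"
      using p by (simp add: powr_mult powr_powr)
    finally show ?thesis by (simp add: mult.assoc)
  qed
  with P \<mu> show "P \<in> dominated_polynomials 2 n s sF"
    unfolding dominated_polynomials_def
    by (intro CollectI conjI exI[of _ "C * 2 powr (n / p)"] exI[of _ \<mu>]) auto
qed

text \<open>The L_2 norm \<open>N\<close> of the given measure is 2-summing with constant 1, by
  integrating the test sums, and P is bounded by C times the n-th power of \<open>N\<close>. So the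
  exponent is changed for \<open>N\<close>, and the degree enters through the final power.\<close>

lemma dominated_polynomials_cotype2:
  fixes sF :: "'k \<Rightarrow> 'f::real_normed_vector \<Rightarrow> 'f"
  assumes cot: "has_cotype TYPE('e) 2" and p: "0 < p" "p \<le> 2"
  shows "dominated_polynomials 2 n s sF \<subseteq> dominated_polynomials p n s sF"
proof
  let ?T = "dual_ball_topology s"
  interpret norming_functionals "dual_ball s" by (rule norming_functionals_dual_ball[OF s])
  fix P assume "P \<in> dominated_polynomials 2 n s sF"
  then obtain C \<mu> where P: "P \<in> polynomials n s sF" "0 \<le> C"
    and \<mu>: "regular_borel_prob ?T \<mu>"
    and dom: "\<And>x. norm (P x) \<le> C * (LINT \<phi>|\<mu>. norm (\<phi> x) powr 2) powr (real n / 2)"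
    unfolding dominated_polynomials_def by blast
  interpret prob_space \<mu> using \<mu> by (simp add: regular_borel_prob_def)
  have space: "space \<mu> = dual_ball s" using \<mu> by (simp add: regular_borel_prob_def topspace_dual_ball)
  define N where "N x = (LINT \<phi>|\<mu>. norm (\<phi> x) powr 2) powr (1 / 2)" for x
  have N2: "N x powr 2 = (LINT \<phi>|\<mu>. norm (\<phi> x) powr 2)" for x by (simp add: N_def powr_powr)
  have "(LINT \<phi>|\<mu>. norm (\<phi> (t *\<^sub>R x)) powr 2) = t powr 2 * (LINT \<phi>|\<mu>. norm (\<phi> x) powr 2)"
    if "0 \<le> t" for t x
    unfolding integral_mult_right_zero[symmetric]
    by (rule Bochner_Integration.integral_cong) (use that in \<open>auto simp: space D_scale powr_mult\<close>)
  then have N: "pos_homogeneous N"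
    by (auto simp: pos_homogeneous_def N_def powr_mult powr_powr)
  have "p_summing_on (dual_ball s) 2 1 N"
    unfolding p_summing_on_def
  proof (intro allI impI)
    fix k :: nat and x :: "nat \<Rightarrow> 'e" and W
    assume W: "\<forall>\<phi>\<in>dual_ball s. (\<Sum>j<k. norm (\<phi> (x j)) powr 2) \<le> W"
    have int: "integrable \<mu> (\<lambda>\<phi>. norm (\<phi> (x j)) powr 2)" for j
      by (rule integrable_eval_powr[OF \<mu>]) simp
    have "(\<Sum>j<k. N (x j) powr 2) = (LINT \<phi>|\<mu>. (\<Sum>j<k. norm (\<phi> (x j)) powr 2))"
      unfolding N2 by (rule Bochner_Integration.integral_sum[OF int, symmetric])
    also have "\<dots> \<le> (LINT \<phi>|\<mu>. W)"
      using W by (intro integral_mono Bochner_Integration.integrable_sum int) (auto simp: space)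
    finally show "(\<Sum>j<k. N (x j) powr 2) \<le> 1 * W" by (simp add: prob_space)
  qed
  moreover obtain c where "0 < c" "finite_cotype2 TYPE('e) c"
    using has_cotype_imp_finite_cotype2[OF cot] by blast
  ultimately obtain A where "0 < A" and A: "p_summing_on (dual_ball s) p A N"
    using two_summing_imp_p_summing[OF _ _ p _ zero_less_one N] by blast
  \<comment> \<open>The family is indexed by all of E: one measure must work at every x, while
    \<open>finite_domination\<close> handles finitely many x at a time.\<close>
  have "\<exists>\<nu>. regular_borel_prob ?T \<nu> \<and> (\<forall>x. N x powr p \<le> (LINT \<phi>|\<nu>. A * norm (\<phi> x) powr p))"
  proof (rule regular_measure_from_finite_means[where b = "\<lambda>x. A * norm x powr p"])
    show "compact_space ?T" "Hausdorff_space ?T"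
      using compact_space_dual_ball[OF s] Hausdorff_space_dual_ball[OF s] by auto
    show "continuous_map ?T euclideanreal (\<lambda>\<phi>. A * norm (\<phi> x) powr p)" for x
      by (intro continuous_map_real_mult continuous_map_eval_powr p) simp
    show "0 \<le> A * norm (\<phi> x) powr p \<and> A * norm (\<phi> x) powr p \<le> A * norm x powr p"
      if "\<phi> \<in> topspace ?T" for x \<phi>
      using that D_bound p \<open>0 < A\<close> by (auto simp: topspace_dual_ball intro!: powr_mono2)
  next
    fix I :: "'e set" and \<epsilon> :: real assume "finite I" "0 < \<epsilon>"
    then obtain xs where xs: "set xs = I" by (meson finite_list)
    have "\<exists>L\<in>finite_means (dual_ball s). \<forall>j<length xs.
        N (xs ! j) powr p \<le> A * L (\<lambda>\<phi>. norm (\<phi> (xs ! j)) powr p) + \<epsilon>"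
      by (rule finite_domination[OF p(1) A]) (simp_all add: \<open>0 < A\<close> \<open>0 < \<epsilon>\<close> D_nonempty N D_scale D_bound)
    then show "\<exists>L\<in>finite_means (topspace ?T). \<forall>x\<in>I. N x powr p \<le> L (\<lambda>\<phi>. A * norm (\<phi> x) powr p) + \<epsilon>"
      unfolding topspace_dual_ball xs[symmetric] by (metis finite_means_scale in_set_conv_nth)
  qed
  then obtain \<nu> where \<nu>: "regular_borel_prob ?T \<nu>"
    and N_le: "\<And>x. N x powr p \<le> A * (LINT \<phi>|\<nu>. norm (\<phi> x) powr p)" by auto
  have "norm (P x) \<le> (C * A powr (n / p)) * (LINT \<phi>|\<nu>. norm (\<phi> x) powr p) powr (real n / p)" for x
  proof -
    let ?B = "LINT \<phi>|\<nu>. norm (\<phi> x) powr p"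
    have "(LINT \<phi>|\<mu>. norm (\<phi> x) powr 2) powr (real n / 2) = (N x powr p) powr (n / p)"
      using p by (simp add: N_def powr_powr)
    also have "\<dots> \<le> (A * ?B) powr (n / p)" using N_le p by (intro powr_mono2) auto
    also have "\<dots> = A powr (n / p) * ?B powr (n / p)" using \<open>0 < A\<close> by (simp add: powr_mult)
    finally show ?thesis
      using order_trans[OF dom mult_left_mono[OF _ \<open>0 \<le> C\<close>]] by (simp add: mult.assoc)
  qed
  with P \<nu> show "P \<in> dominated_polynomials p n s sF"
    unfolding dominated_polynomials_def
    by (intro CollectI conjI exI[of _ "C * A powr (n / p)"] exI[of _ \<nu>]) auto
qed

end

theorem proposition2:
  fixes sE :: "'k::real_or_complex_field \<Rightarrow> 'e::banach \<Rightarrow> 'e"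
    and sF :: "'k \<Rightarrow> 'f::banach \<Rightarrow> 'f"
    and n :: nat and p :: real
  assumes "normed_scaling sE"
    and "has_cotype TYPE('e) 2"
    and "normed_scaling sF"
    and "1 \<le> n"
    and "0 < p" and "p \<le> 2"
  shows "as_polynomials p n sE sF = as_polynomials 2 n sE sF \<and>
    dominated_polynomials p n sE sF = dominated_polynomials 2 n sE sF"
  using assms as_polynomials_cotype2 dominated_polynomials_mono dominated_polynomials_cotype2
  by (metis subset_antisym)

end
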